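(* For any skew diagram $\lambda/\mu$ satisfying the positivity condition $\lambda'_{i+1}-\mu'_i\le n$ ($i=1,\dots,l-1$, $l=\lambda_1$) and any $a\in\mathbb C$, $$\chi_{\lambda/\mu,a}=\sum_{p\in P_2(\lambda/\mu)}z_a^p,$$ where $P_2(\lambda/\mu)$ is the set of all $p\in\mathfrak P(u_\mu,v_\lambda)$ such that (i) $p$ does not have any ordinarily intersecting pair $(p_i,p_j)$, and (ii) $p$ does not have any odd $\mathrm I$- or $\mathrm{II}$-region.
   Context: Ring and determinant. Fix a positive integer $n$ (rank of type $D_n$). $I=\{1,2,\dots,n,\overline n,\dots,\overline 2,\overline 1\}$. $\mathcal Z$ is the commutative ring over $\mathbb Z$ generated by $z_{i,a}$ ($i\in I$, $a\in\mathbb C$) with relations $z_{i,a}z_{\overline i,a-2n+2i}=z_{i-1,a}z_{\overline{i-1},a-2n+2i}$ ($i=1,\dots,n$), where $z_{0,a}=z_{\overline 0,a}=1$. In the non-commutative ring generated by $\mathcal Z$ and $\mathbb Z[[X]]$ with $Xz_{i,a}=z_{i,a-2}X$, put $E_a(z,X)=(1+z_{1,a}X)\cdots(1+z_{n,a}X)\,(1-z_{\overline n,a}Xz_{n,a}X)^{-1}\,(1+z_{\overline n,a}X)\cdots(1+z_{\overline 1,a}X)=\sum_{i\ge0}e_{i,a}X^i$ with $e_{i,a}\in\mathcal Z$, and $e_{i,a}=0$ for $i<0$. A skew diagram $\lambda/\mu$ is a pair of partitions with $\lambda_i\ge\mu_i$ for all $i$; $\lambda',\mu'$ are the conjugates.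 $\chi_{\lambda/\mu,a}=\det(e_{\lambda'_i-\mu'_j-i+j,\,a-2(\mu'_j-j+1)})_{1\le i,j\le l}$ with $l=\lambda_1$. Paths. For $w=(x,y)\in\mathbb R^2$ put $\mathrm{ht}(w)=x+y$ (height), $\mathrm{hp}(w)=\frac12(x-y)$ (horizontal position). Steps on $\mathbb Z^2$: NE-step $(x,y)\to(x+1,y)$, NW-step $(x,y)\to(x,y+1)$, E-step $(x,y)\to(x+1,y-1)$. A path is a sequence of consecutive NE-, NW-, E-steps from a lattice point of height $-n$ to one of height $n$, where E-steps occur only at height $0$ and their number is even. The weight $z_a^p$ of a path $p$ is the product over its NE- and E-steps $s$ of $z_{L^1(s),a-2x}$, where $s$ starts at $(x,y)$, $m=x+y$, and $L^1(s)$ is: $n+1+m$ if $m<0$; $n$ if $m=0$ and $s$ is the 2nd, 4th, 6th, ... E-step of $p$; $\overline{n-m}$ otherwise. The weight of a tuple is $z_a^p=\prod_iz_a^{p_i}$. Put $u_i=(\mu'_i+1-i,-n-\mu'_i-1+i)$, $v_i=(\lambda'_i+1-i,n-\lambda'_i-1+i)$ for $1\le i\le l$. $\mathfrak P(u_\mu,v_\lambda)$ is the set of all $l$-tuples $p=(p_1,\dots,p_l)$ of paths such that for some permutation $\sigma\in\mathfrak S_l$, $p_i$ goes from $u_i$ to $v_{\sigma(i)}$ for all $i$. Two paths intersect if they share a lattice point. An intersecting pair $(p_i,p_j)$ is specially intersecting if the intersection occurs only at height $0$ and $p_i(0)-p_j(0)$ is odd, where $p_i(0)$ is the horizontal position of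 the leftmost point of $p_i$ at height $0$; otherwise it is ordinarily intersecting. Regions. $S_+=\{0\le\mathrm{ht}\le n\}$, $S_-=\{-n\le\mathrm{ht}\le0\}$. A lower (resp. upper) path is a sequence of consecutive NE/NW-steps from height $-n$ to $0$ (resp. from $0$ to $n$); $\alpha(r)$ denotes the horizontal position at height $r$. Duals: $\alpha^*(r)=\alpha(-r)-1$, $\beta^*(-r)=\beta(r)+1$ ($0\le r\le n$) for a lower path $\alpha$ and an upper path $\beta$. For $p$ with property (i), removing all E-steps gives $\pi(p)=(\alpha;\beta)=(\alpha_1,\dots,\alpha_l;\beta_1,\dots,\beta_l)$, where $\alpha_i$ is the lower path starting at $u_i$ and $\beta_i$ the upper path ending at $v_i$. A unit $U\subset S_\pm$ is a unit square of the lattice inside $S_\pm$, or the half in $S_\pm$ of a unit square whose horizontal diagonal lies on the boundary of $S_\pm$; its height is the height of its left vertex; its left and right vertices have horizontal positions $a$ and $a'=a+1$. Let $\pm r=\mathrm{ht}(U)$, and set $\beta_{l+1}=\beta_{l+1}^*=-\infty$, $\alpha_0=\alpha_0^*=+\infty$. $U$ is a $\mathrm I$-unit if for some $0\le i\le l$: $\alpha^*_i(r)\le a<a'\le\beta_{i+1}(r)$ (if $U\subset S_+$), resp. $\alpha_i(-r)\le a<a'\le\beta^*_{i+1}(-r)$ (if $U\subset S_-$). $U$ is a $\mathrm{II}$-unit if for some $0\le i\le l$: $\beta_{i+1}(r)\le a<a'\le\alpha_i^*(r)$ (if $U\subset S_+$), resp. $\beta^*_{i+1}(-r)\le a<a'\le\alpha_i(-r)$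 (if $U\subset S_-$); it is a boundary $\mathrm{II}$-unit if this holds with $i=0$, or $i=l$, or $r=n$. Two units are adjacent if the left or right vertex of one is also a vertex of the other. A connected component of the $\mathrm I$-units (resp. $\mathrm{II}$-units) is the union of an equivalence class for the equivalence relation on the set of $\mathrm I$-units (resp. $\mathrm{II}$-units) generated by adjacency. A $\mathrm I$-region is a connected component of the $\mathrm I$-units containing at least one $\mathrm I$-unit of height $0$; a $\mathrm{II}$-region is a connected component of the $\mathrm{II}$-units containing at least one $\mathrm{II}$-unit of height $0$ and no boundary $\mathrm{II}$-unit. For $1\le i\le l-1$ let $h=\alpha_i(0)-\beta_{i+1}(0)$; the pair $(\alpha_i,\beta_{i+1})$ is an overlap if $h\le0$, a hole if $h>0$, and is even/odd according to the parity of $h$. It intersects $V$ at height $0$ if the height-$0$ endpoint of $\alpha_i$ lies in a unit of $V$ in $S_-$ or that of $\beta_{i+1}$ lies in a unit of $V$ in $S_+$. For a $\mathrm I$-region (resp. $\mathrm{II}$-region) $V$, $n(V)$ is the number of $i$ such that $(\alpha_i,\beta_{i+1})$ is an even overlap (resp. an even hole) intersecting $V$ at height $0$; $V$ is odd if $n(V)$ is odd.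
   Formalization: Two units count as adjacent only if both lie in S_+ or both in S_- (the strips are taken as disjoint); with adjacency across height 0 the identity fails, e.g. n=2, λ=(2), μ=∅, where the determinant is 9 at z=1 but the sum is 10. *)

theory Defs
  imports
    Complex_Main
    "HOL-Library.Cardinality"
    "HOL-Library.Extended_Real"
    "HOL-Library.Product_Plus"
    "HOL-Library.FuncSet"
    "HOL-Combinatorics.Permutations"
    "HOL-Computational_Algebra.Formal_Power_Series"
    "Jordan_Normal_Form.Determinant"
begin

section \<open>The ring of the variables \<open>z\<^sub>i\<^sub>,\<^sub>a\<close>\<close>

text \<open>
  The rank \<open>n\<close> of the root system is carried by a type: it is \<open>CARD('n)\<close> for a type \<open>'n\<close> of
  sort \<open>finite\<close>, so that the ring can be a type of class \<open>comm_ring_1\<close>.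
\<close>

datatype letter = Unb nat | Bar nat

text \<open>
  The ring is given by generators and relations: ring expressions in the symbols \<open>z\<^sub>i\<^sub>,\<^sub>a\<close> modulo the
  least congruence that contains the commutative ring laws and the defining relations. Symbols are
  available for all natural indices. The rules \<open>Unb_one\<close> and \<open>Bar_one\<close> set the ones with index
  \<open>0\<close> to \<open>1\<close>, as the defining relations require, and remove the ones with index \<open>> n\<close>, so that the
  generators that remain are exactly those for \<open>1, \<dots>, n\<close> and their barred versions.
\<close>

datatype zterm =
    ZGen letter complex
  | ZZero
  | ZOne
  | ZAdd zterm zterm
  | ZMul zterm zterm
  | ZNeg zterm

inductive zcong :: "nat \<Rightarrow> zterm \<Rightarrow> zterm \<Rightarrow> bool" for n :: nat where
  refl: "zcong n p p"
| sym: "zcong n p q \<Longrightarrow> zcong n q p"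
| trans: "zcong n p q \<Longrightarrow> zcong n q r \<Longrightarrow> zcong n p r"
| add: "zcong n p p' \<Longrightarrow> zcong n q q' \<Longrightarrow> zcong n (ZAdd p q) (ZAdd p' q')"
| mul: "zcong n p p' \<Longrightarrow> zcong n q q' \<Longrightarrow> zcong n (ZMul p q) (ZMul p' q')"
| neg: "zcong n p p' \<Longrightarrow> zcong n (ZNeg p) (ZNeg p')"
| add_assoc: "zcong n (ZAdd (ZAdd p q) r) (ZAdd p (ZAdd q r))"
| add_comm: "zcong n (ZAdd p q) (ZAdd q p)"
| add_zero: "zcong n (ZAdd ZZero p) p"
| add_neg: "zcong n (ZAdd (ZNeg p) p) ZZero"
| mul_assoc: "zcong n (ZMul (ZMul p q) r) (ZMul p (ZMul q r))"
| mul_comm: "zcong n (ZMul p q) (ZMul q p)"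
| mul_one: "zcong n (ZMul ZOne p) p"
| distrib: "zcong n (ZMul (ZAdd p q) r) (ZAdd (ZMul p r) (ZMul q r))"
| Unb_one: "i \<notin> {1..n} \<Longrightarrow> zcong n (ZGen (Unb i) a) ZOne"
| Bar_one: "i \<notin> {1..n} \<Longrightarrow> zcong n (ZGen (Bar i) a) ZOne"
| rel: "i \<in> {1..n} \<Longrightarrow>
    zcong n
      (ZMul (ZGen (Unb i) a) (ZGen (Bar i) (a - 2 * of_nat n + 2 * of_nat i)))
      (ZMul (ZGen (Unb (i - 1)) a) (ZGen (Bar (i - 1)) (a - 2 * of_nat n + 2 * of_nat i)))"

quotient_type 'n zring = zterm / "zcong CARD('n)"
  by (rule equivpI) (auto intro!: reflpI sympI transpI intro: zcong.refl zcong.sym zcong.trans)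

lift_definition zvar :: "letter \<Rightarrow> complex \<Rightarrow> 'n zring" is ZGen .

fun zterm_eval_one :: "zterm \<Rightarrow> int" where
  "zterm_eval_one (ZGen l a) = 1"
| "zterm_eval_one ZZero = 0"
| "zterm_eval_one ZOne = 1"
| "zterm_eval_one (ZAdd p q) = zterm_eval_one p + zterm_eval_one q"
| "zterm_eval_one (ZMul p q) = zterm_eval_one p * zterm_eval_one q"
| "zterm_eval_one (ZNeg p) = - zterm_eval_one p"

lemma zcong_eval_one: "zcong n p q \<Longrightarrow> zterm_eval_one p = zterm_eval_one q"
  by (induction rule: zcong.induct) (auto simp: algebra_simps)

instantiation zring :: (type) comm_ring_1
begin

lift_definition zero_zring :: "'a zring" is ZZero .
lift_definition one_zring :: "'a zring" is ZOne .
lift_definition plus_zring :: "'a zring \<Rightarrow> 'a zring \<Rightarrow> 'a zring" is ZAdd by (rule zcong.add)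
lift_definition times_zring :: "'a zring \<Rightarrow> 'a zring \<Rightarrow> 'a zring" is ZMul by (rule zcong.mul)
lift_definition uminus_zring :: "'a zring \<Rightarrow> 'a zring" is ZNeg by (rule zcong.neg)

definition minus_zring :: "'a zring \<Rightarrow> 'a zring \<Rightarrow> 'a zring" where
  "minus_zring p q = p + - q"

instance
proof
  fix a b c :: "'a zring"
  show "a + b + c = a + (b + c)" by transfer (rule zcong.add_assoc)
  show "a + b = b + a" by transfer (rule zcong.add_comm)
  show "0 + a = a" by transfer (rule zcong.add_zero)
  show "- a + a = 0" by transfer (rule zcong.add_neg)
  show "a - b = a + - b" by (rule minus_zring_def)
  show "a * b * c = a * (b * c)" by transfer (rule zcong.mul_assoc)
  show "a * b = b * a" by transfer (rule zcong.mul_comm)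
  show "1 * a = a" by transfer (rule zcong.mul_one)
  show "(a + b) * c = a * c + b * c" by transfer (rule zcong.distrib)
  show "(0 :: 'a zring) \<noteq> 1" by transfer (auto dest: zcong_eval_one)
qed

end

lemma zvar_relation:
  fixes a :: complex
  assumes "i \<in> {1..CARD('n)}"
  defines "b \<equiv> a - 2 * of_nat CARD('n) + 2 * of_nat i"
  shows "(zvar (Unb i) a * zvar (Bar i) b :: 'n zring) = zvar (Unb (i - 1)) a * zvar (Bar (i - 1)) b"
  using assms(1) unfolding b_def by transfer (rule zcong.rel)

lemma zvar_zero: "(zvar (Unb 0) a :: 'n zring) = 1" "(zvar (Bar 0) a :: 'n zring) = 1"
  by (transfer, rule zcong.intros, simp)+

text \<open>The automorphism \<open>z\<^sub>i\<^sub>,\<^sub>a \<mapsto> z\<^sub>i\<^sub>,\<^sub>a\<^sub>-\<^sub>2\<close>, i.e. conjugation by \<open>X\<close>.\<close>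

primrec zterm_shift :: "zterm \<Rightarrow> zterm" where
  "zterm_shift (ZGen l a) = ZGen l (a - 2)"
| "zterm_shift ZZero = ZZero"
| "zterm_shift ZOne = ZOne"
| "zterm_shift (ZAdd p q) = ZAdd (zterm_shift p) (zterm_shift q)"
| "zterm_shift (ZMul p q) = ZMul (zterm_shift p) (zterm_shift q)"
| "zterm_shift (ZNeg p) = ZNeg (zterm_shift p)"

lemma zcong_shift: "zcong n p q \<Longrightarrow> zcong n (zterm_shift p) (zterm_shift q)"
proof (induction rule: zcong.induct)
  case (rel i a)
  have "a - 2 * of_nat n + 2 * of_nat i - 2 = (a - 2) - 2 * of_nat n + 2 * of_nat i"
    by simp
  then show ?case
    using zcong.rel[OF rel, of "a - 2"] by (simp only: zterm_shift.simps)
qed (auto intro: zcong.intros)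

lift_definition zshift :: "'n zring \<Rightarrow> 'n zring" is zterm_shift
  by (rule zcong_shift)

lemma zshift_simps [simp]:
  "zshift (zvar l a) = zvar l (a - 2)"
  "zshift 0 = 0"
  "zshift 1 = 1"
  "zshift (p + q) = zshift p + zshift q"
  "zshift (p * q) = zshift p * zshift q"
  "zshift (- p) = - zshift p"
  by (transfer, simp add: zcong.refl)+

lemma zshift_pow_simps [simp]:
  "(zshift ^^ k) 0 = 0"
  "(zshift ^^ k) 1 = 1"
  "(zshift ^^ k) (p + q) = (zshift ^^ k) p + (zshift ^^ k) q"
  "(zshift ^^ k) (p * q) = (zshift ^^ k) p * (zshift ^^ k) q"
  by (induction k) simp_all

lemma zshift_pow_sum: "(zshift ^^ k) (sum f A) = (\<Sum>x\<in>A. (zshift ^^ k) (f x))"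
  by (induction A rule: infinite_finite_induct) simp_all


section \<open>Power series in \<open>X\<close> with \<open>X z\<^sub>i\<^sub>,\<^sub>a = z\<^sub>i\<^sub>,\<^sub>a\<^sub>-\<^sub>2 X\<close>\<close>

text \<open>
  The series \<open>\<Sum>\<^sub>k c\<^sub>k X\<^sup>k\<close> is represented by its sequence of coefficients, which are written to the
  left of the powers of \<open>X\<close>.
\<close>

typedef 'n skew_series = "UNIV :: (nat \<Rightarrow> 'n zring) set"
  morphisms scoeff Abs_skew_series ..

setup_lifting type_definition_skew_series

lemma skew_series_eqI: "(\<And>k. scoeff f k = scoeff g k) \<Longrightarrow> f = g"
  by (simp add: scoeff_inject[symmetric] fun_eq_iff)

instantiation skew_series :: (type) ring_1
begin

lift_definition zero_skew_series :: "'a skew_series" is "\<lambda>_. 0" .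
lift_definition one_skew_series :: "'a skew_series" is "\<lambda>k. if k = 0 then 1 else 0" .
lift_definition plus_skew_series :: "'a skew_series \<Rightarrow> 'a skew_series \<Rightarrow> 'a skew_series"
  is "\<lambda>f g k. f k + g k" .
lift_definition uminus_skew_series :: "'a skew_series \<Rightarrow> 'a skew_series"
  is "\<lambda>f k. - f k" .
lift_definition minus_skew_series :: "'a skew_series \<Rightarrow> 'a skew_series \<Rightarrow> 'a skew_series"
  is "\<lambda>f g k. f k - g k" .
lift_definition times_skew_series :: "'a skew_series \<Rightarrow> 'a skew_series \<Rightarrow> 'a skew_series"
  is "\<lambda>f g k. \<Sum>i=0..k. f i * (zshift ^^ i) (g (k - i))" .

instance
proof
  fix a b c :: "'a skew_series"
  show "a * b * c = a * (b * c)"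
  proof (rule skew_series_eqI)
    fix k
    let ?F = "\<lambda>i j m. scoeff a i * (zshift ^^ i) (scoeff b j) * (zshift ^^ (i + j)) (scoeff c m)"
    have "scoeff (a * b * c) k = (\<Sum>j=0..k. \<Sum>i=0..j. ?F i (j - i) (k - j))"
      by (simp add: times_skew_series.rep_eq sum_distrib_right)
    also have "\<dots> = (\<Sum>j=0..k. \<Sum>i=0..k - j. ?F j i (k - j - i))"
      by (rule fps_mult_assoc_lemma)
    also have "\<dots> = scoeff (a * (b * c)) k"
      by (simp add: times_skew_series.rep_eq sum_distrib_left zshift_pow_sum funpow_add mult.assoc)
    finally show "scoeff (a * b * c) k = scoeff (a * (b * c)) k" .
  qed
  have *: "(\<Sum>i=0..k. (if i = 0 then 1 else 0) * f i) = f 0" for k and f :: "nat \<Rightarrow> 'a zring"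
  proof -
    have "(\<Sum>i=0..k. (if i = 0 then 1 else 0) * f i) = (\<Sum>i=0..k. if i = 0 then f i else 0)"
      by (rule sum.cong) auto
    then show ?thesis by simp
  qed
  show "1 * a = a"
    by (rule skew_series_eqI) (simp add: times_skew_series.rep_eq one_skew_series.rep_eq *)
  have **: "(\<Sum>i=0..k. f i * (zshift ^^ i) (if k - i = 0 then 1 else 0)) = f k"
    for k and f :: "nat \<Rightarrow> 'a zring"
  proof -
    have "(\<Sum>i=0..k. f i * (zshift ^^ i) (if k - i = 0 then 1 else 0)) =
        (\<Sum>i=0..k. if i = k then f i else 0)"
      by (rule sum.cong) auto
    then show ?thesis by simp
  qed
  show "a * 1 = a"
    by (rule skew_series_eqI) (simp only: times_skew_series.rep_eq one_skew_series.rep_eq **)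
  show "a + b + c = a + (b + c)" "a + b = b + a" "0 + a = a" "- a + a = 0" "a - b = a + - b"
    by (transfer; simp add: algebra_simps)+
  show "(a + b) * c = a * c + b * c" "a * (b + c) = a * b + a * c"
    by (transfer; simp add: algebra_simps sum.distrib)+
  show "(0 :: 'a skew_series) \<noteq> 1"
    by transfer (metis zero_neq_one)
qed

end

definition sconst :: "'n zring \<Rightarrow> 'n skew_series" where
  "sconst c = Abs_skew_series (\<lambda>k. if k = 0 then c else 0)"

lemma scoeff_sconst: "scoeff (sconst c) k = (if k = 0 then c else 0)"
  by (simp add: sconst_def Abs_skew_series_inverse)

lift_definition sX :: "'n skew_series" is "\<lambda>k. if k = 1 then 1 else 0" .

lemma sX_mult_sconst: "sX * sconst c = sconst (zshift c) * sX"
proof (rule skew_series_eqI)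
  fix k
  have "scoeff (sX * sconst c) k = (\<Sum>i=0..k. if i = 1 then if k = 1 then zshift c else 0 else 0)"
    unfolding times_skew_series.rep_eq sX.rep_eq scoeff_sconst by (rule sum.cong) auto
  also have "\<dots> = (\<Sum>i=0..k. if i = 0 then if k = 1 then zshift c else 0 else 0)"
    by (auto simp: sum.delta)
  also have "\<dots> = scoeff (sconst (zshift c) * sX) k"
    unfolding times_skew_series.rep_eq sX.rep_eq scoeff_sconst by (rule sum.cong) auto
  finally show "scoeff (sX * sconst c) k = scoeff (sconst (zshift c) * sX) k" .
qed

lemma sX_mult_zvar: "sX * sconst (zvar l a) = sconst (zvar l (a - 2)) * sX"
  by (simp add: sX_mult_sconst)

definition sinverse :: "'n skew_series \<Rightarrow> 'n skew_series" where
  "sinverse f = (THE g. f * g = 1 \<and> g * f = 1)"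

fun right_inv_coeff :: "(nat \<Rightarrow> 'n zring) \<Rightarrow> nat \<Rightarrow> 'n zring" where
  "right_inv_coeff f k =
    (if k = 0 then 1 else - (\<Sum>i\<in>{1..k}. f i * (zshift ^^ i) (right_inv_coeff f (k - i))))"

fun left_inv_coeff :: "(nat \<Rightarrow> 'n zring) \<Rightarrow> nat \<Rightarrow> 'n zring" where
  "left_inv_coeff f k =
    (if k = 0 then 1 else - (\<Sum>i\<in>{..<k}. left_inv_coeff f i * (zshift ^^ i) (f (k - i))))"

declare right_inv_coeff.simps [simp del] left_inv_coeff.simps [simp del]

lemma ex1_inverse:
  assumes "scoeff f 0 = 1"
  shows "\<exists>!g. f * g = 1 \<and> g * f = 1"
proof -
  define r l where "r = Abs_skew_series (right_inv_coeff (scoeff f))"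
    and "l = Abs_skew_series (left_inv_coeff (scoeff f))"
  have r: "scoeff r = right_inv_coeff (scoeff f)" and l: "scoeff l = left_inv_coeff (scoeff f)"
    by (simp_all add: r_def l_def Abs_skew_series_inverse)
  have fr: "f * r = 1"
  proof (rule skew_series_eqI)
    fix k
    have "scoeff (f * r) k = scoeff f 0 * right_inv_coeff (scoeff f) k +
        (\<Sum>i\<in>{1..k}. scoeff f i * (zshift ^^ i) (right_inv_coeff (scoeff f) (k - i)))"
      by (simp add: times_skew_series.rep_eq r sum.atLeast_Suc_atMost)
    also have "\<dots> = scoeff 1 k"
      using right_inv_coeff.simps[of "scoeff f" k] assms
      by (cases "k = 0") (simp_all add: one_skew_series.rep_eq)
    finally show "scoeff (f * r) k = scoeff 1 k" .
  qed
  have lf: "l * f = 1"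
  proof (rule skew_series_eqI)
    fix k
    have "scoeff (l * f) k = left_inv_coeff (scoeff f) k * (zshift ^^ k) (scoeff f 0) +
        (\<Sum>i\<in>{..<k}. left_inv_coeff (scoeff f) i * (zshift ^^ i) (scoeff f (k - i)))"
      by (simp add: times_skew_series.rep_eq l atLeast0AtMost lessThan_Suc_atMost[symmetric])
    also have "\<dots> = scoeff 1 k"
      using left_inv_coeff.simps[of "scoeff f" k] assms
      by (cases "k = 0") (simp_all add: one_skew_series.rep_eq)
    finally show "scoeff (l * f) k = scoeff 1 k" .
  qed
  have "l = r"
    by (metis fr lf mult.assoc mult_1 mult_1_right)
  show ?thesis
  proof (rule ex1I[of _ r])
    show "f * r = 1 \<and> r * f = 1" using fr lf \<open>l = r\<close> by simp
    show "g = r" if "f * g = 1 \<and> g * f = 1" for g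
      using that fr by (metis mult.assoc mult_1 mult_1_right)
  qed
qed


section \<open>The determinant\<close>

definition E_factor :: "complex \<Rightarrow> letter \<Rightarrow> 'n skew_series" where
  "E_factor a j = 1 + sconst (zvar j a) * sX"

definition E_middle :: "complex \<Rightarrow> 'n skew_series" where
  "E_middle a =
    1 - sconst (zvar (Bar CARD('n)) a) * sX * sconst (zvar (Unb CARD('n)) a) * sX"

definition E_series :: "complex \<Rightarrow> 'n skew_series" where
  "E_series a =
    prod_list (map (\<lambda>i. E_factor a (Unb i)) [1..<Suc CARD('n)])
    * sinverse (E_middle a)
    * prod_list (map (\<lambda>i. E_factor a (Bar i)) (rev [1..<Suc CARD('n)]))"

lemma sinverse_E_middle:
  fixes a :: complex
  defines "M \<equiv> (E_middle a :: 'n skew_series)"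
  shows "M * sinverse M = 1" "sinverse M * M = 1"
proof -
  have "scoeff M 0 = 1"
    by (simp add: M_def E_middle_def minus_skew_series.rep_eq one_skew_series.rep_eq
        times_skew_series.rep_eq sX.rep_eq)
  from theI'[OF ex1_inverse[OF this]]
  show "M * sinverse M = 1" "sinverse M * M = 1"
    by (simp_all add: sinverse_def)
qed

definition e_coeff :: "int \<Rightarrow> complex \<Rightarrow> 'n zring" where
  "e_coeff i a = (if i < 0 then 0 else scoeff (E_series a) (nat i))"

text \<open>
  A partition \<open>(\<lambda>\<^sub>1, \<lambda>\<^sub>2, \<dots>)\<close> is a function on the positive integers; its value at \<open>0\<close> plays no role.
\<close>

definition is_partition :: "(nat \<Rightarrow> nat) \<Rightarrow> bool" where
  "is_partition lam \<longleftrightarrow>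
    (\<forall>i\<ge>1. lam (Suc i) \<le> lam i) \<and> finite {i. 1 \<le> i \<and> lam i \<noteq> 0}"

definition conj_part :: "(nat \<Rightarrow> nat) \<Rightarrow> nat \<Rightarrow> nat" where
  "conj_part lam j = card {i. 1 \<le> i \<and> j \<le> lam i}"

definition skew_diagram :: "(nat \<Rightarrow> nat) \<Rightarrow> (nat \<Rightarrow> nat) \<Rightarrow> bool" where
  "skew_diagram lam mu \<longleftrightarrow>
    is_partition lam \<and> is_partition mu \<and> (\<forall>i\<ge>1. mu i \<le> lam i)"

definition positivity :: "nat \<Rightarrow> (nat \<Rightarrow> nat) \<Rightarrow> (nat \<Rightarrow> nat) \<Rightarrow> bool" where
  "positivity n lam mu \<longleftrightarrow>
    (\<forall>i. 1 \<le> i \<and> i < lam 1 \<longrightarrow>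
      int (conj_part lam (i + 1)) - int (conj_part mu i) \<le> int n)"

definition chi_entry :: "(nat \<Rightarrow> nat) \<Rightarrow> (nat \<Rightarrow> nat) \<Rightarrow> complex \<Rightarrow> nat \<Rightarrow> nat \<Rightarrow> 'n zring" where
  "chi_entry lam mu a i j =
    e_coeff (int (conj_part lam i) - int (conj_part mu j) - int i + int j)
      (a - 2 * (of_nat (conj_part mu j) - of_nat j + 1))"

definition chi :: "(nat \<Rightarrow> nat) \<Rightarrow> (nat \<Rightarrow> nat) \<Rightarrow> complex \<Rightarrow> 'n zring" where
  "chi lam mu a =
    Determinant.det (mat (lam 1) (lam 1) (\<lambda>(i, j). chi_entry lam mu a (Suc i) (Suc j)))"


section \<open>Paths\<close>

type_synonym point = "int \<times> int"

definition ht :: "point \<Rightarrow> int" where "ht w = fst w + snd w"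

definition hp :: "point \<Rightarrow> real" where "hp w = real_of_int (fst w - snd w) / 2"

datatype step = NE | NW | E

primrec step_vec :: "step \<Rightarrow> point" where
  "step_vec NE = (1, 0)"
| "step_vec NW = (0, 1)"
| "step_vec E = (1, -1)"

text \<open>A sequence of consecutive steps is given by its starting point and the list of its steps.\<close>

type_synonym path = "point \<times> step list"

definition vertex :: "path \<Rightarrow> nat \<Rightarrow> point" where
  "vertex p k = foldl (\<lambda>w s. w + step_vec s) (fst p) (take k (snd p))"

definition path_end :: "path \<Rightarrow> point" where
  "path_end p = vertex p (length (snd p))"

definition vertices :: "path \<Rightarrow> point set" where
  "vertices p = vertex p ` {..length (snd p)}"

definition is_path :: "nat \<Rightarrow> path \<Rightarrow> bool" where
  "is_path n p \<longleftrightarrow>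
    ht (fst p) = - int n \<and> ht (path_end p) = int n \<and>
    (\<forall>k<length (snd p). snd p ! k = E \<longrightarrow> ht (vertex p k) = 0) \<and>
    even (count_list (snd p) E)"

text \<open>
  The label of the step number \<open>k\<close> (counted from \<open>0\<close>). An E-step is the 2nd, 4th, \dots one if and
  only if an odd number of E-steps precede it.
\<close>

definition step_label :: "nat \<Rightarrow> path \<Rightarrow> nat \<Rightarrow> letter" where
  "step_label n p k =
    (let m = ht (vertex p k) in
      if m < 0 then Unb (nat (int n + 1 + m))
      else if m = 0 \<and> snd p ! k = E \<and> odd (count_list (take k (snd p)) E) then Unb n
      else Bar (nat (int n - m)))"

definition path_weight :: "complex \<Rightarrow> path \<Rightarrow> 'n zring" where
  "path_weight a p =
    (\<Prod>k | k < length (snd p) \<and> snd p ! k \<in> {NE, E}.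
      zvar (step_label CARD('n) p k) (a - 2 * of_int (fst (vertex p k))))"

text \<open>Tuples \<open>(p\<^sub>1, \<dots>, p\<^sub>l)\<close> are functions on \<open>{1..l}\<close>, extended by \<open>undefined\<close>.\<close>

definition tuple_weight :: "nat \<Rightarrow> complex \<Rightarrow> (nat \<Rightarrow> path) \<Rightarrow> 'n zring" where
  "tuple_weight l a p = (\<Prod>i\<in>{1..l}. path_weight a (p i))"

definition start_pt :: "nat \<Rightarrow> (nat \<Rightarrow> nat) \<Rightarrow> nat \<Rightarrow> point" where
  "start_pt n mu i =
    (int (conj_part mu i) + 1 - int i, - int n - int (conj_part mu i) - 1 + int i)"

definition end_pt :: "nat \<Rightarrow> (nat \<Rightarrow> nat) \<Rightarrow> nat \<Rightarrow> point" where
  "end_pt n lam i =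
    (int (conj_part lam i) + 1 - int i, int n - int (conj_part lam i) - 1 + int i)"

definition path_tuples :: "nat \<Rightarrow> (nat \<Rightarrow> nat) \<Rightarrow> (nat \<Rightarrow> nat) \<Rightarrow> (nat \<Rightarrow> path) set" where
  "path_tuples n lam mu =
    {p \<in> {1..lam 1} \<rightarrow>\<^sub>E {q. is_path n q}.
      \<exists>\<sigma>. \<sigma> permutes {1..lam 1} \<and>
        (\<forall>i\<in>{1..lam 1}. fst (p i) = start_pt n mu i \<and> path_end (p i) = end_pt n lam (\<sigma> i))}"

definition intersecting :: "path \<Rightarrow> path \<Rightarrow> bool" where
  "intersecting p q \<longleftrightarrow> vertices p \<inter> vertices q \<noteq> {}"

definition hp0 :: "path \<Rightarrow> real" where
  "hp0 p = Min (hp ` {w \<in> vertices p. ht w = 0})"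

definition specially_intersecting :: "path \<Rightarrow> path \<Rightarrow> bool" where
  "specially_intersecting p q \<longleftrightarrow>
    intersecting p q \<and> (\<forall>w \<in> vertices p \<inter> vertices q. ht w = 0) \<and>
    (\<exists>k::int. odd k \<and> hp0 p - hp0 q = of_int k)"

definition ordinarily_intersecting :: "path \<Rightarrow> path \<Rightarrow> bool" where
  "ordinarily_intersecting p q \<longleftrightarrow> intersecting p q \<and> \<not> specially_intersecting p q"


section \<open>Lower and upper paths\<close>

text \<open>
  The E-steps of a path are at height \<open>0\<close>, hence come after the first \<open>n\<close> and before the last \<open>n\<close>
  of its steps. Removing them leaves these two pieces.
\<close>

definition lower_path :: "nat \<Rightarrow> path \<Rightarrow> path" where
  "lower_path n p = (fst p, take n (snd p))"

definition upper_path :: "nat \<Rightarrow> path \<Rightarrow> path" where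
  "upper_path n p = (vertex p (length (snd p) - n), drop (length (snd p) - n) (snd p))"

definition alphas :: "nat \<Rightarrow> (nat \<Rightarrow> path) \<Rightarrow> nat \<Rightarrow> path" where
  "alphas n p i = lower_path n (p i)"

text \<open>The upper path \<open>\<beta>\<^sub>i\<close> is the one that ends at \<open>v\<^sub>i\<close>; it need not come from \<open>p\<^sub>i\<close>.\<close>

definition betas :: "nat \<Rightarrow> (nat \<Rightarrow> nat) \<Rightarrow> (nat \<Rightarrow> path) \<Rightarrow> nat \<Rightarrow> path" where
  "betas n lam p i =
    upper_path n (p (THE j. j \<in> {1..lam 1} \<and> path_end (p j) = end_pt n lam i))"

text \<open>The horizontal position at height \<open>r\<close> of a path without E-steps.\<close>

definition pos_at :: "path \<Rightarrow> int \<Rightarrow> real" where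
  "pos_at p r = hp (vertex p (nat (r - ht (fst p))))"


section \<open>Units and regions\<close>

text \<open>
  Below, \<open>l\<close> is the number of paths, \<open>al\<close> and \<open>be\<close> are the families \<open>\<alpha>\<close> and \<open>\<beta>\<close>, and \<open>r\<close> is
  always the actual, possibly negative, height.
\<close>

definition alpha :: "(nat \<Rightarrow> path) \<Rightarrow> nat \<Rightarrow> int \<Rightarrow> ereal" where
  "alpha al i r = (if i = 0 then \<infinity> else ereal (pos_at (al i) r))"

definition beta :: "nat \<Rightarrow> (nat \<Rightarrow> path) \<Rightarrow> nat \<Rightarrow> int \<Rightarrow> ereal" where
  "beta l be i r = (if i = l + 1 then - \<infinity> else ereal (pos_at (be i) r))"

definition alpha_dual :: "(nat \<Rightarrow> path) \<Rightarrow> nat \<Rightarrow> int \<Rightarrow> ereal" where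
  "alpha_dual al i r = alpha al i (- r) - 1"

definition beta_dual :: "nat \<Rightarrow> (nat \<Rightarrow> path) \<Rightarrow> nat \<Rightarrow> int \<Rightarrow> ereal" where
  "beta_dual l be i r = beta l be i (- r) + 1"

text \<open>
  A unit is represented by the strip \<open>S\<^sub>+\<close> (\<open>Upper\<close>) or \<open>S\<^sub>-\<close> (\<open>Lower\<close>) it lies in and its left
  vertex. The unit square with left vertex \<open>(x, y)\<close> is \<open>[x, x + 1] \<times> [y - 1, y]\<close>; its horizontal
  diagonal has height \<open>x + y\<close>. Hence it lies inside the strip if that height is strictly between
  the bounds of the strip, and one half of it does if the height is one of the bounds.
\<close>

datatype strip = Upper | Lower

type_synonym lunit = "strip \<times> point"

definition strip_heights :: "nat \<Rightarrow> strip \<Rightarrow> real set" where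
  "strip_heights n s = (case s of Upper \<Rightarrow> {0..real n} | Lower \<Rightarrow> {- real n..0})"

definition unit_ht :: "lunit \<Rightarrow> int" where "unit_ht U = ht (snd U)"

definition is_lunit :: "nat \<Rightarrow> lunit \<Rightarrow> bool" where
  "is_lunit n U \<longleftrightarrow> real_of_int (unit_ht U) \<in> strip_heights n (fst U)"

definition left_vertex :: "lunit \<Rightarrow> point" where "left_vertex U = snd U"

definition right_vertex :: "lunit \<Rightarrow> point" where "right_vertex U = snd U + (1, -1)"

definition unit_points :: "nat \<Rightarrow> lunit \<Rightarrow> (real \<times> real) set" where
  "unit_points n U =
    (case U of (s, x, y) \<Rightarrow>
      {(u, v). u \<in> {of_int x..of_int x + 1} \<and> v \<in> {of_int y - 1..of_int y} \<and>
        u + v \<in> strip_heights n s})"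

definition unit_vertices :: "nat \<Rightarrow> lunit \<Rightarrow> point set" where
  "unit_vertices n U =
    {w \<in> {snd U, snd U + (1, -1), snd U + (1, 0), snd U + (0, -1)}.
      real_of_int (ht w) \<in> strip_heights n (fst U)}"

definition lies_in :: "nat \<Rightarrow> point \<Rightarrow> lunit \<Rightarrow> bool" where
  "lies_in n w U \<longleftrightarrow> (real_of_int (fst w), real_of_int (snd w)) \<in> unit_points n U"

text \<open>
  \<open>S\<^sub>+\<close> and \<open>S\<^sub>-\<close> count as disjoint here, so adjacent units lie in the same strip, although as
  subsets of the plane the strips meet in the line of height \<open>0\<close>. If units were also adjacent across
  that line, the determinant formula would fail: at a path \<open>p\<^sub>1\<close> from \<open>u\<^sub>1\<close> to \<open>v\<^sub>1\<close> without
  E-steps, the point at height \<open>0\<close> is the right vertex of a II-unit in \<open>S\<^sub>-\<close> whenever \<open>(\<alpha>\<^sub>1, \<beta>\<^sub>2)\<close>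
  is an even hole, and always the left vertex of a boundary II-unit in \<open>S\<^sub>+\<close>. For \<open>n = 2\<close> and \<open>\<lambda>/\<mu> = (2)\<close>, there would then be no
  odd II-region, and the sum would have 10 terms, while the determinant is 9 at \<open>z\<^sub>i\<^sub>,\<^sub>a = 1\<close>.
\<close>

definition adjacent :: "nat \<Rightarrow> lunit \<Rightarrow> lunit \<Rightarrow> bool" where
  "adjacent n U W \<longleftrightarrow>
    fst U = fst W \<and>
    (left_vertex U \<in> unit_vertices n W \<or> right_vertex U \<in> unit_vertices n W \<or>
     left_vertex W \<in> unit_vertices n U \<or> right_vertex W \<in> unit_vertices n U)"

definition I_cond :: "nat \<Rightarrow> (nat \<Rightarrow> path) \<Rightarrow> (nat \<Rightarrow> path) \<Rightarrow> lunit \<Rightarrow> nat \<Rightarrow> bool" where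
  "I_cond l al be U i \<longleftrightarrow>
    (let r = unit_ht U; a = hp (left_vertex U); a' = hp (right_vertex U) in
      case fst U of
        Upper \<Rightarrow> alpha_dual al i r \<le> ereal a \<and> ereal a' \<le> beta l be (i + 1) r
      | Lower \<Rightarrow> alpha al i r \<le> ereal a \<and> ereal a' \<le> beta_dual l be (i + 1) r)"

definition II_cond :: "nat \<Rightarrow> (nat \<Rightarrow> path) \<Rightarrow> (nat \<Rightarrow> path) \<Rightarrow> lunit \<Rightarrow> nat \<Rightarrow> bool" where
  "II_cond l al be U i \<longleftrightarrow>
    (let r = unit_ht U; a = hp (left_vertex U); a' = hp (right_vertex U) in
      case fst U of
        Upper \<Rightarrow> beta l be (i + 1) r \<le> ereal a \<and> ereal a' \<le> alpha_dual al i r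
      | Lower \<Rightarrow> beta_dual l be (i + 1) r \<le> ereal a \<and> ereal a' \<le> alpha al i r)"

definition I_units :: "nat \<Rightarrow> nat \<Rightarrow> (nat \<Rightarrow> path) \<Rightarrow> (nat \<Rightarrow> path) \<Rightarrow> lunit set" where
  "I_units n l al be = {U. is_lunit n U \<and> (\<exists>i\<le>l. I_cond l al be U i)}"

definition II_units :: "nat \<Rightarrow> nat \<Rightarrow> (nat \<Rightarrow> path) \<Rightarrow> (nat \<Rightarrow> path) \<Rightarrow> lunit set" where
  "II_units n l al be = {U. is_lunit n U \<and> (\<exists>i\<le>l. II_cond l al be U i)}"

definition boundary_II_units :: "nat \<Rightarrow> nat \<Rightarrow> (nat \<Rightarrow> path) \<Rightarrow> (nat \<Rightarrow> path) \<Rightarrow> lunit set" where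
  "boundary_II_units n l al be =
    {U. is_lunit n U \<and>
      (\<exists>i\<le>l. II_cond l al be U i \<and> (i = 0 \<or> i = l \<or> \<bar>unit_ht U\<bar> = int n))}"

text \<open>
  A connected component, and so a region, is represented by the equivalence class of units whose
  union it is.
\<close>

definition components :: "nat \<Rightarrow> lunit set \<Rightarrow> lunit set set" where
  "components n S = S // {(U, W). U \<in> S \<and> W \<in> S \<and> adjacent n U W}\<^sup>*"

definition I_regions :: "nat \<Rightarrow> nat \<Rightarrow> (nat \<Rightarrow> path) \<Rightarrow> (nat \<Rightarrow> path) \<Rightarrow> lunit set set" where
  "I_regions n l al be = {V \<in> components n (I_units n l al be). \<exists>U\<in>V. unit_ht U = 0}"

definition II_regions :: "nat \<Rightarrow> nat \<Rightarrow> (nat \<Rightarrow> path) \<Rightarrow> (nat \<Rightarrow> path) \<Rightarrow> lunit set set" where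
  "II_regions n l al be =
    {V \<in> components n (II_units n l al be).
      (\<exists>U\<in>V. unit_ht U = 0) \<and> V \<inter> boundary_II_units n l al be = {}}"

definition gap :: "(nat \<Rightarrow> path) \<Rightarrow> (nat \<Rightarrow> path) \<Rightarrow> nat \<Rightarrow> real" where
  "gap al be i = pos_at (al i) 0 - pos_at (be (i + 1)) 0"

definition even_gap :: "(nat \<Rightarrow> path) \<Rightarrow> (nat \<Rightarrow> path) \<Rightarrow> nat \<Rightarrow> bool" where
  "even_gap al be i \<longleftrightarrow> (\<exists>k::int. even k \<and> gap al be i = of_int k)"

definition intersects0 ::
    "nat \<Rightarrow> (nat \<Rightarrow> path) \<Rightarrow> (nat \<Rightarrow> path) \<Rightarrow> nat \<Rightarrow> lunit set \<Rightarrow> bool" where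
  "intersects0 n al be i V \<longleftrightarrow>
    (\<exists>U\<in>V. fst U = Lower \<and> lies_in n (path_end (al i)) U) \<or>
    (\<exists>U\<in>V. fst U = Upper \<and> lies_in n (fst (be (i + 1))) U)"

definition odd_I_region ::
    "nat \<Rightarrow> nat \<Rightarrow> (nat \<Rightarrow> path) \<Rightarrow> (nat \<Rightarrow> path) \<Rightarrow> lunit set \<Rightarrow> bool" where
  "odd_I_region n l al be V \<longleftrightarrow>
    V \<in> I_regions n l al be \<and>
    odd (card {i. 1 \<le> i \<and> i < l \<and>
      gap al be i \<le> 0 \<and> even_gap al be i \<and> intersects0 n al be i V})"

definition odd_II_region ::
    "nat \<Rightarrow> nat \<Rightarrow> (nat \<Rightarrow> path) \<Rightarrow> (nat \<Rightarrow> path) \<Rightarrow> lunit set \<Rightarrow> bool" where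
  "odd_II_region n l al be V \<longleftrightarrow>
    V \<in> II_regions n l al be \<and>
    odd (card {i. 1 \<le> i \<and> i < l \<and>
      gap al be i > 0 \<and> even_gap al be i \<and> intersects0 n al be i V})"

definition P2 :: "nat \<Rightarrow> (nat \<Rightarrow> nat) \<Rightarrow> (nat \<Rightarrow> nat) \<Rightarrow> (nat \<Rightarrow> path) set" where
  "P2 n lam mu =
    {p \<in> path_tuples n lam mu.
      (\<forall>i\<in>{1..lam 1}. \<forall>j\<in>{1..lam 1}. i \<noteq> j \<longrightarrow> \<not> ordinarily_intersecting (p i) (p j)) \<and>
      (\<nexists>V. odd_I_region n (lam 1) (alphas n p) (betas n lam p) V \<or>
           odd_II_region n (lam 1) (alphas n p) (betas n lam p) V)}"

lemma foldl_step_vec: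
  "foldl (\<lambda>w s. w + step_vec s) w xs =
    w + (int (count_list xs NE) + int (count_list xs E),
         int (count_list xs NW) - int (count_list xs E))"
proof (induction xs arbitrary: w)
  case (Cons s xs)
  then show ?case by (cases s) (auto simp: prod_eq_iff)
qed (simp add: prod_eq_iff)

lemma length_step_list: "length xs = count_list xs NE + count_list xs NW + count_list xs E"
proof (induction xs)
  case (Cons s xs)
  then show ?case by (cases s) auto
qed simp

lemma UNIV_step: "(UNIV :: step set) = {NE, NW, E}"
  using step.exhaust by auto

lemma finite_paths: "finite {q. is_path n q \<and> fst q = u \<and> path_end q = v}"
proof (rule finite_subset)
  let ?N = "nat (fst v - fst u) + 2 * n"
  show "{q. is_path n q \<and> fst q = u \<and> path_end q = v} \<subseteq>
      {u} \<times> {xs. set xs \<subseteq> UNIV \<and> length xs \<le> ?N}"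
    by (auto simp: is_path_def path_end_def vertex_def foldl_step_vec ht_def length_step_list)
  have "finite (UNIV :: step set)"
    by (simp add: UNIV_step)
  then show "finite ({u} \<times> {xs :: step list. set xs \<subseteq> UNIV \<and> length xs \<le> ?N})"
    by (intro finite_cartesian_product finite_lists_length_le) auto
qed

lemma finite_P2: "finite (P2 n lam mu)"
proof (rule finite_subset)
  let ?Q = "\<lambda>i. \<Union>j\<in>{1..lam 1}.
    {q. is_path n q \<and> fst q = start_pt n mu i \<and> path_end q = end_pt n lam j}"
  have Q: "p i \<in> ?Q i" if p: "p \<in> path_tuples n lam mu" and i: "i \<in> {1..lam 1}" for p i
  proof -
    obtain s where s: "s permutes {1..lam 1}" and
      "fst (p i) = start_pt n mu i" "path_end (p i) = end_pt n lam (s i)"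
      using p i unfolding path_tuples_def by blast
    moreover have "is_path n (p i)"
      using p i unfolding path_tuples_def by (simp add: PiE_iff)
    moreover have "s i \<in> {1..lam 1}"
      using permutes_in_image[OF s] i by blast
    ultimately show ?thesis by blast
  qed
  show "P2 n lam mu \<subseteq> PiE {1..lam 1} ?Q"
  proof
    fix p
    assume "p \<in> P2 n lam mu"
    then have p: "p \<in> path_tuples n lam mu"
      by (simp add: P2_def)
    then have "p \<in> extensional {1..lam 1}"
      unfolding path_tuples_def by (simp add: PiE_iff)
    then show "p \<in> PiE {1..lam 1} ?Q"
      using Q[OF p] unfolding PiE_iff by blast
  qed
  show "finite (PiE {1..lam 1} ?Q)"
    by (intro finite_PiE finite_UN_I finite_paths finite_atLeastAtMost)
qed

end

theory Submission
  imports Defs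
begin

text \<open>
  Expanding the determinant gives a signed sum over families of lower paths, families of upper
  paths and permutations. All \<open>z\<^sub>i\<^sub>,\<^sub>a\<close> are units, so up to factors that depend only on the ends the
  weight of a path is a product over its vertices; the defining relations of the ring say that the
  factor at a point of \<open>\<beta>\<close> and the factor at the same point of \<open>\<alpha>\<^sup>*\<close> are proportional. Families
  with a common point cancel by exchanging the parts that lead to the line of height \<open>0\<close>. For disjoint
  families \<open>\<alpha>, \<beta>\<close> the E-steps match the points of \<open>\<alpha>\<close> and \<open>\<beta>\<close> at height \<open>0\<close>: either the matchings
  cancel, or there is exactly one. The latter happens iff consecutive ones among the intervals
  spanned by \<open>\<alpha>\<^sup>*\<^sub>i(0)\<close> and \<open>\<beta>\<^sub>i\<^sub>+\<^sub>1(0)\<close> are at odd distances; its sign is the parity of the number of even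
  overlaps. This condition is symmetric in the two ends of each interval. Hence the exchange of \<open>\<alpha>\<^sup>*\<^sub>i\<close>
  and \<open>\<beta>\<^sub>i\<^sub>+\<^sub>1\<close> inside an odd region is a sign-reversing involution that keeps all weights, and what
  remains without odd regions is positive.
\<close>

section \<open>The generators are units\<close>

text \<open>Weights live on steps, whereas an exchange inside a region moves whole stretches of
  vertices and alters steps at its rim. As generators are units, a step weight is a quotient of two
  potentials, one at either end; regrouping them by vertex gives factors on which an exchange acts
  row by row. At height 0 the part of the defining relation is played by the weight of two
  consecutive E-steps, the coefficient in the middle factor of the series.

  E-runs have even length, so paths at odd distance may pass each other on the line of height 0 and
  a common point there need not cancel. Hence tails are exchanged separately among the lower and
  among the upper paths, with all E-runs summed into one alternating function of the positions at
  height 0.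

  Positivity says that at height n no pair formed by the dual of \<alpha>_i and \<beta>_(i+1)
  overlaps. So I-regions miss the top, II-regions avoid it by definition, and no exchange moves a
  fixed end. Without odd regions every I-region contains an even number of even overlaps, so their
  total is even and the sign is +1.\<close>

lemma zvar_out_of_range:
  assumes "i \<notin> {1..CARD('n)}"
  shows "(zvar (Unb i) a :: 'n zring) = 1" "(zvar (Bar i) a :: 'n zring) = 1"
proof -
  show "(zvar (Unb i) a :: 'n zring) = 1" using assms by transfer (rule zcong.Unb_one)
  show "(zvar (Bar i) a :: 'n zring) = 1" using assms by transfer (rule zcong.Bar_one)
qed

text \<open>The defining relation equates the product of the two letters of index
  \<open>Suc i\<close> with that of the letters of index \<open>i\<close>, units by induction from
  index 0; a factor of a unit is a unit.\<close>

lemma zvar_dvd_one: "(zvar (Unb i) a :: 'n zring) dvd 1 \<and> (zvar (Bar i) a :: 'n zring) dvd 1"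
proof (induction i arbitrary: a)
  case 0 then show ?case by (simp add: zvar_zero)
next
  case (Suc i)
  show ?case
  proof (cases "Suc i \<in> {1..CARD('n)}")
    case False then show ?thesis by (simp add: zvar_out_of_range)
  next
    case True
    \<comment> \<open>The parameters of the two letters in the relation differ by \<open>s\<close>;
      the barred letter at \<open>a\<close> is reached from the unbarred one at
      \<open>a + s\<close>.\<close>
    define s :: complex where "s = 2 * of_nat CARD('n) - 2 * of_nat (Suc i)"
    have unit: "(zvar (Unb (Suc i)) b * zvar (Bar (Suc i)) (b - s) :: 'n zring) dvd 1" for b
    proof -
      have "(zvar (Unb i) b * zvar (Bar i) (b - s) :: 'n zring) dvd 1 * 1"
        using Suc.IH by (intro mult_dvd_mono) auto
      then show ?thesis using zvar_relation[OF True, of b] by (simp add: s_def algebra_simps)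
    qed
    have "(zvar (Unb (Suc i)) a :: 'n zring) dvd 1" using unit[of a] by (rule dvd_mult_left)
    moreover have "(zvar (Bar (Suc i)) a :: 'n zring) dvd 1"
      using unit[of "a + s"] by (auto dest: dvd_mult_right)
    ultimately show ?thesis ..
  qed
qed

text \<open>A multiplicative antiderivative on the integers. Left of 0 it continues with inverses of
  \<open>f\<close>, hence the hypothesis.\<close>

lemma unit_potential:
  fixes f :: "int \<Rightarrow> 'a::comm_ring_1"
  assumes "\<And>x. f x dvd 1"
  obtains P where "\<And>x. P (x + 1) = P x * f x" "\<And>x. P x dvd 1"
proof -
  have "\<forall>x. \<exists>y. 1 = f x * y" using assms by (auto simp: dvd_def)
  then obtain fi where fi: "\<And>x. 1 = f x * fi x" by metis
  define P where "P x = (if 0 \<le> x then \<Prod>u\<in>{0..<x}. f u else \<Prod>u\<in>{x..<0}. fi u)" for x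
  have "P (x + 1) = P x * f x" for x
  proof (cases "0 \<le> x")
    case True
    then have "{0..<x + 1} = insert x {0..<x}" by auto
    then show ?thesis using True by (simp add: P_def mult.commute)
  next
    case False
    then have "{x..<0} = insert x {x + 1..<0}" by auto
    then have "P x = fi x * (\<Prod>u\<in>{x + 1..<0}. fi u)" using False by (simp add: P_def)
    moreover have "P (x + 1) = (\<Prod>u\<in>{x + 1..<0}. fi u)" using False by (cases "x = -1") (auto simp: P_def)
    ultimately have "P x * f x = (f x * fi x) * P (x + 1)" by (simp add: ac_simps)
    then show ?thesis using fi[of x] by simp
  qed
  moreover have "P x dvd 1" for x
  proof -
    have "f u dvd 1 \<and> fi u dvd 1" for u using fi[of u] by (metis dvd_triv_left dvd_triv_right)
    then show ?thesis unfolding P_def using prod_dvd_prod[of _ _ "\<lambda>_. 1"] by (smt (verit) prod.neutral_const)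
  qed
  ultimately show thesis using that by blast
qed

section \<open>Trails\<close>

text \<open>Both halves of a path are described from the line of height 0 outwards: row 0 is the
  free end there, row \<open>m\<close> the prescribed end. Values above row \<open>m\<close> are
  \<open>undefined\<close>, so equal trails are equal functions.\<close>

definition trails :: "nat \<Rightarrow> int \<Rightarrow> (nat \<Rightarrow> int) set" where
  "trails m t = {c \<in> {..m} \<rightarrow>\<^sub>E UNIV. c m = t \<and> (\<forall>r<m. c (Suc r) = c r \<or> c (Suc r) = c r + 1)}"

lemma trails_0: "trails 0 t = {(\<lambda>r. undefined)(0 := t)}"
  by (auto simp: trails_def PiE_def extensional_def fun_eq_iff)

lemma trails_Suc: "trails (Suc m) t = (\<lambda>c. c(Suc m := t)) ` (trails m t \<union> trails m (t - 1))"
proof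
  show "(\<lambda>c. c(Suc m := t)) ` (trails m t \<union> trails m (t - 1)) \<subseteq> trails (Suc m) t"
    by (auto simp: trails_def PiE_def extensional_def less_Suc_eq)
  show "trails (Suc m) t \<subseteq> (\<lambda>c. c(Suc m := t)) ` (trails m t \<union> trails m (t - 1))"
  proof
    fix c assume c: "c \<in> trails (Suc m) t"
    let ?c = "restrict c {..m}"
    have "c m = t \<or> c m = t - 1" using c by (auto simp: trails_def)
    then have "?c \<in> trails m t \<union> trails m (t - 1)" using c by (auto simp: trails_def)
    moreover have "c = ?c(Suc m := t)"
      using c by (auto simp: trails_def PiE_def extensional_def fun_eq_iff)
    ultimately show "c \<in> (\<lambda>c. c(Suc m := t)) ` (trails m t \<union> trails m (t - 1))" by blast
  qed
qed

lemma inj_on_trails_upd: "inj_on (\<lambda>c. c(Suc m := t)) (trails m s \<union> trails m s')"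
proof (rule inj_onI)
  fix c d assume *: "c \<in> trails m s \<union> trails m s'" "d \<in> trails m s \<union> trails m s'"
    "c(Suc m := t) = d(Suc m := t)"
  have "c r = d r" for r
  proof (cases "r = Suc m")
    case True then show ?thesis using *(1,2) by (auto simp: trails_def PiE_def extensional_def)
  next
    case False then show ?thesis using fun_cong[OF *(3), of r] by simp
  qed
  then show "c = d" by blast
qed

lemma finite_trails: "finite (trails m t)"
  by (induction m arbitrary: t) (auto simp: trails_0 trails_Suc)

lemma trails_bounds:
  assumes "c \<in> trails m t" "r \<le> m"
  shows "c r \<le> t" "t - int (m - r) \<le> c r"
proof -
  have "c r \<le> t \<and> t - int (m - r) \<le> c r" using assms(2)
  proof (induction rule: inc_induct)
    case base then show ?case using assms by (simp add: trails_def)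
  next
    case (step k)
    have "c (Suc k) = c k \<or> c (Suc k) = c k + 1" using assms step by (simp add: trails_def)
    moreover have "m - k = Suc (m - Suc k)" using step.hyps by arith
    ultimately show ?case using step by auto
  qed
  then show "c r \<le> t" "t - int (m - r) \<le> c r" by auto
qed

text \<open>A transfer-matrix sum with boundary vector \<open>T\<close> at row 0. One more linear
  factor in the series will be one more row.\<close>

definition trail_sum :: "(nat \<Rightarrow> int \<Rightarrow> int \<Rightarrow> 'a::comm_ring_1) \<Rightarrow> nat \<Rightarrow> int \<Rightarrow> (int \<Rightarrow> 'a) \<Rightarrow> 'a" where
  "trail_sum w m t T = (\<Sum>c\<in>trails m t. (\<Prod>r<m. w r (c r) (c (Suc r))) * T (c 0))"

lemma trail_sum_0: "trail_sum w 0 t T = T t"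
  by (simp add: trail_sum_def trails_0)

lemma trail_sum_Suc:
  "trail_sum w (Suc m) t T =
    w m t t * trail_sum w m t T + w m (t - 1) t * trail_sum w m (t - 1) T"
proof -
  let ?f = "\<lambda>c. (\<Prod>r<Suc m. w r (c r) (c (Suc r))) * T (c 0)"
  have disj: "trails m t \<inter> trails m (t - 1) = {}" by (auto simp: trails_def)
  have upd: "?f (c(Suc m := t)) = w m s t * ((\<Prod>r<m. w r (c r) (c (Suc r))) * T (c 0))"
    if "c \<in> trails m s" for c s
  proof -
    have "(\<Prod>r<m. w r ((c(Suc m := t)) r) ((c(Suc m := t)) (Suc r))) = (\<Prod>r<m. w r (c r) (c (Suc r)))"
      by (rule prod.cong) auto
    moreover have "c m = s" using that by (simp add: trails_def)
    ultimately show ?thesis by (simp add: ac_simps)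
  qed
  have "trail_sum w (Suc m) t T = (\<Sum>c\<in>trails m t \<union> trails m (t - 1). ?f (c(Suc m := t)))"
    unfolding trail_sum_def trails_Suc by (subst sum.reindex[OF inj_on_trails_upd]) (simp only: o_def)
  also have "\<dots> = (\<Sum>c\<in>trails m t. ?f (c(Suc m := t))) + (\<Sum>c\<in>trails m (t - 1). ?f (c(Suc m := t)))"
    by (rule sum.union_disjoint[OF finite_trails finite_trails disj])
  also have "(\<Sum>c\<in>trails m t. ?f (c(Suc m := t))) = w m t t * trail_sum w m t T"
    unfolding trail_sum_def sum_distrib_left by (rule sum.cong[OF HOL.refl upd])
  also have "(\<Sum>c\<in>trails m (t - 1). ?f (c(Suc m := t))) = w m (t - 1) t * trail_sum w m (t - 1) T"
    unfolding trail_sum_def sum_distrib_left by (rule sum.cong[OF HOL.refl upd])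
  finally show ?thesis .
qed

lemma trail_sum_cong:
  assumes "\<And>x. T x = T' x"
  shows "trail_sum w m t T = trail_sum w m t T'"
  by (simp add: trail_sum_def assms)

lemma trail_sum_add:
  "trail_sum w m t (\<lambda>x. T x + c * T' x) = trail_sum w m t T + c * trail_sum w m t T'"
  by (simp add: trail_sum_def sum.distrib sum_distrib_left algebra_simps)

section \<open>Coefficients of the series\<close>

lemma zshift_pow_zvar: "(zshift ^^ k) (zvar j b) = zvar j (b - 2 * of_nat k)"
  by (induction k) (auto simp: algebra_simps)

lemma scoeff_sconst_mult: "scoeff (sconst z * f) k = z * scoeff f k"
proof -
  have "scoeff (sconst z * f) k = (\<Sum>i=0..k. if i = 0 then z * scoeff f k else 0)"
    unfolding times_skew_series.rep_eq scoeff_sconst by (rule sum.cong) auto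
  then show ?thesis by (simp add: sum.delta)
qed

lemma scoeff_mult_sconst: "scoeff (f * sconst z) k = scoeff f k * (zshift ^^ k) z"
proof -
  have "scoeff (f * sconst z) k = (\<Sum>i=0..k. if i = k then scoeff f k * (zshift ^^ k) z else 0)"
    unfolding times_skew_series.rep_eq scoeff_sconst by (rule sum.cong) auto
  then show ?thesis by (simp add: sum.delta)
qed

lemma scoeff_sX_mult: "scoeff (sX * f) k = (if k = 0 then 0 else zshift (scoeff f (k - 1)))"
proof -
  have "scoeff (sX * f) k = (\<Sum>i=0..k. if i = 1 then zshift (scoeff f (k - 1)) else 0)"
    unfolding times_skew_series.rep_eq sX.rep_eq by (rule sum.cong) auto
  then show ?thesis by (auto simp add: sum.delta)
qed

lemma scoeff_mult_sX: "scoeff (f * sX) k = (if k = 0 then 0 else scoeff f (k - 1))"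
proof -
  have "scoeff (f * sX) k = (\<Sum>i=0..k. if i = k - 1 \<and> k \<noteq> 0 then scoeff f (k - 1) else 0)"
    unfolding times_skew_series.rep_eq sX.rep_eq by (rule sum.cong) auto
  then show ?thesis by (cases "k = 0") (auto simp add: sum.delta)
qed

text \<open>Powers of X count x-steps from \<open>x0\<close>, so the coefficient of degree k is read
  at the point \<open>x0 + k\<close>. For a series with parameter \<open>a - 2 * x0\<close>, a
  letter picked at \<open>x\<close> then carries \<open>a - 2 * x\<close>, whatever
  \<open>x0\<close> is.\<close>

definition svalue :: "int \<Rightarrow> 'n skew_series \<Rightarrow> int \<Rightarrow> 'n zring" where
  "svalue x0 f x = (if x0 \<le> x then scoeff f (nat (x - x0)) else 0)"

text \<open>Choosing X in the last factor is a step from \<open>x - 1\<close> to \<open>x\<close>.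
  Its letter has to pass a power of X of degree \<open>x - 1 - x0\<close>, which lowers its
  parameter by twice that degree.\<close>

lemma svalue_mult_factor:
  "svalue x0 (f * E_factor (a - 2 * of_int x0) j) x =
    svalue x0 f x + svalue x0 f (x - 1) * zvar j (a - 2 * of_int (x - 1))"
proof (cases "x0 < x")
  case True
  define k where "k = nat (x - x0)"
  have k: "0 < k" "nat (x - 1 - x0) = k - 1" using True by (auto simp: k_def)
  have "int (k - 1) = x - 1 - x0" using True by (simp add: k_def)
  then have *: "(of_nat (k - 1) :: complex) = of_int (x - 1 - x0)" by (metis of_int_of_nat_eq)
  have "a - 2 * of_int x0 - 2 * of_nat (k - 1) = a - 2 * of_int (x - 1)"
    unfolding * by (simp add: algebra_simps)
  moreover have "scoeff (f * E_factor (a - 2 * of_int x0) j) k = scoeff f k +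
      scoeff f (k - 1) * (zshift ^^ (k - 1)) (zvar j (a - 2 * of_int x0))"
    using k(1) by (simp add: E_factor_def distrib_left plus_skew_series.rep_eq scoeff_mult_sX
        scoeff_mult_sconst flip: mult.assoc)
  ultimately have "scoeff (f * E_factor (a - 2 * of_int x0) j) k = scoeff f k +
      scoeff f (k - 1) * zvar j (a - 2 * of_int (x - 1))" by (simp only: zshift_pow_zvar)
  then show ?thesis using True k(2) by (simp add: svalue_def flip: k_def)
next
  case False
  then show ?thesis
    by (auto simp: svalue_def E_factor_def distrib_left plus_skew_series.rep_eq scoeff_mult_sX
        simp flip: mult.assoc)
qed

lemma zshift_scoeff_factors:
  "zshift (scoeff (prod_list (map (E_factor b) js)) k) =
    scoeff (prod_list (map (E_factor (b - 2)) js)) k"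
proof (induction js arbitrary: k)
  case Nil then show ?case by (simp add: one_skew_series.rep_eq)
next
  case (Cons j js)
  then show ?case
    by (simp add: E_factor_def distrib_right plus_skew_series.rep_eq mult.assoc scoeff_sconst_mult
        scoeff_sX_mult)
qed

text \<open>Choosing X in the first factor conjugates everything behind it, which amounts to
  restarting the remaining product at \<open>x0 + 1\<close>.\<close>

lemma svalue_factor_mult:
  "svalue x0 (prod_list (map (E_factor (a - 2 * of_int x0)) (j # js))) x =
    svalue x0 (prod_list (map (E_factor (a - 2 * of_int x0)) js)) x +
    zvar j (a - 2 * of_int x0) *
      svalue (x0 + 1) (prod_list (map (E_factor (a - 2 * of_int (x0 + 1))) js)) x"
proof -
  have *: "a - 2 * of_int (x0 + 1) = a - 2 * of_int x0 - 2" by simp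
  show ?thesis
  proof (cases "x0 < x")
    case True
    then have "nat (x - (x0 + 1)) = nat (x - x0) - 1" by simp
    then show ?thesis using True unfolding * zshift_scoeff_factors[symmetric] svalue_def
      by (simp add: E_factor_def distrib_right plus_skew_series.rep_eq mult.assoc scoeff_sconst_mult
        scoeff_sX_mult flip: zshift_scoeff_factors)
  next
    case False
    then show ?thesis unfolding svalue_def
      by (simp add: E_factor_def distrib_right plus_skew_series.rep_eq mult.assoc scoeff_sconst_mult
        scoeff_sX_mult)
  qed
qed

section \<open>Step weights in trail coordinates and the series as a sum over trails\<close>

definition zU :: "complex \<Rightarrow> nat \<Rightarrow> int \<Rightarrow> 'n zring" where
  "zU a i x = zvar (Unb i) (a - 2 * of_int x)"

definition zB :: "complex \<Rightarrow> nat \<Rightarrow> int \<Rightarrow> 'n zring" where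
  "zB a i x = zvar (Bar i) (a - 2 * of_int x)"

text \<open>
  A lower path is stored through its dual: if it has \<open>x\<close>-coordinate \<open>X\<close> at height \<open>-r\<close>, then
  \<open>c r = X + r - 1\<close>. Its step from height \<open>-r - 1\<close> to \<open>-r\<close> is an NE-step iff \<open>c (r + 1) = c r\<close>.
\<close>

definition low_step :: "nat \<Rightarrow> complex \<Rightarrow> nat \<Rightarrow> int \<Rightarrow> int \<Rightarrow> 'n zring" where
  "low_step n a r x y = (if y = x then zU a (n - r) (x - int r) else 1)"

definition up_step :: "nat \<Rightarrow> complex \<Rightarrow> nat \<Rightarrow> int \<Rightarrow> int \<Rightarrow> 'n zring" where
  "up_step n a r x y = (if y = x then 1 else zB a (n - r) x)"

definition E_pair :: "complex \<Rightarrow> int \<Rightarrow> 'n zring" where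
  "E_pair a x = zB a CARD('n) x * zU a CARD('n) (x + 1)"

text \<open>Weight of an E-run from \<open>x\<close> to \<open>y\<close>, odd lengths being
  forbidden. Odd-numbered E-steps carry the barred letter, even-numbered ones the unbarred, hence
  the pairs.\<close>

definition E_run :: "complex \<Rightarrow> int \<Rightarrow> int \<Rightarrow> 'n zring" where
  "E_run a x y = (if x \<le> y \<and> even (y - x) then \<Prod>k<nat (y - x) div 2. E_pair a (x + 2 * int k) else 0)"

text \<open>Splits off the last pair. It is the recursion that the middle factor imposes on the
  coefficients of its inverse.\<close>

lemma E_run_rec: "E_run a x y = (if x = y then 1 else 0) + E_pair a (y - 2) * E_run a x (y - 2)"
proof (cases "x \<le> y - 2 \<and> even (y - x)")
  case True
  then obtain k where k: "y - x = 2 * k" unfolding dvd_def by blast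
  then have "1 \<le> k" using True by auto
  define m where "m = nat (k - 1)"
  have m: "y = x + 2 * int m + 2" using k \<open>1 \<le> k\<close> by (simp add: m_def)
  have "nat (2 * int m + 2) div 2 = Suc m" "nat (2 * int m) div 2 = m" by auto
  then show ?thesis unfolding E_run_def m by (simp add: mult.commute)
next
  case False
  then have "\<not> (x \<le> y - 2 \<and> even (y - 2 - x))" and *: "x \<le> y \<and> even (y - x) \<longleftrightarrow> x = y" by presburger+
  then have "E_run a x (y - 2) = (0 :: 'a zring)" unfolding E_run_def by (intro if_not_P)
  then show ?thesis using * by (simp add: E_run_def)
qed

text \<open>The induction adds the leftmost factor, that is the row farthest from height 0, so the
  start moves to \<open>x0 + 1\<close>. The value \<open>y\<close> at row 0 belongs to the
  x-coordinate \<open>y + 1\<close>.\<close>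

lemma svalue_lower:
  assumes "m \<le> CARD('n)"
  shows "svalue x0 (prod_list (map (E_factor (a - 2 * of_int x0)) (map Unb [Suc (CARD('n) - m)..<Suc CARD('n)]))) x =
    (trail_sum (low_step CARD('n) a) m (x0 + int m - 1) (\<lambda>y. if y + 1 = x then 1 else 0) :: 'n zring)"
  using assms
proof (induction m arbitrary: x0)
  case 0
  then show ?case by (auto simp: trail_sum_0 svalue_def one_skew_series.rep_eq)
next
  case (Suc m)
  let ?N = "CARD('n)"
  have l: "[Suc (?N - Suc m)..<Suc ?N] = (?N - m) # [Suc (?N - m)..<Suc ?N]"
    using Suc.prems by (subst upt_conv_Cons) (auto simp: Suc_diff_Suc)
  have m: "m \<le> CARD('n)" using Suc.prems by simp
  have e: "x0 + int (Suc m) - 1 = x0 + 1 + int m - 1" "x0 + 1 + int m - 1 - 1 = x0 + int m - 1" by auto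
  have l': "map Unb [Suc (?N - Suc m)..<Suc ?N] = Unb (?N - m) # map Unb [Suc (?N - m)..<Suc ?N]"
    unfolding l by (rule list.map)
  show ?case unfolding l' svalue_factor_mult Suc.IH[OF m] trail_sum_Suc e
    by (simp add: low_step_def zU_def)
qed

lemma svalue_upper:
  assumes "m \<le> CARD('n)"
  shows "svalue x0 (f * prod_list (map (E_factor (a - 2 * of_int x0)) (map (\<lambda>r. Bar (CARD('n) - r)) [0..<m]))) x =
    (trail_sum (up_step CARD('n) a) m x (svalue x0 f) :: 'n zring)"
  using assms
proof (induction m arbitrary: x)
  case 0
  then show ?case by (auto simp: trail_sum_0)
next
  case (Suc m)
  then show ?case
    by (simp add: svalue_mult_factor trail_sum_Suc up_step_def zB_def flip: mult.assoc)
qed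

text \<open>The equation \<open>h * E_middle _ = f\<close> in degree \<open>y - x0\<close>, once
  both powers of X have been moved to the right.\<close>

lemma svalue_middle:
  fixes f :: "'n skew_series" and a :: complex and x0 :: int
  defines "h \<equiv> f * sinverse (E_middle (a - 2 * of_int x0))"
  shows "svalue x0 h y = svalue x0 f y + svalue x0 h (y - 2) * E_pair a (y - 2)"
proof -
  let ?b = "a - 2 * of_int x0" and ?N = "CARD('n)"
  let ?z = "zvar (Bar ?N) ?b * zvar (Unb ?N) (?b - 2) :: 'n zring"
  have "h * E_middle ?b = f" unfolding h_def by (simp add: mult.assoc sinverse_E_middle)
  moreover have "E_middle ?b = 1 - sconst (zvar (Bar ?N) ?b) * sconst (zvar (Unb ?N) (?b - 2)) * sX * (sX :: 'n skew_series)"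
    unfolding E_middle_def mult.assoc by (simp add: sX_mult_sconst flip: mult.assoc)
  moreover have "h * (1 - sconst (zvar (Bar ?N) ?b) * sconst (zvar (Unb ?N) (?b - 2)) * sX * sX)
    = h - h * sconst (zvar (Bar ?N) ?b) * sconst (zvar (Unb ?N) (?b - 2)) * sX * sX"
    by (simp add: right_diff_distrib mult.assoc)
  ultimately have f: "f = h - h * sconst (zvar (Bar ?N) ?b) * sconst (zvar (Unb ?N) (?b - 2)) * sX * sX"
    by simp
  have c: "scoeff f k = scoeff h k - (if k < 2 then 0 else scoeff h (k - 2) *
      (zvar (Bar ?N) (?b - 2 * of_nat (k - 2)) * zvar (Unb ?N) (?b - 2 - 2 * of_nat (k - 2))))" for k
  proof (cases "k < 2")
    case True then show ?thesis by (subst f) (auto simp: minus_skew_series.rep_eq scoeff_mult_sX)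
  next
    case False
    then have "k - 1 - 1 = k - 2" "k - 1 \<noteq> 0" "k \<noteq> 0" by auto
    then have "scoeff (g * sX * sX) k = scoeff g (k - 2)" for g :: "'n skew_series"
      by (simp only: scoeff_mult_sX if_False)
    then show ?thesis using False
      by (subst f) (simp only: minus_skew_series.rep_eq scoeff_mult_sconst zshift_pow_zvar mult.assoc[of "scoeff h (k - 2)"] if_False)
  qed
  show ?thesis
  proof (cases "x0 + 2 \<le> y")
    case True
    define k where "k = nat (y - x0)"
    have k: "\<not> k < 2" "nat (y - 2 - x0) = k - 2" using True by (auto simp: k_def)
    have "int (k - 2) = y - 2 - x0" using True by (simp add: k_def)
    then have *: "(of_nat (k - 2) :: complex) = of_int (y - 2 - x0)" by (metis of_int_of_nat_eq)
    have **: "?b - 2 * of_nat (k - 2) = a - 2 * of_int (y - 2)"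
      "?b - 2 - 2 * of_nat (k - 2) = a - 2 * of_int (y - 2 + 1)"
      unfolding * by (simp_all add: algebra_simps)
    have "scoeff f k = scoeff h k - scoeff h (k - 2) * E_pair a (y - 2)"
      using c[of k] unfolding if_not_P[OF k(1)] ** E_pair_def zU_def zB_def .
    then show ?thesis using True k(2) by (simp add: svalue_def flip: k_def)
  next
    case False
    then show ?thesis using c by (auto simp: svalue_def)
  qed
qed

text \<open>Both sides obey the same recursion from \<open>y - 2\<close> to \<open>y\<close>, and
  both vanish for \<open>y < x0\<close>: a trail has a value of at least \<open>x0 - 1\<close> at
  row 0, so no run from it ends left of \<open>x0\<close>.\<close>

lemma svalue_lower_middle:
  fixes a :: complex and x0 :: int
  defines "b \<equiv> a - 2 * of_int x0"
  defines "L \<equiv> prod_list (map (E_factor b) (map Unb [1..<Suc CARD('n)])) :: 'n skew_series"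
  shows "svalue x0 (L * sinverse (E_middle b)) y =
    trail_sum (low_step CARD('n) a) CARD('n) (x0 + int CARD('n) - 1) (\<lambda>x. E_run a (x + 1) y)"
proof (induction "nat (y - x0)" arbitrary: y rule: less_induct)
  case less
  let ?S = "trail_sum (low_step CARD('n) a) CARD('n) (x0 + int CARD('n) - 1) :: _ \<Rightarrow> 'n zring"
  show ?case
  proof (cases "x0 \<le> y")
    case False
    have "E_run a (c 0 + 1) y = (0 :: 'n zring)" if "c \<in> trails CARD('n) (x0 + int CARD('n) - 1)" for c
      using trails_bounds(2)[OF that, of 0] False by (simp add: E_run_def)
    then show ?thesis using False by (simp add: svalue_def trail_sum_def)
  next
    case True
    have IH: "svalue x0 (L * sinverse (E_middle b)) (y - 2) = ?S (\<lambda>x. E_run a (x + 1) (y - 2))"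
    proof (cases "y = x0")
      case False then show ?thesis using True by (intro less) auto
    next
      case True
      have "E_run a (c 0 + 1) (y - 2) = (0 :: 'n zring)" if "c \<in> trails CARD('n) (x0 + int CARD('n) - 1)" for c
        using trails_bounds(2)[OF that, of 0] True by (simp add: E_run_def)
      then show ?thesis using True by (simp add: svalue_def trail_sum_def)
    qed
    have "svalue x0 (L * sinverse (E_middle b)) y = svalue x0 L y +
        svalue x0 (L * sinverse (E_middle b)) (y - 2) * E_pair a (y - 2)"
      unfolding b_def by (rule svalue_middle)
    also have "svalue x0 L y = ?S (\<lambda>x. if x + 1 = y then 1 else 0)"
      using svalue_lower[where 'n = 'n, of "CARD('n)" x0 a y] by (simp add: L_def b_def)
    also have "\<dots> + svalue x0 (L * sinverse (E_middle b)) (y - 2) * E_pair a (y - 2) =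
      ?S (\<lambda>x. E_run a (x + 1) y)"
      unfolding IH by (subst E_run_rec) (simp add: trail_sum_add mult.commute)
    finally show ?thesis .
  qed
qed

text \<open>The three factors of the series become the lower trail, the E-run and the upper trail of
  a path from x-coordinate \<open>x0\<close> to \<open>t\<close>; \<open>x0 + n - 1\<close> is the
  dual coordinate of its start at height -n.\<close>

lemma e_coeff_trails:
  "e_coeff (t - x0) (a - 2 * of_int x0) =
    (\<Sum>c\<in>trails CARD('n) (x0 + int CARD('n) - 1). \<Sum>d\<in>trails CARD('n) t.
      (\<Prod>r<CARD('n). low_step CARD('n) a r (c r) (c (Suc r))) * E_run a (c 0 + 1) (d 0) *
      (\<Prod>r<CARD('n). up_step CARD('n) a r (d r) (d (Suc r))) :: 'n zring)"
proof -
  let ?N = "CARD('n)" and ?b = "a - 2 * of_int x0"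
  let ?L = "prod_list (map (E_factor ?b) (map Unb [1..<Suc ?N])) :: 'n skew_series"
  have "map (\<lambda>r. ?N - r) [0..<?N] = rev [1..<Suc ?N]"
    by (rule nth_equalityI) (auto simp: rev_nth simp del: upt_Suc)
  then have rev: "rev [1..<Suc ?N] = map (\<lambda>r. ?N - r) [0..<?N]" by (rule HOL.sym)
  have E: "E_series ?b = ?L * sinverse (E_middle ?b) *
      prod_list (map (E_factor ?b) (map (\<lambda>r. Bar (?N - r)) [0..<?N]))"
    unfolding E_series_def rev map_map comp_def ..
  have "e_coeff (t - x0) ?b = svalue x0 (E_series ?b :: 'n skew_series) t"
    by (simp add: e_coeff_def svalue_def)
  also have "\<dots> = trail_sum (up_step ?N a) ?N t (svalue x0 (?L * sinverse (E_middle ?b)))"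
    unfolding E by (rule svalue_upper) simp
  also have "\<dots> = trail_sum (up_step ?N a) ?N t (\<lambda>y. trail_sum (low_step ?N a) ?N (x0 + int ?N - 1) (\<lambda>x. E_run a (x + 1) y))"
    by (intro trail_sum_cong svalue_lower_middle)
  also have "\<dots> = (\<Sum>d\<in>trails ?N t. \<Sum>c\<in>trails ?N (x0 + int ?N - 1).
      (\<Prod>r<?N. low_step ?N a r (c r) (c (Suc r))) * E_run a (c 0 + 1) (d 0) *
      (\<Prod>r<?N. up_step ?N a r (d r) (d (Suc r))))"
    unfolding trail_sum_def sum_distrib_left by (intro sum.cong HOL.refl) (simp only: ac_simps)
  also have "\<dots> = (\<Sum>c\<in>trails ?N (x0 + int ?N - 1). \<Sum>d\<in>trails ?N t.
      (\<Prod>r<?N. low_step ?N a r (c r) (c (Suc r))) * E_run a (c 0 + 1) (d 0) *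
      (\<Prod>r<?N. up_step ?N a r (d r) (d (Suc r))))"
    by (rule sum.swap)
  finally show ?thesis .
qed

section \<open>Weights as products over vertices\<close>

lemma unit_cancel:
  fixes x y z :: "'a::comm_ring_1"
  assumes "x dvd 1" "x * y = x * z" shows "y = z"
proof -
  obtain w where w: "1 = x * w" using assms(1) by (auto simp: dvd_def)
  have "(x * w) * y = w * (x * y)" by (simp add: ac_simps)
  also have "\<dots> = w * (x * z)" by (simp only: assms(2))
  also have "\<dots> = (x * w) * z" by (simp add: ac_simps)
  finally show ?thesis using w by simp
qed

text \<open>Functions with equal ratios of consecutive values are proportional. The form is
  cross-multiplied because only \<open>P\<close> is assumed invertible.\<close>

lemma proportional_if_steps:
  fixes P Q :: "int \<Rightarrow> 'a::comm_ring_1"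
  assumes P: "\<And>x. P x dvd 1" and step: "\<And>x. P (x + 1) * Q x = P x * Q (x + 1)"
  shows "P x * Q y = P y * Q x"
proof (induction y rule: int_induct[where k = x])
  case (step1 i)
  have "P i * (P x * Q (i + 1)) = P x * (P i * Q (i + 1))" by (rule mult.left_commute)
  also have "\<dots> = P x * (P (i + 1) * Q i)" by (simp only: step)
  also have "\<dots> = P (i + 1) * (P x * Q i)" by (rule mult.left_commute)
  also have "\<dots> = P (i + 1) * (P i * Q x)" by (simp only: step1.IH)
  also have "\<dots> = P i * (P (i + 1) * Q x)" by (rule mult.left_commute)
  finally show ?case by (rule unit_cancel[OF P])
next
  case (step2 i)
  have "P i * (P x * Q (i - 1)) = P x * (P i * Q (i - 1))" by (rule mult.left_commute)
  also have "\<dots> = P x * (P (i - 1) * Q i)" using step[of "i - 1"] by simp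
  also have "\<dots> = P (i - 1) * (P x * Q i)" by (rule mult.left_commute)
  also have "\<dots> = P (i - 1) * (P i * Q x)" by (simp only: step2.IH)
  also have "\<dots> = P i * (P (i - 1) * Q x)" by (rule mult.left_commute)
  finally show ?case by (rule unit_cancel[OF P])
qed simp

lemma unit_inverse_function:
  fixes P :: "'b \<Rightarrow> 'a::comm_ring_1"
  assumes "\<And>x. P x dvd 1"
  obtains Q where "\<And>x. P x * Q x = 1"
proof -
  have "\<forall>x. \<exists>y. P x * y = 1" using assms unfolding dvd_def by metis
  then show thesis using that by metis
qed

lemma zU_dvd_one: "zU a i x dvd (1 :: 'n zring)" and zB_dvd_one: "zB a i x dvd (1 :: 'n zring)"
  by (simp_all add: zU_def zB_def zvar_dvd_one)

text \<open>The relation of index i = n - r in trail coordinates. Its shift -2n + 2i equals -2r, the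
  difference of the parameters at \<open>x\<close> and at \<open>x - r\<close>; \<open>x - r\<close>
  is where the NE-step of a lower path with dual value \<open>x\<close> starts.\<close>

lemma z_relation:
  assumes "r < CARD('n)"
  shows "zU a (CARD('n) - r) (x - int r) * zB a (CARD('n) - r) x =
    (zU a (CARD('n) - Suc r) (x - int r) * zB a (CARD('n) - Suc r) x :: 'n zring)"
proof -
  have i: "CARD('n) - r \<in> {1..CARD('n)}" using assms by simp
  have "a - 2 * of_int (x - int r) - 2 * of_nat CARD('n) + 2 * of_nat (CARD('n) - r) = a - 2 * of_int x"
    using assms by (simp add: of_nat_diff algebra_simps)
  then show ?thesis using zvar_relation[OF i, of "a - 2 * of_int (x - int r)"] assms
    by (simp only: zU_def zB_def diff_diff_left Suc_eq_plus1)
qed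

text \<open>\<open>S\<close>, \<open>T\<close> and \<open>g\<close> are potentials for NE-steps
  below, NE-steps above and pairs of E-steps. \<open>Fa\<close> and \<open>Fb\<close> collect the
  potentials that meet in a vertex. Their ratios at \<open>x + 1\<close> and \<open>x\<close> agree:
  by the defining relation in rows above 0, by the recursion of \<open>g\<close> in row 0.\<close>

lemma vertex_weights:
  fixes a :: complex
  obtains Fa Fb :: "nat \<Rightarrow> int \<Rightarrow> 'n zring" where
    "\<And>c d s t. c \<in> trails CARD('n) s \<Longrightarrow> d \<in> trails CARD('n) t \<Longrightarrow>
      (\<Prod>r<CARD('n). low_step CARD('n) a r (c r) (c (Suc r))) * E_run a (c 0 + 1) (d 0) *
      (\<Prod>r<CARD('n). up_step CARD('n) a r (d r) (d (Suc r))) =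
      (if c 0 < d 0 \<and> odd (d 0 - c 0)
       then (\<Prod>r\<le>CARD('n). Fa r (c r)) * (\<Prod>r\<le>CARD('n). Fb r (d r)) else 0)"
    and "\<And>r x y. r \<le> CARD('n) \<Longrightarrow> Fa r x * Fb r y = Fa r y * Fb r x"
proof -
  let ?N = "CARD('n)"
  let ?z = "\<lambda>r x. zU a (?N - r) (x - int r) :: 'n zring" and ?b = "\<lambda>r x. zB a (?N - r) x :: 'n zring"
  have "\<exists>P. (\<forall>x. P (x + 1) = P x * ?z r x) \<and> (\<forall>x. P x dvd 1)" for r
    by (rule unit_potential[of "?z r"]) (auto simp: zU_dvd_one)
  then obtain S0 where S0: "\<And>r x. S0 r (x + 1) = S0 r x * ?z r x" "\<And>r x. S0 r x dvd 1" by metis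
  have "\<exists>P. (\<forall>x. P (x + 1) = P x * ?b r x) \<and> (\<forall>x. P x dvd 1)" for r
    by (rule unit_potential[of "?b r"]) (auto simp: zB_dvd_one)
  then obtain T0 where T0: "\<And>r x. T0 r (x + 1) = T0 r x * ?b r x" "\<And>r x. T0 r x dvd 1" by metis
  \<comment> \<open>Row n has letters of index 0, which are 1. Setting the potentials to 1 there
    lets the products run over all rows without a correction at the outer end.\<close>
  define S where "S r x = (if r < ?N then S0 r x else 1)" for r x
  define T where "T r x = (if r < ?N then T0 r x else 1)" for r x
  have zero: "?z ?N x = 1" "?b ?N x = 1" for x by (simp_all add: zU_def zB_def zvar_zero)
  have S: "S r (x + 1) = S r x * ?z r x" "S r x dvd 1" if "r \<le> ?N" for r x
    using S0 zero that by (cases "r = ?N"; simp add: S_def)+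
  have T: "T r (x + 1) = T r x * ?b r x" "T r x dvd 1" if "r \<le> ?N" for r x
    using T0 zero that by (cases "r = ?N"; simp add: T_def)+
  have S1: "S r x dvd 1" and T1: "T r x dvd 1" for r x using S0 T0 by (simp_all add: S_def T_def)
  obtain Si' where "\<And>p. (case p of (r, x) \<Rightarrow> S r x) * Si' p = 1"
    using unit_inverse_function[of "\<lambda>(r, x). S r x"] S1 by auto
  then have Si0: "\<And>r x. S r x * Si' (r, x) = 1" by (metis case_prod_conv)
  define Si where "Si r x = Si' (r, x)" for r x
  have Si: "\<And>r x. S r x * Si r x = 1" unfolding Si_def by (rule Si0)
  obtain Ti' where "\<And>p. (case p of (r, x) \<Rightarrow> T r x) * Ti' p = 1"
    using unit_inverse_function[of "\<lambda>(r, x). T r x"] T1 by auto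
  then have Ti0: "\<And>r x. T r x * Ti' (r, x) = 1" by (metis case_prod_conv)
  define Ti where "Ti r x = Ti' (r, x)" for r x
  have Ti: "\<And>r x. T r x * Ti r x = 1" unfolding Ti_def by (rule Ti0)
  have e1: "E_pair a x dvd (1 :: 'n zring)" for x
    unfolding E_pair_def using mult_dvd_mono[OF zB_dvd_one zU_dvd_one] by simp
  obtain P0 where P0: "\<And>x. P0 (x + 1) = P0 x * E_pair a (2 * x)" "\<And>x. P0 x dvd (1 :: 'n zring)"
    using unit_potential[of "\<lambda>x. E_pair a (2 * x) :: 'n zring"] e1 by metis
  obtain P1 where P1: "\<And>x. P1 (x + 1) = P1 x * E_pair a (2 * x + 1)" "\<And>x. P1 x dvd (1 :: 'n zring)"
    using unit_potential[of "\<lambda>x. E_pair a (2 * x + 1) :: 'n zring"] e1 by metis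
  \<comment> \<open>A potential for steps of length 2 consists of two independent ones, on the even
    and on the odd integers.\<close>
  define g where "g x = (if even x then P0 (x div 2) else P1 (x div 2))" for x
  have g: "g (x + 2) = g x * E_pair a x" for x
  proof -
    have d: "(x + 2) div 2 = x div 2 + 1" by simp
    show ?thesis
    proof (cases "even x")
      case True then show ?thesis unfolding g_def d P0(1) by simp
    next
      case False
      then have "2 * (x div 2) + 1 = x" by presburger
      then show ?thesis using False unfolding g_def d P1(1) by simp
    qed
  qed
  have g1: "g x dvd 1" for x using P0 P1 by (simp add: g_def)
  obtain gi where gi: "\<And>x. g x * gi x = 1" using unit_inverse_function[of g] g1 by auto
  define Fa where "Fa r x = S r (x + 1) * (if r = 0 then gi (x + 1) else Si (r - 1) x)" for r x
  define Fb where "Fb r x = Ti r x * (if r = 0 then g x else T (r - 1) x)" for r x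
  \<comment> \<open>A lower NE-step keeps the dual value while NW raises it, so the quotient is
    taken against \<open>x + 1\<close> and becomes 1 for NW.\<close>
  have low: "low_step ?N a r x y = S r (x + 1) * Si r y" if "r < ?N" "y = x \<or> y = x + 1" for r x y
  proof -
    have "S r (x + 1) * Si r x = ?z r x * (S r x * Si r x)" using that S(1)[of r x] by (simp add: ac_simps)
    then show ?thesis using that Si by (auto simp: low_step_def)
  qed
  have up: "up_step ?N a r x y = T r y * Ti r x" if "r < ?N" "y = x \<or> y = x + 1" for r x y
  proof -
    have "T r (x + 1) * Ti r x = ?b r x * (T r x * Ti r x)" using that T(1)[of r x] by (simp add: ac_simps)
    then show ?thesis using that Ti by (auto simp: up_step_def)
  qed
  have gk: "g (x + 2 * int k) = g x * (\<Prod>i<k. E_pair a (x + 2 * int i))" for x k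
  proof (induction k)
    case (Suc k)
    have "g (x + 2 * int (Suc k)) = g (x + 2 * int k) * E_pair a (x + 2 * int k)"
      using g[of "x + 2 * int k"] by (simp add: algebra_simps)
    then show ?case using Suc by (simp add: ac_simps)
  qed simp
  have run: "E_run a (x + 1) y = (if x < y \<and> odd (y - x) then gi (x + 1) * g y else 0)" for x y
  proof (cases "x < y \<and> odd (y - x)")
    case True
    then have "even (y - (x + 1))" "x + 1 \<le> y" by presburger+
    then obtain m where m0: "y - (x + 1) = 2 * m" unfolding dvd_def by blast
    then have m: "y - (x + 1) = 2 * m" "0 \<le> m" using \<open>x + 1 \<le> y\<close> by auto
    define k where "k = nat m"
    have k: "y = x + 1 + 2 * int k" using m by (simp add: k_def)
    have "nat (2 * int k) div 2 = k" by simp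
    moreover have "gi (x + 1) * g y = (g (x + 1) * gi (x + 1)) * (\<Prod>i<k. E_pair a (x + 1 + 2 * int i))"
      unfolding k gk by (simp add: ac_simps)
    ultimately show ?thesis using True gi unfolding E_run_def k by simp
  next
    case False
    then have "\<not> (x + 1 \<le> y \<and> even (y - (x + 1)))" by presburger
    then have "E_run a (x + 1) y = (0 :: 'n zring)" unfolding E_run_def by (intro if_not_P)
    then show ?thesis using False by (simp only: if_False)
  qed
  show thesis
  proof (rule that[of Fa Fb])
    fix c d s t assume c: "c \<in> trails ?N s" and d: "d \<in> trails ?N t"
    have L: "(\<Prod>r<?N. low_step ?N a r (c r) (c (Suc r))) = (\<Prod>r<?N. S r (c r + 1) * Si r (c (Suc r)))"
      by (rule prod.cong) (use c low in \<open>auto simp: trails_def\<close>)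
    have U: "(\<Prod>r<?N. up_step ?N a r (d r) (d (Suc r))) = (\<Prod>r<?N. T r (d (Suc r)) * Ti r (d r))"
      by (rule prod.cong) (use d up in \<open>auto simp: trails_def\<close>)
    have FA: "(\<Prod>r\<le>?N. Fa r (c r)) = (\<Prod>r<?N. S r (c r + 1) * Si r (c (Suc r))) * gi (c 0 + 1)"
    proof -
      have "(\<Prod>r\<le>?N. Fa r (c r)) = (\<Prod>r\<le>?N. S r (c r + 1)) * (\<Prod>r\<le>?N. if r = 0 then gi (c r + 1) else Si (r - 1) (c r))"
        unfolding Fa_def by (rule prod.distrib)
      also have "(\<Prod>r\<le>?N. S r (c r + 1)) = (\<Prod>r<?N. S r (c r + 1))"
        by (simp add: S_def flip: lessThan_Suc_atMost)
      also have "(\<Prod>r\<le>?N. if r = 0 then gi (c r + 1) else Si (r - 1) (c r)) = gi (c 0 + 1) * (\<Prod>r<?N. Si r (c (Suc r)))"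
        by (subst prod.atMost_shift) simp
      finally show ?thesis by (simp add: prod.distrib ac_simps)
    qed
    have FB: "(\<Prod>r\<le>?N. Fb r (d r)) = (\<Prod>r<?N. T r (d (Suc r)) * Ti r (d r)) * g (d 0)"
    proof -
      have "Ti ?N x = 1" for x using Ti[of ?N x] by (simp add: T_def)
      then have 1: "(\<Prod>r\<le>?N. Ti r (d r)) = (\<Prod>r<?N. Ti r (d r))"
        by (simp flip: lessThan_Suc_atMost)
      have "(\<Prod>r\<le>?N. Fb r (d r)) = (\<Prod>r\<le>?N. Ti r (d r)) * (\<Prod>r\<le>?N. if r = 0 then g (d r) else T (r - 1) (d r))"
        unfolding Fb_def by (rule prod.distrib)
      also have "(\<Prod>r\<le>?N. if r = 0 then g (d r) else T (r - 1) (d r)) = g (d 0) * (\<Prod>r<?N. T r (d (Suc r)))"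
        by (subst prod.atMost_shift) simp
      finally show ?thesis unfolding 1 by (simp add: prod.distrib ac_simps)
    qed
    have FA': "(\<Prod>r<?N. low_step ?N a r (c r) (c (Suc r))) * gi (c 0 + 1) = (\<Prod>r\<le>?N. Fa r (c r))"
      unfolding L FA ..
    have FB': "g (d 0) * (\<Prod>r<?N. up_step ?N a r (d r) (d (Suc r))) = (\<Prod>r\<le>?N. Fb r (d r))"
      unfolding U FB by (rule mult.commute)
    have "p * (q * q') * p' = (p * q) * (q' * p')" for p q q' p' :: "'n zring"
      by (simp only: mult.assoc)
    then have "(\<Prod>r<?N. low_step ?N a r (c r) (c (Suc r))) * (gi (c 0 + 1) * g (d 0)) *
      (\<Prod>r<?N. up_step ?N a r (d r) (d (Suc r))) = (\<Prod>r\<le>?N. Fa r (c r)) * (\<Prod>r\<le>?N. Fb r (d r))"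
      unfolding FA'[symmetric] FB'[symmetric] .
    then show "(\<Prod>r<?N. low_step ?N a r (c r) (c (Suc r))) * E_run a (c 0 + 1) (d 0) *
      (\<Prod>r<?N. up_step ?N a r (d r) (d (Suc r))) =
      (if c 0 < d 0 \<and> odd (d 0 - c 0)
       then (\<Prod>r\<le>?N. Fa r (c r)) * (\<Prod>r\<le>?N. Fb r (d r)) else 0)"
      unfolding run by (cases "c 0 < d 0 \<and> odd (d 0 - c 0)") (simp_all only: if_True if_False mult_zero_left mult_zero_right simp_thms)
  next
    fix r x y assume r: "r \<le> ?N"
    have Siu: "Si r x dvd 1" and giu: "gi x dvd 1" for r x using Si[of r x] gi[of x]
      by (metis dvd_triv_right)+
    show "Fa r x * Fb r y = Fa r y * Fb r x"
    proof (rule proportional_if_steps)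
      show "Fa r x dvd 1" for x unfolding Fa_def using mult_dvd_mono[OF S1 Siu] mult_dvd_mono[OF S1 giu] by simp
      fix x :: int
      have Tix: "Ti r x = Ti r (x + 1) * ?b r x"
      proof -
        have "Ti r (x + 1) * ?b r x = (Ti r (x + 1) * ?b r x) * (T r x * Ti r x)" using Ti by simp
        also have "\<dots> = (T r (x + 1) * Ti r (x + 1)) * Ti r x" unfolding T(1)[OF r] by (simp only: ac_simps)
        finally show ?thesis using Ti by simp
      qed
      have Sx: "S r (x + 1 + 1) = S r (x + 1) * ?z r (x + 1)" by (rule S(1)[OF r])
      show "Fa r (x + 1) * Fb r x = Fa r x * Fb r (x + 1)"
      proof (cases r)
        case 0
        have "Fa r (x + 1) * Fb r x = (S r (x + 1) * Ti r (x + 1)) * ((g x * (?b 0 x * ?z 0 (x + 1))) * gi (x + 2))"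
          unfolding Fa_def Fb_def Sx Tix using 0 by (simp add: ac_simps)
        also have "g x * (?b 0 x * ?z 0 (x + 1)) = g (x + 2)" unfolding g E_pair_def by simp
        also have "g (x + 2) * gi (x + 2) = g (x + 1) * gi (x + 1)" by (simp only: gi)
        also have "(S r (x + 1) * Ti r (x + 1)) * (g (x + 1) * gi (x + 1)) = Fa r x * Fb r (x + 1)"
          unfolding Fa_def Fb_def using 0 by (simp add: ac_simps)
        finally show ?thesis .
      next
        case (Suc q)
        then have q: "q < ?N" "q \<le> ?N" using r by auto
        have Siq: "Si q x = Si q (x + 1) * ?z q x"
        proof -
          have "Si q (x + 1) * ?z q x = (Si q (x + 1) * ?z q x) * (S q x * Si q x)" using Si by simp
          also have "\<dots> = (S q (x + 1) * Si q (x + 1)) * Si q x" unfolding S(1)[OF q(2)] by (simp only: ac_simps)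
          finally show ?thesis using Si by simp
        qed
        \<comment> \<open>The relation of index n - q: the letters of the two rows that meet in a
          vertex of row \<open>r = Suc q\<close> have equal products.\<close>
        have rel: "?z r (x + 1) * ?b r x = ?z q x * ?b q x"
          using z_relation[OF q(1), of a x] Suc by simp
        have "Fa r (x + 1) * Fb r x = (S r (x + 1) * Ti r (x + 1) * Si q (x + 1) * T q x) * (?z r (x + 1) * ?b r x)"
          unfolding Fa_def Fb_def Sx Tix using Suc by (simp only: diff_Suc_1 nat.simps if_False ac_simps)
        also have "\<dots> = (S r (x + 1) * Ti r (x + 1) * Si q (x + 1) * T q x) * (?z q x * ?b q x)" by (simp only: rel)
        also have "\<dots> = Fa r x * Fb r (x + 1)"
          unfolding Fa_def Fb_def Suc diff_Suc_1 nat.simps if_False Siq T(1)[OF q(2)] by (simp add: ac_simps)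
        finally show ?thesis .
      qed
    qed
  qed
qed

section \<open>Matchings of interlaced sequences\<close>

definition strict_dec :: "nat \<Rightarrow> (nat \<Rightarrow> int) \<Rightarrow> bool" where
  "strict_dec l a \<longleftrightarrow> (\<forall>i j. 1 \<le> i \<and> i < j \<and> j \<le> l \<longrightarrow> a j < a i)"

text \<open>Interval i is spanned by \<open>a i\<close> and \<open>b (Suc i)\<close>; the extreme
  ones are the half lines from \<open>b 1\<close> upwards (i = 0) and from \<open>a l\<close>
  downwards (i = l). \<open>lo\<close> and \<open>hi\<close> are the ends that face a neighbouring
  interval.\<close>

definition lo :: "(nat \<Rightarrow> int) \<Rightarrow> (nat \<Rightarrow> int) \<Rightarrow> nat \<Rightarrow> int" where
  "lo a b i = (if i = 0 then b 1 else min (a i) (b (Suc i)))"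

definition hi :: "nat \<Rightarrow> (nat \<Rightarrow> int) \<Rightarrow> (nat \<Rightarrow> int) \<Rightarrow> nat \<Rightarrow> int" where
  "hi l a b i = (if i = l then a l else max (a i) (b (Suc i)))"

definition interlaced :: "nat \<Rightarrow> (nat \<Rightarrow> int) \<Rightarrow> (nat \<Rightarrow> int) \<Rightarrow> bool" where
  "interlaced l a b \<longleftrightarrow>
    (\<forall>i<l. hi l a b (Suc i) < lo a b i \<and> odd (lo a b i - hi l a b (Suc i)))"

text \<open>These are the even overlaps of the theorem: \<alpha>_i reaches height 0 at
  \<open>a i + 1\<close>, so the gap is \<open>a i + 1 - b (Suc i)\<close> and parities are
  reversed.\<close>

definition odd_overlaps :: "nat \<Rightarrow> (nat \<Rightarrow> int) \<Rightarrow> (nat \<Rightarrow> int) \<Rightarrow> nat set" where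
  "odd_overlaps l a b = {i. 1 \<le> i \<and> i < l \<and> a i < b (Suc i) \<and> odd (b (Suc i) - a i)}"

text \<open>The E-run from \<open>a i + 1\<close> to \<open>b (\<sigma> i)\<close> must have an even
  length, at least 0.\<close>

definition matching :: "nat \<Rightarrow> (nat \<Rightarrow> int) \<Rightarrow> (nat \<Rightarrow> int) \<Rightarrow> (nat \<Rightarrow> nat) \<Rightarrow> bool" where
  "matching l a b \<sigma> \<longleftrightarrow> \<sigma> permutes {1..l} \<and>
    (\<forall>i\<in>{1..l}. a i < b (\<sigma> i) \<and> odd (b (\<sigma> i) - a i))"

text \<open>Path i covers the points x with \<open>a i < x\<close> and
  \<open>x \<le> b (\<sigma> i)\<close> of the line of height 0. A common point there is ordinary
  exactly when the left ends have the same parity.\<close>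

definition separated :: "nat \<Rightarrow> (nat \<Rightarrow> int) \<Rightarrow> (nat \<Rightarrow> int) \<Rightarrow> (nat \<Rightarrow> nat) \<Rightarrow> bool" where
  "separated l a b \<sigma> \<longleftrightarrow> (\<forall>i\<in>{1..l}. \<forall>j\<in>{1..l}. i \<noteq> j \<and> even (a i - a j) \<longrightarrow>
    b (\<sigma> i) \<le> a j \<or> b (\<sigma> j) \<le> a i)"

lemma strict_decD: "strict_dec l a \<Longrightarrow> 1 \<le> i \<Longrightarrow> i < j \<Longrightarrow> j \<le> l \<Longrightarrow> a j < a i"
  by (auto simp: strict_dec_def)

lemma strict_dec_le: "strict_dec l a \<Longrightarrow> 1 \<le> i \<Longrightarrow> i \<le> j \<Longrightarrow> j \<le> l \<Longrightarrow> a j \<le> a i"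
  using strict_decD[of l a i j] by (cases "i = j") auto

lemma strict_dec_SucI:
  assumes "\<And>i. 1 \<le> i \<Longrightarrow> i < l \<Longrightarrow> a (Suc i) < a i"
  shows "strict_dec l a"
  unfolding strict_dec_def
proof (intro allI impI)
  fix i j assume "1 \<le> i \<and> i < j \<and> j \<le> l"
  then have "i < j" "1 \<le> i" "j \<le> l" by auto
  then show "a j < a i"
  proof (induction rule: strict_inc_induct[where i = i and j = j])
    case (base i) then show ?case using assms[of i] by simp
  next
    case (step i) then show ?case using assms[of i] by fastforce
  qed
qed

text \<open>
  The induction on \<open>l\<close> removes the smallest end \<open>b (Suc l)\<close>. Its partner is \<open>Suc l\<close> or \<open>l\<close>, which one
  is decided by parity; in the second case \<open>a (Suc l)\<close> takes the place of \<open>a l\<close>.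
\<close>

lemma interlaced_Suc:
  assumes "0 < l"
  shows "interlaced (Suc l) a b \<longleftrightarrow>
    (\<forall>i<l - 1. hi l a b (Suc i) < lo a b i \<and> odd (lo a b i - hi l a b (Suc i))) \<and>
    max (a l) (b (Suc l)) < lo a b (l - 1) \<and> odd (lo a b (l - 1) - max (a l) (b (Suc l))) \<and>
    a (Suc l) < min (a l) (b (Suc l)) \<and> odd (min (a l) (b (Suc l)) - a (Suc l))"
proof -
  obtain k where k: "l = Suc k" using assms by (cases l) auto
  show ?thesis unfolding k interlaced_def
    by (auto simp: less_Suc_eq hi_def lo_def)
qed

lemma interlaced_Suc':
  assumes "0 < l"
  shows "interlaced l a b \<longleftrightarrow>
    (\<forall>i<l - 1. hi l a b (Suc i) < lo a b i \<and> odd (lo a b i - hi l a b (Suc i))) \<and>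
    a l < lo a b (l - 1) \<and> odd (lo a b (l - 1) - a l)"
proof -
  obtain k where k: "l = Suc k" using assms by (cases l) auto
  show ?thesis unfolding k interlaced_def
    by (auto simp: less_Suc_eq hi_def lo_def)
qed

lemma lo_pred_le:
  assumes "strict_dec (Suc l) b" "0 < l" "1 < l \<longrightarrow> c \<le> a (l - 1)" "c \<le> b (Suc l)"
  shows "c \<le> lo a b (l - 1)"
  using assms strict_decD[OF assms(1), of l "Suc l"] by (cases "l = 1") (auto simp: lo_def)

text \<open>Interval \<open>l\<close> contains \<open>b (Suc l)\<close>, and all \<open>a i\<close>
  with \<open>i < l\<close> lie beyond its upper end.\<close>

lemma interlaced_tail_le:
  assumes "interlaced (Suc l) a b" "strict_dec (Suc l) a" "i \<in> {1..Suc l}" "a i < b (Suc l)"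
  shows "i = Suc l \<or> i = l \<and> odd (a l - a (Suc l))"
proof (rule ccontr)
  assume *: "\<not> ?thesis"
  then have l: "0 < l" using assms(3) by auto
  have I: "max (a l) (b (Suc l)) < lo a b (l - 1)" "odd (min (a l) (b (Suc l)) - a (Suc l))"
    using assms(1) unfolding interlaced_Suc[OF l] by auto
  show False
  proof (cases "i < l")
    case True
    then have "l - 1 \<noteq> 0" "a (l - 1) \<le> a i"
      using assms(2,3) by (auto intro: strict_dec_le)
    then show False using I(1) assms(4) by (auto simp: lo_def)
  next
    case False
    then have "i = l" using * assms(3) by auto
    then show False using I(2) * assms(4) by auto
  qed
qed

text \<open>If neither \<open>a (Suc l)\<close> nor a smaller \<open>a l\<close> is at odd distance
  below \<open>b (Suc l)\<close>, no partner exists; interlacing rules this out because two left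
  ends below \<open>b (Suc l)\<close> have different parities.\<close>

lemma interlaced_last:
  assumes "interlaced (Suc l) a b"
  shows "a (Suc l) < b (Suc l) \<and> (odd (b (Suc l) - a (Suc l)) \<or>
    0 < l \<and> a l < b (Suc l) \<and> odd (b (Suc l) - a l))"
proof (cases "l = 0")
  case True then show ?thesis using assms by (auto simp: interlaced_def lo_def hi_def)
next
  case False
  then have I: "a (Suc l) < min (a l) (b (Suc l))" "odd (min (a l) (b (Suc l)) - a (Suc l))"
    using assms interlaced_Suc[of l a b] by auto
  show ?thesis
  proof (cases "b (Suc l) \<le> a l")
    case True then show ?thesis using I by auto
  next
    case F: False
    then have "odd (a l - a (Suc l))" using I by auto
    then have "odd (b (Suc l) - a (Suc l)) \<or> odd (b (Suc l) - a l)" by presburger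
    then show ?thesis using I F \<open>l \<noteq> 0\<close> by auto
  qed
qed

text \<open>In the critical case \<open>a l < b (Suc l)\<close> both have the parity opposite to
  \<open>a (Suc l)\<close>. Cutting interval \<open>l\<close> down to \<open>a l\<close> then keeps
  the parity of its distance to the next interval, and oddness excludes that
  \<open>b (Suc l)\<close> touches that interval.\<close>

lemma interlaced_Suc_fixed:
  assumes a: "strict_dec (Suc l) a" and b: "strict_dec (Suc l) b"
    and last: "a (Suc l) < b (Suc l)" "odd (b (Suc l) - a (Suc l))"
    and tail: "\<And>i. i \<in> {1..l} \<Longrightarrow> a i < b (Suc l) \<Longrightarrow> i = l \<and> odd (a l - a (Suc l))"
  shows "interlaced (Suc l) a b \<longleftrightarrow> interlaced l a b"
proof (cases "l = 0")
  case True then show ?thesis using last by (auto simp: interlaced_def lo_def hi_def)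
next
  case False
  then have l: "0 < l" by simp
  have al: "a (Suc l) < a l" using strict_decD[OF a] l by simp
  show ?thesis
  proof (cases "b (Suc l) \<le> a l")
    case True then show ?thesis
      unfolding interlaced_Suc[OF l] interlaced_Suc'[OF l] using last al by (auto simp: max_def min_def)
  next
    case F: False
    have od: "odd (a l - a (Suc l))" using tail[of l] F l by auto
    have "1 < l \<longrightarrow> b (Suc l) \<le> a (l - 1)" using tail[of "l - 1"] by force
    then have le: "b (Suc l) \<le> lo a b (l - 1)" using lo_pred_le[OF b l] by auto
    have "max (a l) (b (Suc l)) < lo a b (l - 1) \<and> odd (lo a b (l - 1) - max (a l) (b (Suc l)))
      \<longleftrightarrow> a l < lo a b (l - 1) \<and> odd (lo a b (l - 1) - a l)"
    proof -
      have ev: "even (b (Suc l) - a l)" using od last(2) by presburger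
      have m: "max (a l) (b (Suc l)) = b (Suc l)" using F by simp
      have p: "odd (lo a b (l - 1) - b (Suc l)) \<longleftrightarrow> odd (lo a b (l - 1) - a l)" using ev by presburger
      have "odd (lo a b (l - 1) - b (Suc l)) \<Longrightarrow> b (Suc l) < lo a b (l - 1)" using le
        by (metis diff_self even_zero le_less)
      then show ?thesis unfolding m p using F p by linarith
    qed
    moreover have "a (Suc l) < min (a l) (b (Suc l)) \<and> odd (min (a l) (b (Suc l)) - a (Suc l))"
      using F al od by (auto simp: min_def)
    ultimately show ?thesis
      unfolding interlaced_Suc[OF l] interlaced_Suc'[OF l] by blast
  qed
qed

text \<open>Now \<open>b (Suc l)\<close> and \<open>a (Suc l)\<close> have the same parity, so the
  remaining left end \<open>a (Suc l)\<close> can stand for the upper end of interval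
  \<open>l\<close>.\<close>

lemma interlaced_Suc_swapped:
  assumes a: "strict_dec (Suc l) a" and b: "strict_dec (Suc l) b" and l: "0 < l"
    and last: "a l < b (Suc l)" "odd (b (Suc l) - a l)"
    and tail: "\<And>i. i \<in> {1..l} \<Longrightarrow> a i < b (Suc l) \<Longrightarrow> i = l \<and> odd (a l - a (Suc l))"
  shows "interlaced (Suc l) a b \<longleftrightarrow> interlaced l (a(l := a (Suc l))) b"
proof -
  let ?a = "a(l := a (Suc l))"
  have al: "a (Suc l) < a l" using strict_decD[OF a] l by simp
  have od: "odd (a l - a (Suc l))" using tail[of l] last l by auto
  have "1 < l \<longrightarrow> b (Suc l) \<le> a (l - 1)" using tail[of "l - 1"] by force
  then have le: "b (Suc l) \<le> lo a b (l - 1)" using lo_pred_le[OF b l] by auto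
  have lo: "lo ?a b i = lo a b i" if "i < l" for i using that by (auto simp: lo_def)
  have hi: "hi l ?a b (Suc i) = hi l a b (Suc i)" if "i < l - 1" for i using that by (auto simp: hi_def)
  have ev: "even (b (Suc l) - a (Suc l))" using od last(2) by presburger
  have m: "max (a l) (b (Suc l)) = b (Suc l)" using last by simp
  have p: "odd (lo a b (l - 1) - b (Suc l)) \<longleftrightarrow> odd (lo a b (l - 1) - a (Suc l))" using ev by presburger
  have "odd (lo a b (l - 1) - b (Suc l)) \<Longrightarrow> b (Suc l) < lo a b (l - 1)" using le
    by (metis diff_self even_zero le_less)
  then have "max (a l) (b (Suc l)) < lo a b (l - 1) \<and> odd (lo a b (l - 1) - max (a l) (b (Suc l)))
      \<longleftrightarrow> a (Suc l) < lo a b (l - 1) \<and> odd (lo a b (l - 1) - a (Suc l))"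
    unfolding m p using last al p by linarith
  moreover have "a (Suc l) < min (a l) (b (Suc l)) \<and> odd (min (a l) (b (Suc l)) - a (Suc l))"
    using last al od by (auto simp: min_def)
  ultimately show ?thesis
    unfolding interlaced_Suc[OF l] interlaced_Suc'[OF l] using lo hi l by auto
qed

section \<open>Matchings after removal of the smallest right end\<close>

lemma permutes_Suc_iff:
  assumes "\<sigma> (Suc l) = Suc l"
  shows "\<sigma> permutes {1..Suc l} \<longleftrightarrow> \<sigma> permutes {1..l}"
proof
  assume "\<sigma> permutes {1..Suc l}"
  then show "\<sigma> permutes {1..l}"
    by (rule permutes_superset) (use assms in \<open>auto simp: le_Suc_eq\<close>)
next
  assume "\<sigma> permutes {1..l}"
  then show "\<sigma> permutes {1..Suc l}" by (rule permutes_subset) auto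
qed

lemma permutes_image_le:
  assumes "\<sigma> permutes {1..Suc l}" "strict_dec (Suc l) b" "i \<in> {1..Suc l}"
  shows "b (Suc l) \<le> b (\<sigma> i)"
proof -
  have "\<sigma> i \<in> {1..Suc l}" using permutes_in_image[OF assms(1)] assms(3) by blast
  then show ?thesis by (intro strict_dec_le[OF assms(2)]) auto
qed

lemma matching_last:
  assumes "matching (Suc l) a b \<sigma>"
  obtains i where "i \<in> {1..Suc l}" "\<sigma> i = Suc l" "a i < b (Suc l)" "odd (b (Suc l) - a i)"
proof -
  have s: "\<sigma> permutes {1..Suc l}" using assms by (simp add: matching_def)
  then have "Suc l \<in> \<sigma> ` {1..Suc l}" by (simp add: permutes_image)
  then obtain i where "i \<in> {1..Suc l}" "\<sigma> i = Suc l" by auto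
  then show thesis using assms that[of i] unfolding matching_def by metis
qed

text \<open>Parity forbids \<open>l\<close> as partner of \<open>b (Suc l)\<close>, so
  \<open>Suc l\<close> is forced. Its run reaches no other left end of the same parity and adds no
  condition to \<open>separated\<close>.\<close>

lemma matchings_Suc_fixed:
  assumes a: "strict_dec (Suc l) a" and b: "strict_dec (Suc l) b"
    and last: "a (Suc l) < b (Suc l)" "odd (b (Suc l) - a (Suc l))"
    and tail: "\<And>i. i \<in> {1..l} \<Longrightarrow> a i < b (Suc l) \<Longrightarrow> i = l \<and> odd (a l - a (Suc l))"
  shows "matching (Suc l) a b \<sigma> \<longleftrightarrow> matching l a b \<sigma>"
    and "matching l a b \<sigma> \<Longrightarrow> separated (Suc l) a b \<sigma> \<longleftrightarrow> separated l a b \<sigma>"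
proof -
  show "matching (Suc l) a b \<sigma> \<longleftrightarrow> matching l a b \<sigma>"
  proof
    assume m: "matching (Suc l) a b \<sigma>"
    then obtain i where i: "i \<in> {1..Suc l}" "\<sigma> i = Suc l" "a i < b (Suc l)" "odd (b (Suc l) - a i)"
      by (rule matching_last)
    have "i = Suc l"
    proof (rule ccontr)
      assume "i \<noteq> Suc l"
      then have "i = l" "odd (a l - a (Suc l))" using tail[of i] i by auto
      then show False using i(4) last(2) by presburger
    qed
    then have "\<sigma> (Suc l) = Suc l" using i by simp
    then show "matching l a b \<sigma>" using m permutes_Suc_iff[of \<sigma> l] unfolding matching_def by auto
  next
    assume m: "matching l a b \<sigma>"
    then have "\<sigma> (Suc l) = Suc l" unfolding matching_def
      using permutes_not_in[of \<sigma> "{1..l}" "Suc l"] by simp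
    moreover have "\<sigma> permutes {1..Suc l}"
      using m permutes_Suc_iff[of \<sigma> l] calculation unfolding matching_def by blast
    ultimately show "matching (Suc l) a b \<sigma>" using m last
      unfolding matching_def by (auto simp: le_Suc_eq)
  qed
  assume m: "matching l a b \<sigma>"
  then have s: "\<sigma> (Suc l) = Suc l" unfolding matching_def
      using permutes_not_in[of \<sigma> "{1..l}" "Suc l"] by simp
  have new: "b (Suc l) \<le> a j" if "j \<in> {1..l}" "even (a j - a (Suc l))" for j
    using tail[of j] that by force
  show "separated (Suc l) a b \<sigma> \<longleftrightarrow> separated l a b \<sigma>"
  proof
    assume "separated (Suc l) a b \<sigma>" then show "separated l a b \<sigma>" by (auto simp: separated_def)
  next
    assume A: "separated l a b \<sigma>"
    show "separated (Suc l) a b \<sigma>" unfolding separated_def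
    proof (intro ballI impI)
      fix i j assume ij: "i \<in> {1..Suc l}" "j \<in> {1..Suc l}" "i \<noteq> j \<and> even (a i - a j)"
      then consider "i \<in> {1..l}" "j \<in> {1..l}" | "i = Suc l" "j \<in> {1..l}" | "i \<in> {1..l}" "j = Suc l"
        by (auto simp: le_Suc_eq)
      then show "b (\<sigma> i) \<le> a j \<or> b (\<sigma> j) \<le> a i"
      proof cases
        case 1 then show ?thesis using A ij unfolding separated_def by blast
      next
        case 2 
        then have "even (a j - a (Suc l))" using ij by presburger
        then show ?thesis using new[of j] 2 s by auto
      next
        case 3 then show ?thesis using new[of i] ij s by auto
      qed
    qed
  qed
qed

text \<open>The partner of \<open>b (Suc l)\<close> is forced to be \<open>l\<close>. Composition
  with \<open>t\<close> renames the surviving index \<open>Suc l\<close> to \<open>l\<close>, and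
  the run of \<open>l\<close> reaches no other left end of its parity.\<close>

lemma matchings_Suc_swapped:
  assumes a: "strict_dec (Suc l) a" and b: "strict_dec (Suc l) b" and l: "0 < l"
    and last: "a l < b (Suc l)" "odd (b (Suc l) - a l)"
    and tail: "\<And>i. i \<in> {1..l} \<Longrightarrow> a i < b (Suc l) \<Longrightarrow> i = l \<and> odd (a l - a (Suc l))"
  defines "t \<equiv> transpose l (Suc l)"
  shows "matching (Suc l) a b (\<sigma> \<circ> t) \<longleftrightarrow> matching l (a(l := a (Suc l))) b \<sigma>"
    and "matching l (a(l := a (Suc l))) b \<sigma> \<Longrightarrow>
      separated (Suc l) a b (\<sigma> \<circ> t) \<longleftrightarrow> separated l (a(l := a (Suc l))) b \<sigma>"
proof -
  let ?a = "a(l := a (Suc l))"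
  have t: "t l = Suc l" "t (Suc l) = l" "\<And>i. i \<noteq> l \<Longrightarrow> i \<noteq> Suc l \<Longrightarrow> t i = i"
    by (auto simp: t_def transpose_def)
  have tt: "t permutes {1..Suc l}" unfolding t_def using l by (intro permutes_swap_id) auto
  have od: "odd (a l - a (Suc l))" using tail[of l] last l by auto
  have perm: "\<sigma> \<circ> t permutes {1..Suc l} \<longleftrightarrow> \<sigma> permutes {1..Suc l}"
  proof
    assume "\<sigma> \<circ> t permutes {1..Suc l}"
    then have "(\<sigma> \<circ> t) \<circ> t permutes {1..Suc l}" using tt by (rule permutes_compose[rotated])
    then show "\<sigma> permutes {1..Suc l}" by (simp add: o_assoc[symmetric] t_def)
  qed (use tt in \<open>auto intro: permutes_compose\<close>)
  show *: "matching (Suc l) a b (\<sigma> \<circ> t) \<longleftrightarrow> matching l ?a b \<sigma>"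
  proof
    assume m: "matching (Suc l) a b (\<sigma> \<circ> t)"
    then obtain i where i: "i \<in> {1..Suc l}" "(\<sigma> \<circ> t) i = Suc l" "a i < b (Suc l)" "odd (b (Suc l) - a i)"
      by (rule matching_last)
    have "i \<noteq> Suc l" using i(4) od last(2) by auto
    then have "i = l" using tail[of i] i by auto
    then have s: "\<sigma> (Suc l) = Suc l" using i t by simp
    have "?a i < b (\<sigma> i) \<and> odd (b (\<sigma> i) - ?a i)" if "i \<in> {1..l}" for i
    proof (cases "i = l")
      case True
      have "a (Suc l) < b ((\<sigma> \<circ> t) (Suc l)) \<and> odd (b ((\<sigma> \<circ> t) (Suc l)) - a (Suc l))"
        by (rule bspec[OF conjunct2[OF m[unfolded matching_def]]]) simp
      then show ?thesis using True t by simp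
    next
      case False
      have "a i < b ((\<sigma> \<circ> t) i) \<and> odd (b ((\<sigma> \<circ> t) i) - a i)"
        using m that unfolding matching_def by auto
      then show ?thesis using False t that by simp
    qed
    then show "matching l ?a b \<sigma>" using m perm permutes_Suc_iff[of \<sigma> l, OF s] unfolding matching_def by simp
  next
    assume m: "matching l ?a b \<sigma>"
    then have s: "\<sigma> (Suc l) = Suc l" unfolding matching_def
      using permutes_not_in[of \<sigma> "{1..l}" "Suc l"] by simp
    have "a i < b ((\<sigma> \<circ> t) i) \<and> odd (b ((\<sigma> \<circ> t) i) - a i)" if i: "i \<in> {1..Suc l}" for i
    proof -
      consider "i = l" | "i = Suc l" | "i \<noteq> l" "i \<in> {1..l}"
        using i by (cases "i = Suc l"; cases "i = l"; auto)
      then show ?thesis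
      proof cases
        case 1 then show ?thesis using t s last by simp
      next
        case 2
        have "?a l < b (\<sigma> l) \<and> odd (b (\<sigma> l) - ?a l)"
          by (rule bspec[OF conjunct2[OF m[unfolded matching_def]]]) (use l in simp)
        then show ?thesis using t 2 by simp
      next
        case 3
        have "?a i < b (\<sigma> i) \<and> odd (b (\<sigma> i) - ?a i)"
          by (rule bspec[OF conjunct2[OF m[unfolded matching_def]]]) (use 3 in simp)
        then show ?thesis using t 3 by simp
      qed
    qed
    then show "matching (Suc l) a b (\<sigma> \<circ> t)" using m perm permutes_Suc_iff[of \<sigma> l, OF s] unfolding matching_def by simp
  qed
  assume m: "matching l ?a b \<sigma>"
  then have s: "\<sigma> (Suc l) = Suc l" unfolding matching_def
      using permutes_not_in[of \<sigma> "{1..l}" "Suc l"] by simp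
  have new: "b (Suc l) \<le> a j" if "j \<in> {1..Suc l}" "j \<noteq> l" "even (a j - a l)" for j
  proof (cases "j = Suc l")
    case True then show ?thesis using that od by presburger
  next
    case False then show ?thesis using tail[of j] that by force
  qed
  have sep: "separated (Suc l) a b (\<sigma> \<circ> t) \<longleftrightarrow>
     (\<forall>i\<in>{1..Suc l} - {l}. \<forall>j\<in>{1..Suc l} - {l}. i \<noteq> j \<and> even (a i - a j) \<longrightarrow>
        b ((\<sigma> \<circ> t) i) \<le> a j \<or> b ((\<sigma> \<circ> t) j) \<le> a i)" (is "_ \<longleftrightarrow> ?R")
  proof
    assume A: ?R
    show "separated (Suc l) a b (\<sigma> \<circ> t)" unfolding separated_def
    proof (intro ballI impI)
      fix i j assume ij: "i \<in> {1..Suc l}" "j \<in> {1..Suc l}" "i \<noteq> j \<and> even (a i - a j)"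
      then consider "i \<noteq> l" "j \<noteq> l" | "i = l" "j \<noteq> l" | "j = l" "i \<noteq> l" by auto
      then show "b ((\<sigma> \<circ> t) i) \<le> a j \<or> b ((\<sigma> \<circ> t) j) \<le> a i"
      proof cases
        case 1 then show ?thesis using A ij by blast
      next
        case 2 
        then have "even (a j - a l)" using ij by presburger
        then show ?thesis using new[of j] 2 s t ij by auto
      next
        case 3 then show ?thesis using new[of i] ij s t by auto
      qed
    qed
  qed (auto simp: separated_def)
  \<comment> \<open>Renames the indices other than \<open>l\<close> of the longer sequence to those
    of the shorter one.\<close>
  define h where "h = (\<lambda>i. if i = Suc l then l else i)"
  have im: "h ` ({1..Suc l} - {l}) = {1..l}"
  proof
    show "h ` ({1..Suc l} - {l}) \<subseteq> {1..l}" using l by (auto simp: h_def)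
    show "{1..l} \<subseteq> h ` ({1..Suc l} - {l})"
    proof
      fix x assume x: "x \<in> {1..l}"
      show "x \<in> h ` ({1..Suc l} - {l})"
      proof (cases "x = l")
        case True then have "x = h (Suc l)" by (simp add: h_def)
        then show ?thesis by (rule image_eqI) auto
      next
        case False then have "x = h x" using x by (simp add: h_def)
        then show ?thesis using x False by (intro image_eqI) auto
      qed
    qed
  qed
  have h: "?a (h i) = a i" "\<sigma> (h i) = (\<sigma> \<circ> t) i" if "i \<in> {1..Suc l} - {l}" for i
    using that t by (auto simp: h_def)
  have hinj: "h i = h j \<longleftrightarrow> i = j" if "i \<in> {1..Suc l} - {l}" "j \<in> {1..Suc l} - {l}" for i j
    using that by (auto simp: h_def)
  show "separated (Suc l) a b (\<sigma> \<circ> t) \<longleftrightarrow> separated l ?a b \<sigma>"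
    unfolding sep unfolding separated_def im[symmetric] ball_simps(9)
    by (intro ball_cong HOL.refl) (simp add: h hinj del: fun_upd_apply o_apply)
qed

text \<open>Two left ends of equal parity lie below every right end, since \<open>b (Suc l)\<close>
  is the smallest. Exchanging their partners is an involution of the matchings that changes the
  sign, and their runs always overlap, so no matching is separated.\<close>

lemma matching_sum_zero:
  assumes a: "strict_dec (Suc l) a" and b: "strict_dec (Suc l) b"
    and ij: "i \<in> {1..Suc l}" "j \<in> {1..Suc l}" "i \<noteq> j" "even (a i - a j)"
      "a i < b (Suc l)" "a j < b (Suc l)"
  shows "(\<Sum>\<sigma> | matching (Suc l) a b \<sigma>. sign \<sigma>) = 0"
    and "matching (Suc l) a b \<sigma> \<Longrightarrow> \<not> separated (Suc l) a b \<sigma>"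
proof -
  let ?t = "transpose i j"
  have tp: "?t permutes {1..Suc l}" using ij by (intro permutes_swap_id)
  have pt: "permutation ?t" by (rule permutation_swap_id)
  have mt: "matching (Suc l) a b (\<sigma> \<circ> ?t)" if m: "matching (Suc l) a b \<sigma>" for \<sigma>
  proof -
    have s: "\<sigma> permutes {1..Suc l}" using m by (simp add: matching_def)
    have "a k < b ((\<sigma> \<circ> ?t) k) \<and> odd (b ((\<sigma> \<circ> ?t) k) - a k)" if k: "k \<in> {1..Suc l}" for k
    proof -
      have mi: "odd (b (\<sigma> i) - a i)" "odd (b (\<sigma> j) - a j)" using m ij by (auto simp: matching_def)
      have le: "b (Suc l) \<le> b (\<sigma> i)" "b (Suc l) \<le> b (\<sigma> j)" using permutes_image_le[OF s b] ij by auto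
      consider "k = i" | "k = j" | "k \<noteq> i" "k \<noteq> j" by auto
      then show ?thesis
      proof cases
        case 1
        then have "(\<sigma> \<circ> ?t) k = \<sigma> j" by simp
        moreover have "odd (b (\<sigma> j) - a i)" using mi(2) ij(4) by presburger
        ultimately show ?thesis using 1 le ij by simp
      next
        case 2
        then have "(\<sigma> \<circ> ?t) k = \<sigma> i" by simp
        moreover have "odd (b (\<sigma> i) - a j)" using mi(1) ij(4) by presburger
        ultimately show ?thesis using 2 le ij by simp
      next
        case 3 then show ?thesis using m k by (auto simp: matching_def)
      qed
    qed
    then show ?thesis using permutes_compose[OF tp s] unfolding matching_def by blast
  qed
  have inv: "(\<sigma> \<circ> ?t) \<circ> ?t = \<sigma>" for \<sigma> :: "nat \<Rightarrow> nat" by (simp add: o_assoc[symmetric])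
  have "(\<Sum>\<sigma> | matching (Suc l) a b \<sigma>. sign \<sigma>) = (\<Sum>\<sigma> | matching (Suc l) a b \<sigma>. sign (\<sigma> \<circ> ?t))"
    by (rule sum.reindex_bij_witness[where i = "\<lambda>\<sigma>. \<sigma> \<circ> ?t" and j = "\<lambda>\<sigma>. \<sigma> \<circ> ?t"])
       (use mt inv in auto)
  also have "\<dots> = (\<Sum>\<sigma> | matching (Suc l) a b \<sigma>. - sign \<sigma>)"
  proof (rule sum.cong[OF HOL.refl])
    fix \<sigma> assume "\<sigma> \<in> {\<sigma>. matching (Suc l) a b \<sigma>}"
    then have "permutation \<sigma>" using permutes_imp_permutation[of "{1..Suc l}" \<sigma>] by (auto simp: matching_def)
    then show "sign (\<sigma> \<circ> ?t) = - sign \<sigma>" using ij(3) by (simp add: sign_compose pt sign_swap_id)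
  qed
  finally show "(\<Sum>\<sigma> | matching (Suc l) a b \<sigma>. sign \<sigma>) = 0" by (simp add: sum_negf)
  assume m: "matching (Suc l) a b \<sigma>"
  then have "b (Suc l) \<le> b (\<sigma> i)" "b (Suc l) \<le> b (\<sigma> j)"
    using permutes_image_le[of \<sigma> l b] b ij by (auto simp: matching_def)
  then have "\<not> (b (\<sigma> i) \<le> a j \<or> b (\<sigma> j) \<le> a i)" using ij(5,6) by linarith
  then show "\<not> separated (Suc l) a b \<sigma>" using ij(1-4) unfolding separated_def by blast
qed

lemma odd_overlaps_Suc:
  "odd_overlaps (Suc l) a b =
    (if 0 < l \<and> a l < b (Suc l) \<and> odd (b (Suc l) - a l) then insert l (odd_overlaps l a b)
     else odd_overlaps l a b)"
  by (auto simp: odd_overlaps_def less_Suc_eq)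

lemma finite_odd_overlaps: "finite (odd_overlaps l a b)"
  by (rule finite_subset[of _ "{..<l}"]) (auto simp: odd_overlaps_def)

text \<open>Three integers are never pairwise at odd distance. So either two left ends of equal
  parity lie below the smallest right end and everything cancels, or at most \<open>l\<close> and
  \<open>Suc l\<close> lie there and the partner is forced or missing. A forced partner
  \<open>l\<close> costs one transposition and is one more element of
  \<open>odd_overlaps\<close>.\<close>

theorem matching_dichotomy:
  assumes "strict_dec l a" "strict_dec l b"
  shows "(interlaced l a b \<longrightarrow> (\<exists>\<sigma>. {\<tau>. matching l a b \<tau>} = {\<sigma>} \<and> separated l a b \<sigma> \<and>
            sign \<sigma> = (-1) ^ card (odd_overlaps l a b))) \<and>
         (\<not> interlaced l a b \<longrightarrow> (\<forall>\<sigma>. matching l a b \<sigma> \<longrightarrow> \<not> separated l a b \<sigma>) \<and>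
            (\<Sum>\<sigma> | matching l a b \<sigma>. sign \<sigma>) = 0)"
  using assms
proof (induction l arbitrary: a)
  case 0
  have "{\<tau>. matching 0 a b \<tau>} = {id}" by (auto simp: matching_def)
  then show ?case by (auto simp: interlaced_def separated_def odd_overlaps_def sign_id)
next
  case (Suc l)
  note a = Suc.prems(1) and b = Suc.prems(2)
  have a': "strict_dec l a" "strict_dec l b" using a b by (auto simp: strict_dec_def)
  consider (two) i j where "i \<in> {1..Suc l}" "j \<in> {1..Suc l}" "i \<noteq> j" "even (a i - a j)"
      "a i < b (Suc l)" "a j < b (Suc l)"
    | (one) "\<And>i j. i \<in> {1..Suc l} \<Longrightarrow> j \<in> {1..Suc l} \<Longrightarrow> i \<noteq> j \<Longrightarrow>
      a i < b (Suc l) \<Longrightarrow> a j < b (Suc l) \<Longrightarrow> odd (a i - a j)" by blast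
  then show ?case
  proof cases
    case two
    have "\<not> interlaced (Suc l) a b"
    proof
      assume I: "interlaced (Suc l) a b"
      from interlaced_tail_le[OF I a two(1,5)] interlaced_tail_le[OF I a two(2,6)] two(3,4)
      show False by (metis dvd_minus_iff even_diff minus_diff_eq)
    qed
    then show ?thesis using matching_sum_zero[OF a b two] by blast
  next
    case one
    have tail: "i = l \<and> odd (a l - a (Suc l))" if i: "i \<in> {1..l}" "a i < b (Suc l)" for i
    proof -
      have lt: "a (Suc l) < b (Suc l)" using strict_decD[OF a, of i "Suc l"] i by simp
      have "i = l"
      proof (rule ccontr)
        assume "i \<noteq> l"
        then have "a l < b (Suc l)" using strict_decD[OF a, of i l] i by simp
        then have "odd (a i - a l)" "odd (a i - a (Suc l))" "odd (a l - a (Suc l))"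
          using one[of i l] one[of i "Suc l"] one[of l "Suc l"] i lt \<open>i \<noteq> l\<close> by auto
        then show False by presburger
      qed
      then show ?thesis using one[of l "Suc l"] i lt by auto
    qed
    consider (fixed) "a (Suc l) < b (Suc l)" "odd (b (Suc l) - a (Suc l))"
      | (swapped) "0 < l" "a l < b (Suc l)" "odd (b (Suc l) - a l)"
      | (none) "\<not> (a (Suc l) < b (Suc l) \<and> odd (b (Suc l) - a (Suc l)))"
         "\<not> (0 < l \<and> a l < b (Suc l) \<and> odd (b (Suc l) - a l))" by blast
    then show ?thesis
    proof cases
      case fixed
      have M: "matching (Suc l) a b = matching l a b"
        using matchings_Suc_fixed(1)[OF a b fixed tail] by blast
      have S: "matching l a b \<sigma> \<Longrightarrow> separated (Suc l) a b \<sigma> = separated l a b \<sigma>" for \<sigma>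
        using matchings_Suc_fixed(2)[OF a b fixed tail] by blast
      have I: "interlaced (Suc l) a b = interlaced l a b"
        using interlaced_Suc_fixed[OF a b fixed tail] by blast
      have "\<not> (0 < l \<and> a l < b (Suc l) \<and> odd (b (Suc l) - a l))"
      proof
        assume *: "0 < l \<and> a l < b (Suc l) \<and> odd (b (Suc l) - a l)"
        then have "odd (a l - a (Suc l))" using tail[of l] by auto
        then show False using * fixed by presburger
      qed
      then have O: "odd_overlaps (Suc l) a b = odd_overlaps l a b" unfolding odd_overlaps_Suc by (rule if_not_P)
      show ?thesis unfolding M I O
      proof (cases "interlaced l a b")
        case True
        then obtain \<sigma> where \<sigma>: "{\<tau>. matching l a b \<tau>} = {\<sigma>}" "separated l a b \<sigma>"
            "sign \<sigma> = (-1) ^ card (odd_overlaps l a b)" using Suc.IH[OF a'] by blast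
        then have "separated (Suc l) a b \<sigma>" using S[of \<sigma>] by blast
        then show "(interlaced l a b \<longrightarrow> (\<exists>\<sigma>. {\<tau>. matching l a b \<tau>} = {\<sigma>} \<and>
            separated (Suc l) a b \<sigma> \<and> sign \<sigma> = (-1) ^ card (odd_overlaps l a b))) \<and>
         (\<not> interlaced l a b \<longrightarrow> (\<forall>\<sigma>. matching l a b \<sigma> \<longrightarrow> \<not> separated (Suc l) a b \<sigma>) \<and>
            (\<Sum>\<sigma> | matching l a b \<sigma>. sign \<sigma>) = 0)" using True \<sigma> by blast
      next
        case False
        then have "\<forall>\<sigma>. matching l a b \<sigma> \<longrightarrow> \<not> separated l a b \<sigma>"
            "(\<Sum>\<sigma> | matching l a b \<sigma>. sign \<sigma>) = 0" using Suc.IH[OF a'] by blast+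
        then show "(interlaced l a b \<longrightarrow> (\<exists>\<sigma>. {\<tau>. matching l a b \<tau>} = {\<sigma>} \<and>
            separated (Suc l) a b \<sigma> \<and> sign \<sigma> = (-1) ^ card (odd_overlaps l a b))) \<and>
         (\<not> interlaced l a b \<longrightarrow> (\<forall>\<sigma>. matching l a b \<sigma> \<longrightarrow> \<not> separated (Suc l) a b \<sigma>) \<and>
            (\<Sum>\<sigma> | matching l a b \<sigma>. sign \<sigma>) = 0)" using False S by blast
      qed
    next
      case swapped
      let ?t = "transpose l (Suc l)" and ?a = "a(l := a (Suc l))"
      have inv: "(\<sigma> \<circ> ?t) \<circ> ?t = \<sigma>" for \<sigma> :: "nat \<Rightarrow> nat" by (simp add: o_assoc[symmetric])
      have sd: "strict_dec l ?a"
        using a by (auto simp: strict_dec_def)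
      have M: "matching (Suc l) a b (\<sigma> \<circ> ?t) \<longleftrightarrow> matching l ?a b \<sigma>" for \<sigma>
        using matchings_Suc_swapped(1)[OF a b swapped tail] by blast
      have S: "matching l ?a b \<sigma> \<Longrightarrow> separated (Suc l) a b (\<sigma> \<circ> ?t) = separated l ?a b \<sigma>" for \<sigma>
        using matchings_Suc_swapped(2)[OF a b swapped tail] by blast
      have I: "interlaced (Suc l) a b = interlaced l ?a b"
        using interlaced_Suc_swapped[OF a b swapped tail] by blast
      have "odd_overlaps l ?a b = odd_overlaps l a b" by (auto simp: odd_overlaps_def)
      then have "odd_overlaps (Suc l) a b = insert l (odd_overlaps l ?a b)"
        using swapped by (simp add: odd_overlaps_Suc)
      moreover have "l \<notin> odd_overlaps l ?a b" by (simp add: odd_overlaps_def)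
      ultimately have O: "card (odd_overlaps (Suc l) a b) = Suc (card (odd_overlaps l ?a b))"
        using finite_odd_overlaps by simp
      have img: "{\<tau>. matching (Suc l) a b \<tau>} = (\<lambda>\<sigma>. \<sigma> \<circ> ?t) ` {\<sigma>. matching l ?a b \<sigma>}" (is "?A = ?B")
      proof
        show "?B \<subseteq> ?A" using M by auto
        show "?A \<subseteq> ?B"
        proof
          fix \<tau> assume "\<tau> \<in> ?A"
          then have "matching l ?a b (\<tau> \<circ> ?t)" using M[of "\<tau> \<circ> ?t"] inv by simp
          then show "\<tau> \<in> ?B" using inv[of \<tau>] by (metis (mono_tags) image_eqI mem_Collect_eq)
        qed
      qed
      have inj: "inj_on (\<lambda>\<sigma>. \<sigma> \<circ> ?t) {\<sigma>. matching l ?a b \<sigma>}"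
        by (rule inj_on_inverseI[where g = "\<lambda>\<sigma>. \<sigma> \<circ> ?t"]) (use inv in simp)
      have sg: "sign (\<sigma> \<circ> ?t) = - sign \<sigma>" if "matching l ?a b \<sigma>" for \<sigma>
      proof -
        have "permutation \<sigma>" using that permutes_imp_permutation[of "{1..l}" \<sigma>] by (auto simp: matching_def)
        then show ?thesis by (simp add: sign_compose permutation_swap_id sign_swap_id)
      qed
      note IH = Suc.IH[OF sd a'(2)]
      show ?thesis
      proof (cases "interlaced l ?a b")
        case True
        then obtain \<sigma> where \<sigma>: "{\<tau>. matching l ?a b \<tau>} = {\<sigma>}" "separated l ?a b \<sigma>"
            "sign \<sigma> = (-1) ^ card (odd_overlaps l ?a b)" using IH by blast
        have m: "matching l ?a b \<sigma>" using \<sigma>(1) by blast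
        have "{\<tau>. matching (Suc l) a b \<tau>} = {\<sigma> \<circ> ?t}" using img \<sigma>(1) by simp
        moreover have "separated (Suc l) a b (\<sigma> \<circ> ?t)" using S m \<sigma>(2) by simp
        moreover have "sign (\<sigma> \<circ> ?t) = (-1) ^ card (odd_overlaps (Suc l) a b)"
          using sg[OF m] \<sigma>(3) O by simp
        ultimately have ex: "\<exists>\<sigma>. {\<tau>. matching (Suc l) a b \<tau>} = {\<sigma>} \<and> separated (Suc l) a b \<sigma> \<and>
            sign \<sigma> = (-1) ^ card (odd_overlaps (Suc l) a b)" by (intro exI[of _ "\<sigma> \<circ> ?t"] conjI)
        have J: "interlaced (Suc l) a b" unfolding I by (rule True)
        show ?thesis by (rule conjI, rule impI, rule ex, rule impI, rule notE[OF _ J])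
      next
        case False
        have "\<not> separated (Suc l) a b \<tau>" if "matching (Suc l) a b \<tau>" for \<tau>
        proof -
          have m: "matching l ?a b (\<tau> \<circ> ?t)" using M[of "\<tau> \<circ> ?t"] that inv by simp
          have "\<not> separated l ?a b (\<tau> \<circ> ?t)" using conjunct2[OF IH] False m by blast
          then show ?thesis using S[OF m] inv[of \<tau>] by simp
        qed
        moreover have "(\<Sum>\<tau> | matching (Suc l) a b \<tau>. sign \<tau>) = 0"
        proof -
          have "(\<Sum>\<tau> | matching (Suc l) a b \<tau>. sign \<tau>) = (\<Sum>\<sigma> | matching l ?a b \<sigma>. sign (\<sigma> \<circ> ?t))"
            unfolding img by (simp add: sum.reindex[OF inj])
          also have "\<dots> = (\<Sum>\<sigma> | matching l ?a b \<sigma>. - sign \<sigma>)"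
            by (rule sum.cong) (use sg in auto)
          also have "\<dots> = 0"
            by (simp only: sum_negf conjunct2[OF mp[OF conjunct2[OF IH] False]] minus_zero)
          finally show ?thesis .
        qed
        ultimately show ?thesis using False I by simp
      qed
    next
      case none
      have nom: "\<not> matching (Suc l) a b \<sigma>" for \<sigma>
      proof
        assume "matching (Suc l) a b \<sigma>"
        then obtain i where i: "i \<in> {1..Suc l}" "a i < b (Suc l)" "odd (b (Suc l) - a i)"
          by (rule matching_last)
        then have "i \<noteq> Suc l" using none(1) by auto
        then have "i = l" "0 < l" using tail[of i] i by auto
        then show False using i none(2) by auto
      qed
      then have "{\<sigma>. matching (Suc l) a b \<sigma>} = {}" by blast
      moreover have "\<not> interlaced (Suc l) a b" using interlaced_last none by blast
      ultimately show ?thesis using nom by simp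
    qed
  qed
qed

text \<open>Reindexing by \<open>h\<close> alone would show that twice the sum is 0, which says
  nothing in the presence of 2-torsion. Therefore orbits are removed one by one, and fixed points
  need a hypothesis of their own.\<close>

lemma sum_involution_zero:
  fixes f :: "'b \<Rightarrow> 'a::ab_group_add"
  assumes "finite S" and "\<And>x. x \<in> S \<Longrightarrow> h x \<in> S" and "\<And>x. x \<in> S \<Longrightarrow> h (h x) = x"
    and "\<And>x. x \<in> S \<Longrightarrow> f (h x) = - f x" and "\<And>x. x \<in> S \<Longrightarrow> h x = x \<Longrightarrow> f x = 0"
  shows "sum f S = 0"
  using assms
proof (induction "card S" arbitrary: S rule: less_induct)
  case less
  show ?case
  proof (cases "S = {}")
    case False
    then obtain x where x: "x \<in> S" by blast
    have hx: "h x \<in> S" "h (h x) = x" using less.prems x by auto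
    let ?T = "S - {x, h x}"
    have "sum f ?T = 0"
    proof (rule less.hyps)
      show "card ?T < card S" using x less.prems(1) by (intro psubset_card_mono) auto
      fix y assume y: "y \<in> ?T"
      then have "h y \<noteq> x" "h y \<noteq> h x" using less.prems(3)[of y] less.prems(3)[OF x] by auto
      then show "h y \<in> ?T" using y less.prems(2) by blast
    qed (use less.prems in auto)
    moreover have "sum f S = sum f ?T + sum f {x, h x}"
      by (rule sum.subset_diff) (use x hx less.prems(1) in auto)
    moreover have "sum f {x, h x} = 0"
      using less.prems(4)[OF x] less.prems(5)[OF x] by (cases "h x = x") auto
    ultimately show ?thesis by simp
  qed simp
qed

section \<open>Cancellation of intersecting families\<close>

definition families :: "nat \<Rightarrow> nat \<Rightarrow> (nat \<Rightarrow> int) \<Rightarrow> (nat \<Rightarrow> nat \<Rightarrow> int) set" where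
  "families n l s = (\<Pi>\<^sub>E i\<in>{1..l}. trails n (s i))"

definition vertex_disjoint :: "nat \<Rightarrow> nat \<Rightarrow> (nat \<Rightarrow> nat \<Rightarrow> int) \<Rightarrow> bool" where
  "vertex_disjoint n l A \<longleftrightarrow> (\<forall>r\<le>n. inj_on (\<lambda>i. A i r) {1..l})"

definition clash :: "nat \<Rightarrow> nat \<Rightarrow> (nat \<Rightarrow> nat \<Rightarrow> int) \<Rightarrow> nat \<Rightarrow> nat \<Rightarrow> nat \<Rightarrow> bool" where
  "clash n l A r i j \<longleftrightarrow> r \<le> n \<and> i \<in> {1..l} \<and> j \<in> {1..l} \<and> i < j \<and> A i r = A j r \<and>
    (\<forall>r'. r < r' \<and> r' \<le> n \<longrightarrow> inj_on (\<lambda>i. A i r') {1..l})"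

text \<open>The tail exchange of Lindstroem, Gessel and Viennot: the prescribed ends at row
  \<open>n\<close> stay, the free ends at row 0 are transposed.\<close>

definition cut :: "(nat \<Rightarrow> nat \<Rightarrow> int) \<Rightarrow> nat \<Rightarrow> nat \<Rightarrow> nat \<Rightarrow> nat \<Rightarrow> nat \<Rightarrow> int" where
  "cut A r i j k r' = (if r' \<le> r then A (transpose i j k) r' else A k r')"

lemma finite_families: "finite (families n l s)"
  unfolding families_def by (intro finite_PiE finite_trails finite_atLeastAtMost)

lemma clash_exists:
  assumes "\<not> vertex_disjoint n l A"
  obtains r i j where "clash n l A r i j"
proof -
  let ?P = "\<lambda>r. r \<le> n \<and> \<not> inj_on (\<lambda>i. A i r) {1..l}"
  obtain r0 where "?P r0" using assms by (auto simp: vertex_disjoint_def)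
  then have r: "?P (Greatest ?P)" by (rule GreatestI_nat[where b = n]) simp
  have max: "r' \<le> Greatest ?P" if "?P r'" for r' using that by (rule Greatest_le_nat[where b = n]) simp
  obtain i j where "i \<in> {1..l}" "j \<in> {1..l}" "i \<noteq> j" "A i (Greatest ?P) = A j (Greatest ?P)"
    using r unfolding inj_on_def by blast
  moreover have "inj_on (\<lambda>i. A i r') {1..l}" if "Greatest ?P < r'" "r' \<le> n" for r'
    using max[of r'] that by (meson not_le)
  ultimately have "clash n l A (Greatest ?P) i j \<or> clash n l A (Greatest ?P) j i"
    using r unfolding clash_def by (metis nat_neq_iff)
  then show thesis using that by blast
qed

context
  fixes n l r i j :: nat and A :: "nat \<Rightarrow> nat \<Rightarrow> int"
  assumes cl: "clash n l A r i j"
begin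

lemma cut_row: "r \<le> r' \<Longrightarrow> cut A r i j k r' = A k r'"
  using cl by (auto simp: cut_def clash_def transpose_def)

lemma clash_not_inj: "\<not> inj_on (\<lambda>k. A k r) {1..l}"
proof
  assume "inj_on (\<lambda>k. A k r) {1..l}"
  then have "i = j" using cl by (intro inj_onD[of "\<lambda>k. A k r"]) (auto simp: clash_def)
  then show False using cl by (simp add: clash_def)
qed

text \<open>From row \<open>r\<close> upwards nothing changes. A clash below \<open>r\<close> is
  impossible on either side, since it would need row \<open>r\<close> to be free of
  repetitions.\<close>

lemma clash_cut: "clash n l (cut A r i j) \<rho> x y \<longleftrightarrow> clash n l A \<rho> x y"
proof (cases "r \<le> \<rho>")
  case True
  then show ?thesis by (auto simp: clash_def cut_row)
next
  case False
  have "\<not> inj_on (\<lambda>k. cut A r i j k r) {1..l}" using clash_not_inj by (simp add: cut_row)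
  with clash_not_inj show ?thesis using False cl unfolding clash_def by (meson not_le)
qed

lemma cut_cut: "cut (cut A r i j) r i j = A"
  by (auto simp: cut_def fun_eq_iff)

lemma transpose_ends: "transpose i j k \<in> {1..l} \<longleftrightarrow> k \<in> {1..l}"
  using cl by (auto simp: clash_def transpose_def)

lemma cut_families:
  assumes "A \<in> families n l s" shows "cut A r i j \<in> families n l s"
  unfolding families_def
proof (rule PiE_I)
  have A: "A k \<in> trails n (s k)" if "k \<in> {1..l}" for k using assms that by (auto simp: families_def)
  fix k assume k: "k \<in> {1..l}"
  let ?k = "transpose i j k"
  have Ak: "A k \<in> trails n (s k)" and Atk: "A ?k \<in> trails n (s ?k)" using A k transpose_ends by auto
  have ext: "cut A r i j k \<in> {..n} \<rightarrow>\<^sub>E UNIV"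
    using Ak cl by (auto simp: trails_def PiE_def extensional_def cut_def clash_def)
  have "cut A r i j k n = s k" using Ak cl by (simp add: cut_row clash_def trails_def)
  moreover have "cut A r i j k (Suc r') = cut A r i j k r' \<or> cut A r i j k (Suc r') = cut A r i j k r' + 1"
    if "r' < n" for r'
  proof (cases "r' < r")
    case True then show ?thesis using Atk that by (auto simp: cut_def trails_def)
  next
    case False then show ?thesis using Ak that by (auto simp: cut_row trails_def)
  qed
  ultimately show "cut A r i j k \<in> trails n (s k)" using ext by (simp add: trails_def)
next
  fix k assume k: "k \<notin> {1..l}"
  then have "transpose i j k = k" using cl by (auto simp: clash_def transpose_def)
  then have "cut A r i j k = A k" by (auto simp: cut_def fun_eq_iff)
  then show "cut A r i j k = undefined" using assms k by (simp add: families_def PiE_def extensional_def)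
qed

text \<open>Every row is merely permuted, and the factor of a vertex depends on its row and position
  only. This is what the passage to vertex weights is for.\<close>

lemma cut_weight:
  fixes F :: "nat \<Rightarrow> int \<Rightarrow> 'a::comm_monoid_mult"
  shows "(\<Prod>k\<in>{1..l}. \<Prod>r'\<le>n. F r' (cut A r i j k r')) = (\<Prod>k\<in>{1..l}. \<Prod>r'\<le>n. F r' (A k r'))"
proof -
  have "(\<Prod>k\<in>{1..l}. F r' (cut A r i j k r')) = (\<Prod>k\<in>{1..l}. F r' (A k r'))" for r'
  proof (cases "r' \<le> r")
    case True
    have "transpose i j permutes {1..l}" using cl by (intro permutes_swap_id) (auto simp: clash_def)
    then have "(\<Prod>k\<in>{1..l}. F r' (A k r')) = (\<Prod>k\<in>{1..l}. F r' (A (transpose i j k) r'))"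
      using prod.permute[of "transpose i j" "{1..l}" "\<lambda>k. F r' (A k r')"] by (simp add: comp_def)
    then show ?thesis using True by (simp add: cut_def)
  qed (simp add: cut_def)
  then show ?thesis by (subst (1 2) prod.swap) simp
qed

end

text \<open>
  The parts below the topmost height with a common point are exchanged. The rows from this height
  upwards do not change, so the same pair is chosen again.
\<close>

lemma sum_families_disjoint:
  fixes F :: "nat \<Rightarrow> int \<Rightarrow> 'a::comm_ring_1" and T :: "(nat \<Rightarrow> int) \<Rightarrow> 'a"
  assumes alt: "\<And>v i j. i \<in> {1..l} \<Longrightarrow> j \<in> {1..l} \<Longrightarrow> i \<noteq> j \<Longrightarrow> T (v \<circ> transpose i j) = - T v"
    and eq: "\<And>v i j. i \<in> {1..l} \<Longrightarrow> j \<in> {1..l} \<Longrightarrow> i \<noteq> j \<Longrightarrow> v i = v j \<Longrightarrow> T v = 0"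
  shows "(\<Sum>A\<in>families n l s. (\<Prod>k\<in>{1..l}. \<Prod>r\<le>n. F r (A k r)) * T (\<lambda>k. A k 0)) =
    (\<Sum>A | A \<in> families n l s \<and> vertex_disjoint n l A.
      (\<Prod>k\<in>{1..l}. \<Prod>r\<le>n. F r (A k r)) * T (\<lambda>k. A k 0))"
    (is "sum ?f ?S = sum ?f ?D")
proof -
  let ?B = "{A \<in> families n l s. \<not> vertex_disjoint n l A}"
  define sel where "sel A = (SOME (r, i, j). clash n l A r i j)" for A
  define h where "h A = (case sel A of (r, i, j) \<Rightarrow> cut A r i j)" for A
  have sel: "case sel A of (r, i, j) \<Rightarrow> clash n l A r i j" if A: "A \<in> ?B" for A
  proof -
    obtain r i j where "clash n l A r i j" using A clash_exists[of n l A] by blast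
    then show ?thesis unfolding sel_def by (intro someI[of "\<lambda>(r, i, j). clash n l A r i j" "(r, i, j)"]) simp
  qed
  have "sum ?f ?B = 0"
  proof (rule sum_involution_zero[where h = h])
    show "finite ?B" using finite_families by simp
    fix A assume A: "A \<in> ?B"
    obtain r i j where s: "sel A = (r, i, j)" by (cases "sel A") auto
    then have cl: "clash n l A r i j" using sel[OF A] by simp
    have hA: "h A = cut A r i j" by (simp add: h_def s)
    have selh: "sel (h A) = (r, i, j)" unfolding hA s[symmetric] sel_def clash_cut[OF cl] ..
    have "\<not> inj_on (\<lambda>k. cut A r i j k r) {1..l}" using clash_not_inj[OF cl] by (simp add: cut_row[OF cl])
    then have "\<not> vertex_disjoint n l (h A)" using cl by (auto simp: hA vertex_disjoint_def clash_def)
    then show "h A \<in> ?B" using cut_families[OF cl] A by (simp add: hA)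
    have "h (h A) = cut (h A) r i j" by (simp only: h_def[of "h A"] selh prod.case)
    then show "h (h A) = A" unfolding hA cut_cut[OF cl] .
    have ij: "i \<in> {1..l}" "j \<in> {1..l}" "i \<noteq> j" using cl by (auto simp: clash_def)
    have bottom: "(\<lambda>k. h A k 0) = (\<lambda>k. A k 0) \<circ> transpose i j" by (auto simp: hA cut_def)
    show "?f (h A) = - ?f A" unfolding bottom alt[OF ij] unfolding hA cut_weight[OF cl] by simp
    \<comment> \<open>A family that the exchange fixes has equal bottoms at \<open>i\<close> and
      \<open>j\<close>. The alternating property would only give that twice its term is 0.\<close>
    assume "h A = A"
    then have "cut A r i j i 0 = A i 0" by (simp add: hA)
    moreover have "cut A r i j i 0 = A j 0" by (simp add: cut_def)
    ultimately have "A j 0 = A i 0" by simp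
    then show "?f A = 0" using eq[OF ij, of "\<lambda>k. A k 0"] by simp
  qed
  moreover have "sum ?f ?S = sum ?f (?S - ?B) + sum ?f ?B"
    by (rule sum.subset_diff) (auto intro: finite_families)
  moreover have "?S - ?B = ?D" by auto
  ultimately show ?thesis by simp
qed

text \<open>From row to row the difference of two trails changes by at most 1, so it cannot change
  sign without a common point.\<close>

lemma vertex_disjoint_strict:
  assumes A: "A \<in> families n l s" and s: "\<And>i j. 1 \<le> i \<Longrightarrow> i < j \<Longrightarrow> j \<le> l \<Longrightarrow> s j < s i"
    and d: "vertex_disjoint n l A" and ij: "1 \<le> i" "i < j" "j \<le> l" and r: "r \<le> n"
  shows "A j r < A i r"
  using r
proof (induction rule: inc_induct)
  case base
  have "A i n = s i" "A j n = s j" using A ij by (auto simp: families_def trails_def)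
  then show ?case using s ij by simp
next
  case (step r)
  have "A i \<in> trails n (s i)" "A j \<in> trails n (s j)" using A ij by (auto simp: families_def)
  then have "A i (Suc r) = A i r \<or> A i (Suc r) = A i r + 1" "A j (Suc r) = A j r \<or> A j (Suc r) = A j r + 1"
    using step.hyps by (auto simp: trails_def)
  moreover have "A i r \<noteq> A j r"
  proof
    assume "A i r = A j r"
    moreover have "inj_on (\<lambda>i. A i r) {1..l}" using d step.hyps by (simp add: vertex_disjoint_def)
    ultimately have "i = j" using ij by (intro inj_onD[of "\<lambda>i. A i r" "{1..l}"]) auto
    then show False using ij by simp
  qed
  ultimately show ?case using step.IH by auto
qed

section \<open>Connected components\<close>

definition conn :: "('u \<Rightarrow> 'u \<Rightarrow> bool) \<Rightarrow> 'u set \<Rightarrow> ('u \<times> 'u) set" where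
  "conn R S = {(U, W). U \<in> S \<and> W \<in> S \<and> R U W}\<^sup>*"

definition conn_classes :: "('u \<Rightarrow> 'u \<Rightarrow> bool) \<Rightarrow> 'u set \<Rightarrow> 'u set set" where
  "conn_classes R S = S // conn R S"

lemma conn_closed: "(U, W) \<in> conn R S \<Longrightarrow> U \<in> S \<Longrightarrow> W \<in> S"
  unfolding conn_def by (induction rule: rtrancl_induct) auto

lemma conn_sym:
  assumes "symp R" "(U, W) \<in> conn R S" shows "(W, U) \<in> conn R S"
proof -
  have "Relation.sym {(U, W). U \<in> S \<and> W \<in> S \<and> R U W}"
    using assms(1) by (auto simp: Relation.sym_def symp_def)
  then have "Relation.sym (conn R S)" unfolding conn_def by (rule sym_rtrancl)
  then show ?thesis using assms(2) by (rule symD)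
qed

lemma class_eq:
  assumes "symp R" "C \<in> conn_classes R S" "U \<in> C"
  shows "C = conn R S `` {U}"
proof -
  obtain U0 where U0: "U0 \<in> S" "C = conn R S `` {U0}" using assms(2) by (auto simp: conn_classes_def elim: quotientE)
  then have 1: "(U0, U) \<in> conn R S" using assms(3) by simp
  then have 2: "(U, U0) \<in> conn R S" by (rule conn_sym[OF assms(1)])
  show ?thesis unfolding U0(2)
    using 1 2 by (auto simp: conn_def intro: rtrancl_trans)
qed

lemma class_of: "U \<in> S \<Longrightarrow> conn R S `` {U} \<in> conn_classes R S \<and> U \<in> conn R S `` {U}"
  by (auto simp: conn_classes_def conn_def intro: quotientI)

lemma class_subset: "C \<in> conn_classes R S \<Longrightarrow> C \<subseteq> S"
  by (auto simp: conn_classes_def elim!: quotientE intro: conn_closed)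

lemma class_adj:
  assumes "C \<in> conn_classes R S" "U \<in> C" "W \<in> S" "R U W"
  shows "W \<in> C"
proof -
  obtain U0 where U0: "U0 \<in> S" "C = conn R S `` {U0}" using assms(1) by (auto simp: conn_classes_def elim: quotientE)
  then have 1: "(U0, U) \<in> conn R S" using assms(2) by simp
  then have "U \<in> S" using U0(1) by (rule conn_closed)
  then show ?thesis using 1 assms(3,4) unfolding U0(2) conn_def by (auto intro: rtrancl_into_rtrancl)
qed

lemma conn_Un:
  assumes "\<And>U W. U \<in> S1 \<Longrightarrow> W \<in> S2 \<Longrightarrow> \<not> R U W" "U \<in> S1"
  shows "conn R (S1 \<union> S2) `` {U} = conn R S1 `` {U}"
proof
  show "conn R S1 `` {U} \<subseteq> conn R (S1 \<union> S2) `` {U}"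
    unfolding conn_def by (intro Image_mono rtrancl_mono) auto
  have "W \<in> S1 \<and> (U, W) \<in> conn R S1" if "(U, W) \<in> conn R (S1 \<union> S2)" for W
    using that unfolding conn_def[of _ "S1 \<union> S2"]
  proof (induction rule: rtrancl_induct)
    case base then show ?case using assms(2) by (simp add: conn_def)
  next
    case (step Y Z)
    then have "Z \<in> S1" using assms(1) by blast
    then show ?case using step unfolding conn_def by (auto intro: rtrancl_into_rtrancl)
  qed
  then show "conn R (S1 \<union> S2) `` {U} \<subseteq> conn R S1 `` {U}" by auto
qed

lemma conn_classes_Un:
  assumes "symp R" "\<And>U W. U \<in> S1 \<Longrightarrow> W \<in> S2 \<Longrightarrow> \<not> R U W"
  shows "conn_classes R (S1 \<union> S2) = conn_classes R S1 \<union> conn_classes R S2"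
proof -
  have "\<not> R U W" if "U \<in> S2" "W \<in> S1" for U W using that assms by (metis sympD)
  then have 2: "conn R (S1 \<union> S2) `` {U} = conn R S2 `` {U}" if "U \<in> S2" for U
    using conn_Un[of S2 S1 R U] that by (simp add: Un_commute)
  have "conn_classes R (S1 \<union> S2) = (\<lambda>U. conn R (S1 \<union> S2) `` {U}) ` (S1 \<union> S2)"
    by (auto simp: conn_classes_def quotient_def)
  also have "\<dots> = (\<lambda>U. conn R S1 `` {U}) ` S1 \<union> (\<lambda>U. conn R S2 `` {U}) ` S2"
    unfolding image_Un using conn_Un[of S1 S2 R, OF assms(2)] 2 by (intro arg_cong2[where f = "(\<union>)"] image_cong) auto
  also have "\<dots> = conn_classes R S1 \<union> conn_classes R S2"
    by (auto simp: conn_classes_def quotient_def)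
  finally show ?thesis .
qed

lemma conn_classes_image:
  assumes inj: "inj_on f S" and R: "\<And>U W. U \<in> S \<Longrightarrow> W \<in> S \<Longrightarrow> R' (f U) (f W) \<longleftrightarrow> R U W"
  shows "conn_classes R' (f ` S) = (`) f ` conn_classes R S"
proof -
  have "conn R' (f ` S) `` {f U} = f ` (conn R S `` {U})" if U: "U \<in> S" for U
  proof
    have "\<exists>W\<in>S. Z = f W \<and> (U, W) \<in> conn R S" if "(f U, Z) \<in> conn R' (f ` S)" for Z
      using that unfolding conn_def[of R']
    proof (induction rule: rtrancl_induct)
      case base then show ?case using U by (auto simp: conn_def)
    next
      case (step Y Z)
      then obtain W W' where "W \<in> S" "Y = f W" "(U, W) \<in> conn R S" "W' \<in> S" "Z = f W'" "R' (f W) (f W')"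
        by auto
      then show ?case using R unfolding conn_def by (blast intro: rtrancl_into_rtrancl)
    qed
    then show "conn R' (f ` S) `` {f U} \<subseteq> f ` (conn R S `` {U})" by blast
    have "(f U, f W) \<in> conn R' (f ` S)" if "(U, W) \<in> conn R S" for W
      using that unfolding conn_def[of R]
    proof (induction rule: rtrancl_induct)
      case base then show ?case by (simp add: conn_def)
    next
      case (step Y Z)
      then show ?case using R unfolding conn_def by (auto intro: rtrancl_into_rtrancl)
    qed
    then show "f ` (conn R S `` {U}) \<subseteq> conn R' (f ` S) `` {f U}" by auto
  qed
  then show ?thesis unfolding conn_classes_def quotient_def by (auto simp: image_iff)
qed

section \<open>Regions\<close>

text \<open>
  Units are given by coordinates \<open>(x, r)\<close>, where \<open>x\<close> is the \<open>x\<close>-coordinate of the left vertex and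
  \<open>r\<close> the height, in the upper strip. The families \<open>a\<close> and \<open>b\<close> hold the dual lower paths
  \<open>\<alpha>\<^sup>*\<close> and the upper paths \<open>\<beta>\<close>.
\<close>

definition hex_adj :: "int \<times> nat \<Rightarrow> int \<times> nat \<Rightarrow> bool" where
  "hex_adj U W \<longleftrightarrow> (fst W - fst U, int (snd W) - int (snd U)) \<in>
    {(0, 0), (1, 0), (-1, 0), (0, 1), (0, -1), (1, 1), (-1, -1)}"

lemma symp_hex_adj: "symp hex_adj"
  by (auto simp: symp_def hex_adj_def)

text \<open>Inner overlaps and holes at once. The condition is symmetric in \<open>a i\<close> and
  \<open>b (Suc i)\<close>, so it survives their exchange.\<close>

definition between :: "nat \<Rightarrow> (nat \<Rightarrow> nat \<Rightarrow> int) \<Rightarrow> (nat \<Rightarrow> nat \<Rightarrow> int) \<Rightarrow> int \<Rightarrow> nat \<Rightarrow> bool" where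
  "between l a b x r \<longleftrightarrow> (\<exists>i. 1 \<le> i \<and> i < l \<and>
    min (a i r) (b (Suc i) r) \<le> x \<and> x < max (a i r) (b (Suc i) r))"

text \<open>The holes of index 0 and \<open>l\<close>, which are unbounded and belong to the
  boundary; for \<open>l = 0\<close> the hole is the whole strip.\<close>

definition outer :: "nat \<Rightarrow> (nat \<Rightarrow> nat \<Rightarrow> int) \<Rightarrow> (nat \<Rightarrow> nat \<Rightarrow> int) \<Rightarrow> int \<Rightarrow> nat \<Rightarrow> bool" where
  "outer l a b x r \<longleftrightarrow> l = 0 \<or> b 1 r \<le> x \<or> x < a l r"

definition region_units :: "nat \<Rightarrow> nat \<Rightarrow> (nat \<Rightarrow> nat \<Rightarrow> int) \<Rightarrow> (nat \<Rightarrow> nat \<Rightarrow> int) \<Rightarrow> (int \<times> nat) set" where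
  "region_units n l a b = {(x, r). r \<le> n \<and> (outer l a b x r \<or> between l a b x r)}"

definition boundary_units :: "nat \<Rightarrow> nat \<Rightarrow> (nat \<Rightarrow> nat \<Rightarrow> int) \<Rightarrow> (nat \<Rightarrow> nat \<Rightarrow> int) \<Rightarrow> (int \<times> nat) set" where
  "boundary_units n l a b = {(x, r). r \<le> n \<and> (outer l a b x r \<or> r = n \<and> between l a b x r)}"

text \<open>Odd differences are even gaps. The leftmost unit at height 0 stands for the whole
  interval of the pair, whose units lie in one component.\<close>

definition odd_runs :: "nat \<Rightarrow> (nat \<Rightarrow> nat \<Rightarrow> int) \<Rightarrow> (nat \<Rightarrow> nat \<Rightarrow> int) \<Rightarrow> (int \<times> nat) set \<Rightarrow> nat set" where
  "odd_runs l a b C = {i. 1 \<le> i \<and> i < l \<and> odd (b (Suc i) 0 - a i 0) \<and>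
    (min (a i 0) (b (Suc i) 0), 0) \<in> C}"

text \<open>Covers I- and II-regions together. Under positivity boundary units are holes, so
  avoiding them restricts II-components only.\<close>

definition odd_region :: "nat \<Rightarrow> nat \<Rightarrow> (nat \<Rightarrow> nat \<Rightarrow> int) \<Rightarrow> (nat \<Rightarrow> nat \<Rightarrow> int) \<Rightarrow> (int \<times> nat) set \<Rightarrow> bool" where
  "odd_region n l a b C \<longleftrightarrow> C \<in> conn_classes hex_adj (region_units n l a b) \<and>
    (\<exists>x. (x, 0) \<in> C) \<and> C \<inter> boundary_units n l a b = {} \<and> odd (card (odd_runs l a b C))"

definition flips :: "nat \<Rightarrow> nat \<Rightarrow> (int \<times> nat) set \<Rightarrow> (nat \<Rightarrow> nat \<Rightarrow> int) \<Rightarrow> (nat \<Rightarrow> nat \<Rightarrow> int) \<Rightarrow> nat \<Rightarrow> nat \<Rightarrow> bool" where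
  "flips n l V a b i r \<longleftrightarrow> 1 \<le> i \<and> i < l \<and> r \<le> n \<and> a i r \<noteq> b (Suc i) r \<and>
    (min (a i r) (b (Suc i) r), r) \<in> V"

definition flip_a :: "nat \<Rightarrow> nat \<Rightarrow> (int \<times> nat) set \<Rightarrow> (nat \<Rightarrow> nat \<Rightarrow> int) \<Rightarrow> (nat \<Rightarrow> nat \<Rightarrow> int) \<Rightarrow> nat \<Rightarrow> nat \<Rightarrow> int" where
  "flip_a n l V a b i r = (if flips n l V a b i r then b (Suc i) r else a i r)"

definition flip_b :: "nat \<Rightarrow> nat \<Rightarrow> (int \<times> nat) set \<Rightarrow> (nat \<Rightarrow> nat \<Rightarrow> int) \<Rightarrow> (nat \<Rightarrow> nat \<Rightarrow> int) \<Rightarrow> nat \<Rightarrow> nat \<Rightarrow> int" where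
  "flip_b n l V a b j r = (if flips n l V a b (j - 1) r then a (j - 1) r else b j r)"

text \<open>By the dichotomy, \<open>interlaced\<close> says that the positions at height 0 admit
  exactly one matching, so the pair of families determines the E-runs.\<close>

definition config :: "nat \<Rightarrow> nat \<Rightarrow> (nat \<Rightarrow> int) \<Rightarrow> (nat \<Rightarrow> int) \<Rightarrow> (nat \<Rightarrow> nat \<Rightarrow> int) \<Rightarrow> (nat \<Rightarrow> nat \<Rightarrow> int) \<Rightarrow> bool" where
  "config n l s t a b \<longleftrightarrow> a \<in> families n l s \<and> b \<in> families n l t \<and>
    vertex_disjoint n l a \<and> vertex_disjoint n l b \<and> interlaced l (\<lambda>i. a i 0) (\<lambda>i. b i 0)"

lemma strict_dec_vertex_disjoint:
  fixes A :: "nat \<Rightarrow> nat \<Rightarrow> int"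
  assumes "\<And>i r. 1 \<le> i \<Longrightarrow> i < l \<Longrightarrow> r \<le> n \<Longrightarrow> A (Suc i) r < A i r"
  shows "vertex_disjoint n l A"
  unfolding vertex_disjoint_def
proof (intro allI impI inj_onI)
  fix r i j assume r: "r \<le> n" "i \<in> {1..l}" "j \<in> {1..l}" "A i r = A j r"
  have "strict_dec l (\<lambda>i. A i r)" using assms r by (intro strict_dec_SucI) auto
  then show "i = j" using r strict_decD[of l "\<lambda>i. A i r" i j] strict_decD[of l "\<lambda>i. A i r" j i]
    by (cases i j rule: linorder_cases) auto
qed

section \<open>Invariants of the exchange\<close>

lemma flip_pair:
  assumes "1 \<le> i" "i < l"
  shows "min (flip_a n l V a b i r) (flip_b n l V a b (Suc i) r) = min (a i r) (b (Suc i) r)"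
    and "max (flip_a n l V a b i r) (flip_b n l V a b (Suc i) r) = max (a i r) (b (Suc i) r)"
    and "flip_a n l V a b i r = flip_b n l V a b (Suc i) r \<longleftrightarrow> a i r = b (Suc i) r"
    and "odd (flip_b n l V a b (Suc i) r - flip_a n l V a b i r) \<longleftrightarrow> odd (b (Suc i) r - a i r)"
  by (auto simp: flip_a_def flip_b_def min_def max_def)

lemma flip_ends: "flip_b n l V a b (Suc 0) r = b (Suc 0) r" "flip_a n l V a b l r = a l r"
  by (auto simp: flip_a_def flip_b_def flips_def)

lemma flip_region_units: "region_units n l (flip_a n l V a b) (flip_b n l V a b) = region_units n l a b"
  and flip_boundary_units: "boundary_units n l (flip_a n l V a b) (flip_b n l V a b) = boundary_units n l a b"
  and flip_odd_runs: "odd_runs l (flip_a n l V a b) (flip_b n l V a b) C = odd_runs l a b C"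
proof -
  have *: "between l (flip_a n l V a b) (flip_b n l V a b) = between l a b"
    "outer l (flip_a n l V a b) (flip_b n l V a b) = outer l a b"
    by (auto simp: between_def outer_def fun_eq_iff flip_pair flip_ends cong: conj_cong)
  show "region_units n l (flip_a n l V a b) (flip_b n l V a b) = region_units n l a b"
    "boundary_units n l (flip_a n l V a b) (flip_b n l V a b) = boundary_units n l a b"
    by (simp_all add: region_units_def boundary_units_def *)
  show "odd_runs l (flip_a n l V a b) (flip_b n l V a b) C = odd_runs l a b C"
    unfolding odd_runs_def by (intro Collect_cong conj_cong HOL.refl) (simp_all only: flip_pair(1,4))
qed

lemma flip_odd_region:
  "odd_region n l (flip_a n l V a b) (flip_b n l V a b) = odd_region n l a b"
  by (simp add: fun_eq_iff odd_region_def flip_region_units flip_boundary_units flip_odd_runs)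

lemma flip_flips: "flips n l V (flip_a n l V a b) (flip_b n l V a b) = flips n l V a b"
  by (auto simp: fun_eq_iff flips_def flip_pair)

lemma flip_flip:
  "flip_a n l V (flip_a n l V a b) (flip_b n l V a b) = a"
  "flip_b n l V (flip_a n l V a b) (flip_b n l V a b) = b"
proof -
  show "flip_a n l V (flip_a n l V a b) (flip_b n l V a b) = a"
    unfolding fun_eq_iff flip_a_def[of n l V "flip_a n l V a b"] flip_flips
    by (simp add: flip_a_def flip_b_def)
  have "flip_a n l V a b (j - 1) r = b j r" if "flips n l V a b (j - 1) r" for j r
    using that by (cases j) (auto simp: flip_a_def flips_def)
  then show "flip_b n l V (flip_a n l V a b) (flip_b n l V a b) = b"
    unfolding fun_eq_iff flip_b_def[of n l V "flip_a n l V a b"] flip_flips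
    by (simp add: flip_b_def)
qed

lemma flip_interlaced:
  "interlaced l (\<lambda>i. flip_a n l V a b i 0) (\<lambda>i. flip_b n l V a b i 0) = interlaced l (\<lambda>i. a i 0) (\<lambda>i. b i 0)"
proof -
  have "lo (\<lambda>i. flip_a n l V a b i 0) (\<lambda>i. flip_b n l V a b i 0) i = lo (\<lambda>i. a i 0) (\<lambda>i. b i 0) i"
    "hi l (\<lambda>i. flip_a n l V a b i 0) (\<lambda>i. flip_b n l V a b i 0) (Suc i) = hi l (\<lambda>i. a i 0) (\<lambda>i. b i 0) (Suc i)"
    if "i < l" for i
    using that by (auto simp: lo_def hi_def flip_pair flip_ends)
  then show ?thesis unfolding interlaced_def by simp
qed

text \<open>The factors of \<open>a i\<close> and \<open>b (Suc i)\<close> are multiplied together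
  row by row; \<open>a l\<close> and \<open>b 1\<close> have no partner, do not move and are split
  off.\<close>

lemma flip_weight:
  fixes Fa Fb :: "nat \<Rightarrow> int \<Rightarrow> 'a::comm_monoid_mult"
  assumes "\<And>r x y. r \<le> n \<Longrightarrow> Fa r x * Fb r y = Fa r y * Fb r x"
  shows "(\<Prod>i\<in>{1..l}. \<Prod>r\<le>n. Fa r (flip_a n l V a b i r)) * (\<Prod>i\<in>{1..l}. \<Prod>r\<le>n. Fb r (flip_b n l V a b i r)) =
    (\<Prod>i\<in>{1..l}. \<Prod>r\<le>n. Fa r (a i r)) * (\<Prod>i\<in>{1..l}. \<Prod>r\<le>n. Fb r (b i r))"
proof (cases l)
  case 0 then show ?thesis by simp
next
  case (Suc m)
  have A: "(\<Prod>i\<in>{1..l}. f i) = (\<Prod>i\<in>{1..m}. f i) * f l" for f :: "nat \<Rightarrow> 'a"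
    unfolding Suc by simp
  have B: "(\<Prod>i\<in>{1..l}. f i) = f (Suc 0) * (\<Prod>i\<in>{1..m}. f (Suc i))" for f :: "nat \<Rightarrow> 'a"
    unfolding Suc by (simp add: prod.atLeast_Suc_atMost prod.shift_bounds_cl_Suc_ivl del: prod.cl_ivl_Suc)
  have pair: "(\<Prod>r\<le>n. Fa r (flip_a n l V a b i r)) * (\<Prod>r\<le>n. Fb r (flip_b n l V a b (Suc i) r)) =
      (\<Prod>r\<le>n. Fa r (a i r)) * (\<Prod>r\<le>n. Fb r (b (Suc i) r))" for i
    unfolding prod.distrib[symmetric]
    by (rule prod.cong) (auto simp: flip_a_def flip_b_def assms)
  have C: "((\<Prod>i\<in>{1..m}. f i) * u) * (v * (\<Prod>i\<in>{1..m}. g i)) = u * v * (\<Prod>i\<in>{1..m}. f i * g i)"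
    for f g :: "nat \<Rightarrow> 'a" and u v
    by (simp add: prod.distrib ac_simps)
  show ?thesis
    unfolding A[of "\<lambda>i. \<Prod>r\<le>n. Fa r (flip_a n l V a b i r)"] A[of "\<lambda>i. \<Prod>r\<le>n. Fa r (a i r)"]
      B[of "\<lambda>i. \<Prod>r\<le>n. Fb r (flip_b n l V a b i r)"] B[of "\<lambda>i. \<Prod>r\<le>n. Fb r (b i r)"] C
      pair flip_ends ..
qed

lemma even_card_sym_diff:
  assumes "finite A" "finite B"
  shows "even (card (A - B \<union> (B - A))) \<longleftrightarrow> (even (card A) \<longleftrightarrow> even (card B))"
proof -
  have "card A = card (A - B) + card (A \<inter> B)" "card B = card (B - A) + card (A \<inter> B)"
    using assms by (metis card_Diff_subset_Int card_mono finite_Int inf_le1 le_add_diff_inverse2,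
      metis card_Diff_subset_Int card_mono finite_Int inf_commute inf_le1 le_add_diff_inverse2)
  moreover have "card (A - B \<union> (B - A)) = card (A - B) + card (B - A)"
    using assms by (intro card_Un_disjoint) auto
  ultimately show ?thesis by auto
qed

text \<open>Odd runs in \<open>V\<close> turn from overlaps into holes or back, all others stay. The
  symmetric difference gives the change of sign when \<open>odd_runs l a b V\<close> has odd
  size.\<close>

lemma flip_odd_overlaps:
  "odd_overlaps l (\<lambda>i. flip_a n l V a b i 0) (\<lambda>i. flip_b n l V a b i 0) =
    (odd_overlaps l (\<lambda>i. a i 0) (\<lambda>i. b i 0) - odd_runs l a b V) \<union>
    (odd_runs l a b V - odd_overlaps l (\<lambda>i. a i 0) (\<lambda>i. b i 0))"
proof -
  have "flips n l V a b i 0 \<longleftrightarrow> i \<in> odd_runs l a b V" if "1 \<le> i" "i < l" "odd (b (Suc i) 0 - a i 0)" for i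
    using that by (auto simp: flips_def odd_runs_def)
  moreover have "a i 0 \<noteq> b (Suc i) 0" if "odd (b (Suc i) 0 - a i 0)" for i using that by auto
  moreover have "odd (flip_b n l V a b (Suc i) 0 - flip_a n l V a b i 0) \<longleftrightarrow> odd (b (Suc i) 0 - a i 0)"
    if "1 \<le> i" "i < l" for i using that by (rule flip_pair(4))
  moreover have "flip_a n l V a b i 0 < flip_b n l V a b (Suc i) 0 \<longleftrightarrow>
      (if flips n l V a b i 0 then b (Suc i) 0 < a i 0 else a i 0 < b (Suc i) 0)" for i
    by (simp add: flip_a_def flip_b_def)
  ultimately have "i \<in> odd_overlaps l (\<lambda>i. flip_a n l V a b i 0) (\<lambda>i. flip_b n l V a b i 0) \<longleftrightarrow>
    1 \<le> i \<and> i < l \<and> odd (b (Suc i) 0 - a i 0) \<and>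
    (a i 0 < b (Suc i) 0 \<longleftrightarrow> i \<notin> odd_runs l a b V)" for i
    unfolding odd_overlaps_def mem_Collect_eq by (smt (verit, ccfv_threshold))
  then show ?thesis by (auto simp: odd_overlaps_def odd_runs_def)
qed

section \<open>The exchange maps configurations to configurations\<close>

context
  fixes n l :: nat and a b :: "nat \<Rightarrow> nat \<Rightarrow> int" and V :: "(int \<times> nat) set"
  assumes V: "V \<in> conn_classes hex_adj (region_units n l a b)"
begin

text \<open>Consecutive units of a row are adjacent, so the interval of a pair lies in the component
  as a whole or not at all.\<close>

lemma class_interval:
  assumes "1 \<le> i" "i < l" "r \<le> n" "min (a i r) (b (Suc i) r) \<le> x" "x < max (a i r) (b (Suc i) r)"
  shows "(x, r) \<in> V \<longleftrightarrow> flips n l V a b i r"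
proof -
  let ?m = "min (a i r) (b (Suc i) r)"
  have T: "(y, r) \<in> region_units n l a b" if "?m \<le> y" "y \<le> x" for y
    using assms that by (auto simp: region_units_def between_def)
  have "(x, r) \<in> V \<longleftrightarrow> (?m, r) \<in> V"
    using assms(4) T
  proof (induction x rule: int_ge_induct)
    case (step y)
    have "(y, r) \<in> region_units n l a b" "(y + 1, r) \<in> region_units n l a b" using step by auto
    then have "(y, r) \<in> V \<longleftrightarrow> (y + 1, r) \<in> V"
      using class_adj[OF V, of "(y, r)" "(y + 1, r)"] class_adj[OF V, of "(y + 1, r)" "(y, r)"]
      by (auto simp: hex_adj_def)
    then show ?case using step by auto
  qed simp
  then show ?thesis using assms by (auto simp: flips_def)
qed

context
  fixes s t :: "nat \<Rightarrow> int"
  assumes c: "config n l s t a b" and bd: "V \<inter> boundary_units n l a b = {}"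
    and s: "\<And>i j. 1 \<le> i \<Longrightarrow> i < j \<Longrightarrow> j \<le> l \<Longrightarrow> s j < s i"
    and t: "\<And>i j. 1 \<le> i \<Longrightarrow> i < j \<Longrightarrow> j \<le> l \<Longrightarrow> t j < t i"
begin

lemma a_less: "1 \<le> i \<Longrightarrow> i < j \<Longrightarrow> j \<le> l \<Longrightarrow> r \<le> n \<Longrightarrow> a j r < a i r"
  using c vertex_disjoint_strict[of a n l s, OF _ s] by (auto simp: config_def)

lemma b_less: "1 \<le> i \<Longrightarrow> i < j \<Longrightarrow> j \<le> l \<Longrightarrow> r \<le> n \<Longrightarrow> b j r < b i r"
  using c vertex_disjoint_strict[of b n l t, OF _ t] by (auto simp: config_def)

lemma a_step: "1 \<le> i \<Longrightarrow> i \<le> l \<Longrightarrow> r < n \<Longrightarrow> a i (Suc r) = a i r \<or> a i (Suc r) = a i r + 1"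
  and b_step: "1 \<le> i \<Longrightarrow> i \<le> l \<Longrightarrow> r < n \<Longrightarrow> b i (Suc r) = b i r \<or> b i (Suc r) = b i r + 1"
  using c by (auto simp: config_def families_def trails_def PiE_iff)

text \<open>Intervals in the top row consist of boundary units, which \<open>V\<close> avoids. So
  the prescribed ends do not move.\<close>

lemma flips_top: "\<not> flips n l V a b i n"
proof
  assume f: "flips n l V a b i n"
  then have "between l a b (min (a i n) (b (Suc i) n)) n"
    unfolding between_def flips_def by (intro exI[of _ i]) auto
  then show False using f bd by (auto simp: flips_def boundary_units_def)
qed

text \<open>The minimum of two trails moves by 0 or 1 from row to row, hence the leftmost units of
  the two intervals are adjacent.\<close>

lemma flips_adjacent_rows:
  assumes "1 \<le> i" "i < l" "r < n" "a i r \<noteq> b (Suc i) r" "a i (Suc r) \<noteq> b (Suc i) (Suc r)"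
  shows "flips n l V a b i r \<longleftrightarrow> flips n l V a b i (Suc r)"
proof -
  let ?m = "min (a i r) (b (Suc i) r)" and ?m' = "min (a i (Suc r)) (b (Suc i) (Suc r))"
  have "(?m, r) \<in> region_units n l a b" "(?m', Suc r) \<in> region_units n l a b"
    using assms unfolding region_units_def between_def
    by (auto intro!: disjI2 exI[of _ i] simp: min_def max_def)
  moreover have "hex_adj (?m, r) (?m', Suc r)"
    using a_step[of i r] b_step[of "Suc i" r] assms by (auto simp: hex_adj_def min_def)
  ultimately have "(?m, r) \<in> V \<longleftrightarrow> (?m', Suc r) \<in> V"
    using class_adj[OF V] symp_hex_adj by (metis sympD)
  then show ?thesis using assms by (auto simp: flips_def)
qed

text \<open>The last hypothesis describes when exchanging only one of two neighbouring pairs would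
  destroy the order of \<open>a\<close> or of \<open>b\<close>. In this case the intervals overlap
  or touch, contain adjacent units, and are exchanged together.\<close>

lemma flips_neighbours:
  assumes "1 \<le> i" "Suc i < l" "r \<le> n" "b (Suc i) r \<le> a (Suc i) r \<or> a i r \<le> b (Suc (Suc i)) r"
  shows "flips n l V a b i r \<longleftrightarrow> flips n l V a b (Suc i) r"
proof -
  have less: "a (Suc i) r < a i r" "b (Suc (Suc i)) r < b (Suc i) r"
    using a_less[of i "Suc i" r] b_less[of "Suc i" "Suc (Suc i)" r] assms by auto
  let ?x = "min (a i r) (b (Suc i) r)"
  have i1: "min (a i r) (b (Suc i) r) \<le> ?x" "?x < max (a i r) (b (Suc i) r)"
    and i2: "min (a (Suc i) r) (b (Suc (Suc i)) r) \<le> ?x - 1" "?x - 1 < max (a (Suc i) r) (b (Suc (Suc i)) r)"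
    using less assms(4) by auto
  have l: "1 \<le> Suc i" "i < l" using assms by auto
  have "(?x, r) \<in> region_units n l a b" "(?x - 1, r) \<in> region_units n l a b"
    using i1 i2 assms l unfolding region_units_def between_def by blast+
  then have "(?x, r) \<in> V \<longleftrightarrow> (?x - 1, r) \<in> V"
    using class_adj[OF V, of "(?x, r)" "(?x - 1, r)"] class_adj[OF V, of "(?x - 1, r)" "(?x, r)"]
    by (auto simp: hex_adj_def)
  then show ?thesis
    using class_interval[OF assms(1) l(2) assms(3) i1] class_interval[OF l(1) assms(2,3) i2] by blast
qed

text \<open>Otherwise the interval of the last pair reaches \<open>b l r\<close>, whose left
  neighbour is an outer unit, and \<open>V\<close> would contain a boundary unit.\<close>

lemma flips_last:
  assumes "flips n l V a b i r" "Suc i = l" shows "a l r < b l r"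
proof (rule ccontr)
  assume *: "\<not> a l r < b l r"
  have i: "1 \<le> i" "i < l" "r \<le> n" using assms by (auto simp: flips_def)
  then have "b l r < a i r" using a_less[of i l r] * by auto
  then have "(b l r, r) \<in> V" using class_interval[OF i, of "b l r"] assms by auto
  moreover have "(b l r - 1, r) \<in> boundary_units n l a b"
    using * i by (auto simp: boundary_units_def outer_def)
  moreover from this have "(b l r - 1, r) \<in> region_units n l a b"
    by (auto simp: boundary_units_def region_units_def)
  ultimately have "(b l r - 1, r) \<in> V" using class_adj[OF V, of "(b l r, r)" "(b l r - 1, r)"] by (simp add: hex_adj_def)
  then show False using bd \<open>(b l r - 1, r) \<in> boundary_units n l a b\<close> by blast
qed

text \<open>The mirror image at the other side: otherwise the interval contains the left neighbour
  of the outer unit at \<open>b 1 r\<close>.\<close>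

lemma flips_first:
  assumes "flips n l V a b 1 r" shows "a 1 r < b 1 r"
proof (rule ccontr)
  assume *: "\<not> a 1 r < b 1 r"
  have i: "1 \<le> (1::nat)" "1 < l" "r \<le> n" using assms by (auto simp: flips_def)
  then have "b (Suc 1) r < b 1 r" using b_less[of 1 "Suc 1" r] by auto
  then have "(b 1 r - 1, r) \<in> V" using class_interval[OF i, of "b 1 r - 1"] assms * by auto
  moreover have "(b 1 r, r) \<in> boundary_units n l a b"
    using i by (auto simp: boundary_units_def outer_def)
  moreover from this have "(b 1 r, r) \<in> region_units n l a b"
    by (auto simp: boundary_units_def region_units_def)
  ultimately have "(b 1 r, r) \<in> V" using class_adj[OF V, of "(b 1 r - 1, r)" "(b 1 r, r)"] by (simp add: hex_adj_def)
  then show False using bd \<open>(b 1 r, r) \<in> boundary_units n l a b\<close> by blast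
qed

lemma flip_a_less:
  assumes "1 \<le> i" "i < l" "r \<le> n"
  shows "flip_a n l V a b (Suc i) r < flip_a n l V a b i r"
proof (cases "Suc i = l")
  case True
  have "\<not> flips n l V a b l r" by (simp add: flips_def)
  then show ?thesis using flips_last[of i r] True a_less[of i l r] assms by (auto simp: flip_a_def)
next
  case False
  then have il: "Suc i < l" using assms by simp
  have less: "a (Suc i) r < a i r" "b (Suc (Suc i)) r < b (Suc i) r"
    using a_less[of i "Suc i" r] b_less[of "Suc i" "Suc (Suc i)" r] assms il by auto
  have "b (Suc i) r \<le> a (Suc i) r \<or> a i r \<le> b (Suc (Suc i)) r \<longrightarrow>
      flips n l V a b i r = flips n l V a b (Suc i) r"
    using flips_neighbours[OF assms(1) il assms(3)] by blast
  then show ?thesis using less by (auto simp: flip_a_def)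
qed

lemma flip_b_less:
  assumes "1 \<le> j" "j < l" "r \<le> n"
  shows "flip_b n l V a b (Suc j) r < flip_b n l V a b j r"
proof (cases "j = 1")
  case True
  have "\<not> flips n l V a b 0 r" by (simp add: flips_def)
  then show ?thesis using flips_first[of r] True b_less[of 1 "Suc 1" r] assms by (auto simp: flip_b_def)
next
  case False
  then obtain i where i: "j = Suc i" "1 \<le> i" using assms by (cases j) auto
  have il: "Suc i < l" using assms i by simp
  have less: "a (Suc i) r < a i r" "b (Suc (Suc i)) r < b (Suc i) r"
    using a_less[of i "Suc i" r] b_less[of "Suc i" "Suc (Suc i)" r] assms i by auto
  have "b (Suc i) r \<le> a (Suc i) r \<or> a i r \<le> b (Suc (Suc i)) r \<longrightarrow>
      flips n l V a b i r = flips n l V a b (Suc i) r"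
    using flips_neighbours[OF i(2) il assms(3)] by blast
  then show ?thesis unfolding i using less by (auto simp: flip_b_def)
qed

text \<open>Between two rows the exchange can start or stop only if the two trails coincide in one
  of them, and there it has no effect.\<close>

lemma flip_steps:
  assumes "1 \<le> i" "i < l" "r < n"
  shows "flip_a n l V a b i (Suc r) = flip_a n l V a b i r \<or> flip_a n l V a b i (Suc r) = flip_a n l V a b i r + 1"
    and "flip_b n l V a b (Suc i) (Suc r) = flip_b n l V a b (Suc i) r \<or> flip_b n l V a b (Suc i) (Suc r) = flip_b n l V a b (Suc i) r + 1"
proof -
  have st: "a i (Suc r) = a i r \<or> a i (Suc r) = a i r + 1"
    "b (Suc i) (Suc r) = b (Suc i) r \<or> b (Suc i) (Suc r) = b (Suc i) r + 1"
    using a_step[of i r] b_step[of "Suc i" r] assms by auto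
  have eq: "flips n l V a b i r \<longrightarrow> a i r \<noteq> b (Suc i) r"
    "flips n l V a b i (Suc r) \<longrightarrow> a i (Suc r) \<noteq> b (Suc i) (Suc r)" by (auto simp: flips_def)
  consider "flips n l V a b i r = flips n l V a b i (Suc r)" | "a i r = b (Suc i) r" |
    "a i (Suc r) = b (Suc i) (Suc r)" using flips_adjacent_rows[OF assms] by blast
  then have "(flip_a n l V a b i (Suc r) = flip_a n l V a b i r \<or> flip_a n l V a b i (Suc r) = flip_a n l V a b i r + 1) \<and>
    (flip_b n l V a b (Suc i) (Suc r) = flip_b n l V a b (Suc i) r \<or> flip_b n l V a b (Suc i) (Suc r) = flip_b n l V a b (Suc i) r + 1)"
  proof cases
    case 1 then show ?thesis using st by (auto simp: flip_a_def flip_b_def)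
  next
    case 2 then show ?thesis using st eq by (auto simp: flip_a_def flip_b_def)
  next
    case 3 then show ?thesis using st eq by (auto simp: flip_a_def flip_b_def)
  qed
  then show "flip_a n l V a b i (Suc r) = flip_a n l V a b i r \<or> flip_a n l V a b i (Suc r) = flip_a n l V a b i r + 1"
    and "flip_b n l V a b (Suc i) (Suc r) = flip_b n l V a b (Suc i) r \<or> flip_b n l V a b (Suc i) (Suc r) = flip_b n l V a b (Suc i) r + 1"
    by blast+
qed

lemma flip_families: "flip_a n l V a b \<in> families n l s" "flip_b n l V a b \<in> families n l t"
proof -
  have a: "a i \<in> trails n (s i)" and b: "b i \<in> trails n (t i)" if "i \<in> {1..l}" for i
    using c that by (auto simp: config_def families_def)
  have ao: "a i = undefined" and bo: "b i = undefined" if "i \<notin> {1..l}" for i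
    using c that by (auto simp: config_def families_def PiE_def extensional_def)
  have hi: "a i r = undefined" "b i r = undefined" if "i \<in> {1..l}" "n < r" for i r
    using a[OF that(1)] b[OF that(1)] that by (auto simp: trails_def PiE_def extensional_def)
  show "flip_a n l V a b \<in> families n l s" unfolding families_def
  proof (rule PiE_I)
    fix i assume i: "i \<in> {1..l}"
    have "flip_a n l V a b i \<in> {..n} \<rightarrow>\<^sub>E UNIV"
      using hi(1)[OF i] by (auto simp: PiE_def extensional_def flip_a_def flips_def)
    moreover have "flip_a n l V a b i n = s i" using flips_top a[OF i] by (simp add: flip_a_def trails_def)
    moreover have "flip_a n l V a b i (Suc r) = flip_a n l V a b i r \<or> flip_a n l V a b i (Suc r) = flip_a n l V a b i r + 1"
      if "r < n" for r
    proof (cases "i = l")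
      case True then show ?thesis using a_step[of l r] i that by (simp add: flip_ends)
    next
      case False then show ?thesis using flip_steps[of i r] i that by simp
    qed
    ultimately show "flip_a n l V a b i \<in> trails n (s i)" by (simp add: trails_def)
  next
    fix i assume i: "i \<notin> {1..l}"
    then have "flip_a n l V a b i = a i" by (auto simp: fun_eq_iff flip_a_def flips_def)
    then show "flip_a n l V a b i = undefined" using ao i by simp
  qed
  show "flip_b n l V a b \<in> families n l t" unfolding families_def
  proof (rule PiE_I)
    fix i assume i: "i \<in> {1..l}"
    have "flip_b n l V a b i \<in> {..n} \<rightarrow>\<^sub>E UNIV"
      using hi(2)[OF i] by (auto simp: PiE_def extensional_def flip_b_def flips_def)
    moreover have "flip_b n l V a b i n = t i" using flips_top b[OF i] by (simp add: flip_b_def trails_def)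
    moreover have "flip_b n l V a b i (Suc r) = flip_b n l V a b i r \<or> flip_b n l V a b i (Suc r) = flip_b n l V a b i r + 1"
      if "r < n" for r
    proof (cases "i = 1")
      case True then show ?thesis using b_step[of 1 r] i that by (simp add: flip_ends)
    next
      case False
      then obtain j where "i = Suc j" "1 \<le> j" "j < l" using i by (cases i) auto
      then show ?thesis using flip_steps[of j r] that by simp
    qed
    ultimately show "flip_b n l V a b i \<in> trails n (t i)" by (simp add: trails_def)
  next
    fix i assume i: "i \<notin> {1..l}"
    then have "flip_b n l V a b i = b i" by (auto simp: fun_eq_iff flip_b_def flips_def)
    then show "flip_b n l V a b i = undefined" using bo i by simp
  qed
qed

lemma flip_config: "config n l s t (flip_a n l V a b) (flip_b n l V a b)"
proof -
  have "vertex_disjoint n l (flip_a n l V a b)" by (rule strict_dec_vertex_disjoint) (rule flip_a_less)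
  moreover have "vertex_disjoint n l (flip_b n l V a b)" by (rule strict_dec_vertex_disjoint) (rule flip_b_less)
  ultimately show ?thesis using c flip_families by (simp add: config_def flip_interlaced)
qed

end

end

section \<open>Overlaps and holes as separate components, and the sign without odd regions\<close>

definition overlap_units :: "nat \<Rightarrow> nat \<Rightarrow> (nat \<Rightarrow> nat \<Rightarrow> int) \<Rightarrow> (nat \<Rightarrow> nat \<Rightarrow> int) \<Rightarrow> (int \<times> nat) set" where
  "overlap_units n l a b = {(x, r). r \<le> n \<and> (\<exists>i. 1 \<le> i \<and> i < l \<and> a i r \<le> x \<and> x < b (Suc i) r)}"

definition hole_units :: "nat \<Rightarrow> nat \<Rightarrow> (nat \<Rightarrow> nat \<Rightarrow> int) \<Rightarrow> (nat \<Rightarrow> nat \<Rightarrow> int) \<Rightarrow> (int \<times> nat) set" where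
  "hole_units n l a b = {(x, r). r \<le> n \<and> (\<exists>i\<le>l. (i = l \<or> b (Suc i) r \<le> x) \<and> (i = 0 \<or> x < a i r))}"

lemma region_units_eq: "region_units n l a b = overlap_units n l a b \<union> hole_units n l a b"
proof -
  have "outer l a b x r \<or> between l a b x r \<longleftrightarrow>
     (\<exists>i. 1 \<le> i \<and> i < l \<and> a i r \<le> x \<and> x < b (Suc i) r) \<or>
     (\<exists>i\<le>l. (i = l \<or> b (Suc i) r \<le> x) \<and> (i = 0 \<or> x < a i r))" (is "?L \<longleftrightarrow> ?I \<or> ?II") for x r
  proof
    assume ?L
    then consider "l = 0 \<or> b (Suc 0) r \<le> x" | "x < a l r"
      | i where "1 \<le> i" "i < l" "min (a i r) (b (Suc i) r) \<le> x" "x < max (a i r) (b (Suc i) r)"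
      by (auto simp: outer_def between_def)
    then show "?I \<or> ?II"
    proof cases
      case 1 then have ?II by (intro exI[of _ 0]) auto
      then show ?thesis ..
    next
      case 2 then have ?II by (intro exI[of _ l]) auto
      then show ?thesis ..
    next
      case 3
      then consider "a i r \<le> x" "x < b (Suc i) r" | "b (Suc i) r \<le> x" "x < a i r" by linarith
      then show ?thesis using 3 by cases (blast, use less_imp_le in blast)
    qed
  next
    assume "?I \<or> ?II"
    then show ?L
    proof
      assume ?I
      then show ?thesis by (force simp: between_def)
    next
      assume ?II
      then obtain i where i: "i \<le> l" "i = l \<or> b (Suc i) r \<le> x" "i = 0 \<or> x < a i r" by blast
      then consider "i = 0" | "i = l" | "1 \<le> i" "i < l" by linarith
      then show ?thesis
      proof cases
        case 1 then show ?thesis using i by (auto simp: outer_def)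
      next
        case 2 then show ?thesis using i by (auto simp: outer_def)
      next
        case 3 then have "between l a b x r" unfolding between_def using i by (intro exI[of _ i]) auto
        then show ?thesis ..
      qed
    qed
  qed
  then show ?thesis by (auto simp: region_units_def overlap_units_def hole_units_def)
qed

text \<open>The hypothesis makes every nonempty interval of the top row a hole.\<close>

lemma boundary_units_eq:
  assumes "\<And>i. 1 \<le> i \<Longrightarrow> i < l \<Longrightarrow> b (Suc i) n \<le> a i n"
  shows "boundary_units n l a b = {(x, r). r \<le> n \<and>
    (\<exists>i\<le>l. (i = l \<or> b (Suc i) r \<le> x) \<and> (i = 0 \<or> x < a i r) \<and> (i = 0 \<or> i = l \<or> r = n))}"
proof -
  have "outer l a b x r \<or> r = n \<and> between l a b x r \<longleftrightarrow>
    (\<exists>i\<le>l. (i = l \<or> b (Suc i) r \<le> x) \<and> (i = 0 \<or> x < a i r) \<and> (i = 0 \<or> i = l \<or> r = n))"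
    (is "?L \<longleftrightarrow> ?R") for x r
  proof
    assume ?L
    then consider "l = 0 \<or> b (Suc 0) r \<le> x" | "x < a l r"
      | i where "r = n" "1 \<le> i" "i < l" "min (a i r) (b (Suc i) r) \<le> x" "x < max (a i r) (b (Suc i) r)"
      by (auto simp: outer_def between_def)
    then show ?R
    proof cases
      case 1 then show ?R by (intro exI[of _ 0]) auto
    next
      case 2 then show ?R by (intro exI[of _ l]) auto
    next
      case 3 then show ?R using assms[of i] by (intro exI[of _ i]) auto
    qed
  next
    assume ?R
    then obtain i where i: "i \<le> l" "i = l \<or> b (Suc i) r \<le> x" "i = 0 \<or> x < a i r" "i = 0 \<or> i = l \<or> r = n"
      by blast
    show ?L
    proof (cases "i = 0 \<or> i = l")
      case True then show ?thesis using i by (auto simp: outer_def)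
    next
      case False
      then have "between l a b x r" unfolding between_def using i by (intro exI[of _ i]) auto
      then show ?thesis using i False by blast
    qed
  qed
  then show ?thesis by (auto simp: boundary_units_def)
qed

context
  fixes n l :: nat and a b :: "nat \<Rightarrow> nat \<Rightarrow> int" and s t :: "nat \<Rightarrow> int"
  assumes c: "config n l s t a b"
    and s: "\<And>i j. 1 \<le> i \<Longrightarrow> i < j \<Longrightarrow> j \<le> l \<Longrightarrow> s j < s i"
    and t: "\<And>i j. 1 \<le> i \<Longrightarrow> i < j \<Longrightarrow> j \<le> l \<Longrightarrow> t j < t i"
begin

text \<open>Let the overlap have index \<open>i\<close> and the hole index \<open>j\<close>. For
  \<open>j < i\<close> the hole lies to the right of the overlap with at least one unit in between,
  for \<open>j > i\<close> to the left. For \<open>j = i\<close> the difference of the two trails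
  would have to change sign within one row step, without room for the value 0.\<close>

lemma overlap_hole_not_adj:
  assumes "U \<in> overlap_units n l a b" "W \<in> hole_units n l a b"
  shows "\<not> hex_adj U W"
proof
  assume adj: "hex_adj U W"
  obtain x r where U: "U = (x, r)" by (cases U)
  obtain y q where W: "W = (y, q)" by (cases W)
  obtain i where i: "1 \<le> i" "i < l" "a i r \<le> x" "x < b (Suc i) r" and r: "r \<le> n"
    using assms(1) U by (auto simp: overlap_units_def)
  obtain j where j: "j \<le> l" "j = l \<or> b (Suc j) q \<le> y" "j = 0 \<or> y < a j q" and q: "q \<le> n"
    using assms(2) W by (auto simp: hole_units_def)
  have A1: "a i (Suc r') = a i r' \<or> a i (Suc r') = a i r' + 1"
    and B1: "b (Suc i) (Suc r') = b (Suc i) r' \<or> b (Suc i) (Suc r') = b (Suc i) r' + 1" if "r' < n" for r'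
    using c i that by (auto simp: config_def families_def trails_def PiE_iff)
  have d: "(q = r \<and> y - x \<in> {0, 1, -1}) \<or> (q = Suc r \<and> y - x \<in> {0, 1}) \<or> (r = Suc q \<and> x - y \<in> {0, 1})"
    using adj by (auto simp: hex_adj_def U W)
  have st: "q = Suc r \<Longrightarrow> (a i q = a i r \<or> a i q = a i r + 1) \<and> (b (Suc i) q = b (Suc i) r \<or> b (Suc i) q = b (Suc i) r + 1)"
    "r = Suc q \<Longrightarrow> (a i r = a i q \<or> a i r = a i q + 1) \<and> (b (Suc i) r = b (Suc i) q \<or> b (Suc i) r = b (Suc i) q + 1)"
    using A1[of r] A1[of q] B1[of r] B1[of q] r q by auto
  consider "j < i" | "j = i" | "i < j" by linarith
  then show False
  proof cases
    case 1
    then have "b (Suc i) q < b (Suc j) q"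
      using vertex_disjoint_strict[of b n l t, OF _ t] c i q by (auto simp: config_def)
    then show False using d st i j 1 by auto
  next
    case 2
    then show False using d st i j by auto
  next
    case 3
    then have "a j q < a i q"
      using vertex_disjoint_strict[of a n l s, OF _ s] c i j q by (auto simp: config_def)
    then show False using d st i j 3 by auto
  qed
qed

lemma overlap_hole_disjoint: "overlap_units n l a b \<inter> hole_units n l a b = {}"
  using overlap_hole_not_adj by (fastforce simp: hex_adj_def)

lemma region_classes:
  "conn_classes hex_adj (region_units n l a b) =
    conn_classes hex_adj (overlap_units n l a b) \<union> conn_classes hex_adj (hole_units n l a b)"
  unfolding region_units_eq by (intro conn_classes_Un symp_hex_adj overlap_hole_not_adj)

lemma class_overlap:
  assumes "C \<in> conn_classes hex_adj (region_units n l a b)" "U \<in> C" "U \<in> overlap_units n l a b"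
  shows "C \<subseteq> overlap_units n l a b" "C \<in> conn_classes hex_adj (overlap_units n l a b)"
proof -
  have "C \<notin> conn_classes hex_adj (hole_units n l a b)"
    using class_subset overlap_hole_disjoint assms(2,3) by blast
  then show "C \<in> conn_classes hex_adj (overlap_units n l a b)" using assms(1) region_classes by blast
  then show "C \<subseteq> overlap_units n l a b" by (rule class_subset)
qed

text \<open>The odd overlaps are sorted by the component of their leftmost unit. Such a component
  consists of overlaps, so it avoids the boundary, and its odd runs are exactly the odd overlaps
  sorted into it; being no odd region, it has an even number of them.\<close>

lemma even_overlaps:
  assumes pos: "\<And>i. 1 \<le> i \<Longrightarrow> i < l \<Longrightarrow> t (Suc i) \<le> s i"
    and no: "\<And>C. \<not> odd_region n l a b C"
  shows "even (card (odd_overlaps l (\<lambda>i. a i 0) (\<lambda>i. b i 0)))"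
proof -
  let ?O = "odd_overlaps l (\<lambda>i. a i 0) (\<lambda>i. b i 0)" and ?T = "region_units n l a b"
  define K where "K i = conn hex_adj ?T `` {(a i 0, 0)}" for i
  have top: "b (Suc i) n \<le> a i n" if "1 \<le> i" "i < l" for i
    using c pos[OF that] that by (auto simp: config_def families_def trails_def PiE_iff)
  have bh: "boundary_units n l a b \<subseteq> hole_units n l a b"
    by (subst boundary_units_eq) (use top in \<open>auto simp: hole_units_def\<close>)
  have K: "(a i 0, 0) \<in> overlap_units n l a b" "K i \<in> conn_classes hex_adj ?T" "(a i 0, 0) \<in> K i"
    if "i \<in> ?O" for i
  proof -
    show *: "(a i 0, 0) \<in> overlap_units n l a b"
      using that by (auto simp: odd_overlaps_def overlap_units_def)
    then have "(a i 0, 0) \<in> ?T" by (simp add: region_units_eq)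
    from class_of[OF this] show "K i \<in> conn_classes hex_adj ?T" "(a i 0, 0) \<in> K i" by (auto simp: K_def)
  qed
  have ev: "even (card {j \<in> ?O. K j = K i})" if i: "i \<in> ?O" for i
  proof -
    have sub: "K i \<subseteq> overlap_units n l a b" by (rule class_overlap[OF K(2,3,1)]) (rule i)+
    have "{j \<in> ?O. K j = K i} = odd_runs l a b (K i)"
    proof (intro equalityI subsetI)
      fix j assume "j \<in> {j \<in> ?O. K j = K i}"
      then have j: "j \<in> ?O" "(a j 0, 0) \<in> K i" using K(3)[of j] by auto
      then have "min (a j 0) (b (Suc j) 0) = a j 0" by (auto simp: odd_overlaps_def)
      then show "j \<in> odd_runs l a b (K i)" using j by (auto simp: odd_runs_def odd_overlaps_def)
    next
      fix j assume j: "j \<in> odd_runs l a b (K i)"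
      have lt: "a j 0 < b (Suc j) 0"
      proof (rule ccontr)
        assume "\<not> a j 0 < b (Suc j) 0"
        moreover have "a j 0 \<noteq> b (Suc j) 0" using j by (auto simp: odd_runs_def)
        ultimately have "b (Suc j) 0 < a j 0" by simp
        then have "(b (Suc j) 0, 0) \<in> hole_units n l a b" "(b (Suc j) 0, 0) \<in> K i"
          using j by (auto simp: odd_runs_def hole_units_def min_def intro!: exI[of _ j] split: if_splits)
        then show False using sub overlap_hole_disjoint by blast
      qed
      then have jO: "j \<in> ?O" using j by (auto simp: odd_runs_def odd_overlaps_def)
      have "(a j 0, 0) \<in> K i" using j lt by (auto simp: odd_runs_def min_def split: if_splits)
      then have "K i = K j" unfolding K_def[of j] by (rule class_eq[OF symp_hex_adj K(2)[OF i]])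
      then show "j \<in> {j \<in> ?O. K j = K i}" using jO by simp
    qed
    moreover have "even (card (odd_runs l a b (K i)))"
      using no[of "K i"] K(2,3)[OF i] sub bh overlap_hole_disjoint unfolding odd_region_def by blast
    ultimately show ?thesis by simp
  qed
  have fin: "finite ?O" by (rule finite_odd_overlaps)
  have "card ?O = (\<Sum>C\<in>K ` ?O. card {j \<in> ?O. K j = C})"
    using sum.image_gen[OF fin, of "\<lambda>_. 1::nat" K] by simp
  also have "even \<dots>" by (rule dvd_sum) (use ev in blast)
  finally show ?thesis .
qed

end

lemma finite_config: "finite {(a, b). config n l s t a b}"
  by (rule finite_subset[of _ "families n l s \<times> families n l t"])
    (auto simp: config_def finite_families)

text \<open>
  Exchanging the boundaries of an odd region reverses the sign and preserves the weight. Odd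
  regions only depend on the unordered pairs \<open>{a i r, b (i + 1) r}\<close>, so the chosen region is
  the same after the exchange.
\<close>

lemma sum_config_signed:
  fixes Fa Fb :: "nat \<Rightarrow> int \<Rightarrow> 'a::comm_ring_1"
  assumes F: "\<And>r x y. r \<le> n \<Longrightarrow> Fa r x * Fb r y = Fa r y * Fb r x"
    and s: "\<And>i j. 1 \<le> i \<Longrightarrow> i < j \<Longrightarrow> j \<le> l \<Longrightarrow> s j < s i"
    and t: "\<And>i j. 1 \<le> i \<Longrightarrow> i < j \<Longrightarrow> j \<le> l \<Longrightarrow> t j < t i"
    and pos: "\<And>i. 1 \<le> i \<Longrightarrow> i < l \<Longrightarrow> t (Suc i) \<le> s i"
  defines "W \<equiv> \<lambda>a b. (\<Prod>i\<in>{1..l}. \<Prod>r\<le>n. Fa r (a i r)) * (\<Prod>i\<in>{1..l}. \<Prod>r\<le>n. Fb r (b i r))"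
  shows "(\<Sum>(a, b) | config n l s t a b.
      (-1) ^ card (odd_overlaps l (\<lambda>i. a i 0) (\<lambda>i. b i 0)) * W a b) =
    (\<Sum>(a, b) | config n l s t a b \<and> (\<forall>C. \<not> odd_region n l a b C). W a b)"
proof -
  let ?sg = "\<lambda>a b. (-1) ^ card (odd_overlaps l (\<lambda>i. a i 0) (\<lambda>i. b i 0)) :: 'a"
  let ?S = "{(a, b). config n l s t a b}"
  let ?G = "{(a, b). config n l s t a b \<and> (\<forall>C. \<not> odd_region n l a b C)}"
  let ?B = "{(a, b). config n l s t a b \<and> (\<exists>C. odd_region n l a b C)}"
  define V where "V a b = (SOME C. odd_region n l a b C)" for a b
  define h where "h = (\<lambda>(a, b). (flip_a n l (V a b) a b, flip_b n l (V a b) a b))"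
  have V: "odd_region n l a b (V a b)" if "(a, b) \<in> ?B" for a b
    using that unfolding V_def by (auto intro: someI_ex)
  have zero: "sum (\<lambda>(a, b). ?sg a b * W a b) ?B = 0"
  proof (rule sum_involution_zero[where h = h])
    show "finite ?B" by (rule finite_subset[OF _ finite_config[of n l s t]]) auto
    fix p assume p: "p \<in> ?B"
    obtain a b where ab: "p = (a, b)" by (cases p)
    let ?V = "V a b"
    let ?a = "flip_a n l ?V a b" and ?b = "flip_b n l ?V a b"
    have c: "config n l s t a b" and o: "odd_region n l a b ?V" using p V ab by auto
    then have cl: "?V \<in> conn_classes hex_adj (region_units n l a b)"
      and bd: "?V \<inter> boundary_units n l a b = {}" and od: "odd (card (odd_runs l a b ?V))"
      by (auto simp: odd_region_def)
    have hp: "h p = (?a, ?b)" by (simp add: h_def ab)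
    have V': "V ?a ?b = ?V" by (simp add: V_def flip_odd_region)
    show "h p \<in> ?B" using flip_config[OF cl c bd s t] o by (auto simp: hp flip_odd_region)
    have "h (h p) = (flip_a n l ?V ?a ?b, flip_b n l ?V ?a ?b)" unfolding hp by (simp add: h_def V')
    then show "h (h p) = p" by (simp add: flip_flip ab)
    have fin: "finite (odd_runs l a b ?V)" by (rule finite_subset[of _ "{..l}"]) (auto simp: odd_runs_def)
    have "?sg ?a ?b = - ?sg a b"
      using even_card_sym_diff[OF finite_odd_overlaps fin] od
      by (auto simp: flip_odd_overlaps minus_one_power_iff)
    moreover have "W ?a ?b = W a b" unfolding W_def by (rule flip_weight[OF F])
    ultimately show "(case h p of (a, b) \<Rightarrow> ?sg a b * W a b) = - (case p of (a, b) \<Rightarrow> ?sg a b * W a b)"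
      unfolding hp unfolding ab prod.case by simp
    assume "h p = p"
    then have e: "?a = a" unfolding hp unfolding ab by simp
    obtain i where i: "i \<in> odd_runs l a b ?V" using od by (metis card.empty even_zero ex_in_conv)
    then have "flips n l ?V a b i 0" by (auto simp: odd_runs_def flips_def)
    then have "?a i 0 = b (Suc i) 0" "a i 0 \<noteq> b (Suc i) 0" by (auto simp: flip_a_def flips_def)
    then show "(case p of (a, b) \<Rightarrow> ?sg a b * W a b) = 0" using e by simp
  qed
  have "sum (\<lambda>(a, b). ?sg a b * W a b) ?S = sum (\<lambda>(a, b). ?sg a b * W a b) (?S - ?B) + sum (\<lambda>(a, b). ?sg a b * W a b) ?B"
    by (rule sum.subset_diff) (auto intro: finite_config)
  also have "?S - ?B = ?G" by auto
  also have "sum (\<lambda>(a, b). ?sg a b * W a b) ?G = sum (\<lambda>(a, b). W a b) ?G"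
    using even_overlaps[of n l s t, OF _ s t pos] by (intro sum.cong HOL.refl) (auto simp: minus_one_power_iff)
  finally show ?thesis using zero by simp
qed

section \<open>Paths built from trails\<close>

lemma vertex_0: "vertex q 0 = fst q"
  by (simp add: vertex_def)

lemma vertex_Suc: "k < length (snd q) \<Longrightarrow> vertex q (Suc k) = vertex q k + step_vec (snd q ! k)"
  by (simp add: vertex_def take_Suc_conv_app_nth)

lemma ht_step: "ht (w + step_vec s) = ht w + (if s = E then 0 else 1)"
  by (cases s) (auto simp: ht_def)

lemma ht_vertex_Suc: "k < length (snd q) \<Longrightarrow>
    ht (vertex q (Suc k)) = ht (vertex q k) + (if snd q ! k = E then 0 else 1)"
  by (simp only: vertex_Suc ht_step)

lemma fst_step: "fst (w + step_vec s) = fst w + (if s = NW then 0 else 1)"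
  by (cases s) auto

lemma fst_vertex_Suc: "k < length (snd q) \<Longrightarrow>
    fst (vertex q (Suc k)) = fst (vertex q k) + (if snd q ! k = NW then 0 else 1)"
  by (simp only: vertex_Suc fst_step)

definition low_steps :: "nat \<Rightarrow> (nat \<Rightarrow> int) \<Rightarrow> step list" where
  "low_steps n c = map (\<lambda>k. if c (n - k) = c (n - Suc k) then NE else NW) [0..<n]"

definition up_steps :: "nat \<Rightarrow> (nat \<Rightarrow> int) \<Rightarrow> step list" where
  "up_steps n d = map (\<lambda>r. if d (Suc r) = d r then NW else NE) [0..<n]"

text \<open>The lower half reaches height 0 at x-coordinate \<open>c 0 + 1\<close>, the upper half
  leaves it at \<open>d 0\<close>; the E-steps fill the distance. The start is the point of height
  -n whose dual coordinate is \<open>c n\<close>.\<close>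

definition trail_path :: "nat \<Rightarrow> (nat \<Rightarrow> int) \<Rightarrow> (nat \<Rightarrow> int) \<Rightarrow> path" where
  "trail_path n c d = ((c n - int n + 1, - c n - 1),
    low_steps n c @ replicate (nat (d 0 - c 0 - 1)) E @ up_steps n d)"

lemma low_steps: "length (low_steps n c) = n" "k < n \<Longrightarrow> low_steps n c ! k = (if c (n - k) = c (n - Suc k) then NE else NW)"
  by (simp_all add: low_steps_def)

lemma up_steps: "length (up_steps n c) = n" "k < n \<Longrightarrow> up_steps n d ! k = (if d (Suc k) = d k then NW else NE)"
  by (simp_all add: up_steps_def)

lemma count_low_steps: "count_list (take k (low_steps n c)) E = 0"
  by (rule count_notin) (auto simp: low_steps_def dest!: in_set_takeD)

lemma count_up_steps: "count_list (up_steps n d) E = 0"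
  by (rule count_notin) (auto simp: up_steps_def)

lemma count_replicate: "count_list (replicate k x) x = k"
  by (induction k) auto

context
  fixes n :: nat and c d :: "nat \<Rightarrow> int" and s t :: int
  assumes c: "c \<in> trails n s" and d: "d \<in> trails n t" and cd: "c 0 < d 0" "odd (d 0 - c 0)"
begin

private abbreviation "N \<equiv> nat (d 0 - c 0 - 1)"
private abbreviation "q \<equiv> trail_path n c d"

lemma trail_N: "even N" "int N = d 0 - c 0 - 1"
proof -
  show *: "int N = d 0 - c 0 - 1" using cd by simp
  have "even (d 0 - c 0 - 1)" using cd(2) by presburger
  then show "even N" using cd(1) by (subst even_nat_iff) auto
qed

lemma length_trail_path: "length (snd q) = n + N + n"
  by (simp add: trail_path_def low_steps up_steps)

lemma trail_step:
  "k < n \<Longrightarrow> snd q ! k = (if c (n - k) = c (n - Suc k) then NE else NW)"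
  "k < N \<Longrightarrow> snd q ! (n + k) = E"
  "r < n \<Longrightarrow> snd q ! (n + N + r) = (if d (Suc r) = d r then NW else NE)"
  by (simp_all add: trail_path_def nth_append low_steps up_steps)

lemma c_step: "r < n \<Longrightarrow> c (Suc r) = c r \<or> c (Suc r) = c r + 1"
  and d_step: "r < n \<Longrightarrow> d (Suc r) = d r \<or> d (Suc r) = d r + 1"
  using c d by (auto simp: trails_def)

lemma vertex_low: "k \<le> n \<Longrightarrow> vertex q k = (c (n - k) - int (n - k) + 1, - c (n - k) - 1)"
proof (induction k)
  case 0 then show ?case by (simp add: vertex_0 trail_path_def)
next
  case (Suc k)
  define r where "r = n - Suc k"
  have r: "n - k = Suc r" "r < n" using Suc.prems by (auto simp: r_def)
  have "vertex q (Suc k) = vertex q k + step_vec (snd q ! k)"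
    using Suc.prems by (intro vertex_Suc) (simp add: length_trail_path)
  also have "\<dots> = (c r - int r + 1, - c r - 1)"
    using Suc c_step[OF r(2)] r by (auto simp: trail_step r_def[symmetric])
  finally show ?case by (simp add: r_def)
qed

lemma vertex_mid: "k \<le> N \<Longrightarrow> vertex q (n + k) = (c 0 + 1 + int k, - c 0 - 1 - int k)"
proof (induction k)
  case 0 then show ?case using vertex_low[of n] by simp
next
  case (Suc k)
  have "vertex q (Suc (n + k)) = vertex q (n + k) + step_vec (snd q ! (n + k))"
    using Suc.prems by (intro vertex_Suc) (simp add: length_trail_path)
  then show ?case using Suc by (simp add: trail_step)
qed

lemma vertex_up: "r \<le> n \<Longrightarrow> vertex q (n + N + r) = (d r, int r - d r)"
proof (induction r)
  case 0 then show ?case using vertex_mid[of N] trail_N(2) by simp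
next
  case (Suc r)
  have "vertex q (Suc (n + N + r)) = vertex q (n + N + r) + step_vec (snd q ! (n + N + r))"
    using Suc.prems by (intro vertex_Suc) (simp add: length_trail_path)
  then show ?case using Suc d_step[of r] by (auto simp: trail_step)
qed

lemma path_end_trail: "path_end q = (d n, int n - d n)"
  by (simp add: path_end_def length_trail_path vertex_up)

lemma index_cases:
  assumes "k < n + N + n"
  obtains r where "r < n" "k = n - Suc r" | j where "j < N" "k = n + j" | r where "r < n" "k = n + N + r"
proof -
  consider "k < n" | "n \<le> k" "k < n + N" | "n + N \<le> k" by linarith
  then show thesis
  proof cases
    case 1 then have "n - Suc k < n" "k = n - Suc (n - Suc k)" by auto
    then show ?thesis by (rule that(1))
  next
    case 2 then have "k - n < N" "k = n + (k - n)" by auto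
    then show ?thesis by (rule that(2))
  next
    case 3 then have "k - (n + N) < n" "k = n + N + (k - (n + N))" using assms by auto
    then show ?thesis by (rule that(3))
  qed
qed

lemma is_path_trail: "is_path n q"
proof -
  have "ht (vertex q k) = 0" if k: "k < length (snd q)" "snd q ! k = E" for k
  proof -
    have "k < n + N + n" using k by (simp add: length_trail_path)
    then show ?thesis
    proof (cases rule: index_cases)
      case (1 r) then show ?thesis using k trail_step(1)[of k] by (simp split: if_splits)
    next
      case (2 j) then show ?thesis using vertex_mid[of j] by (simp add: ht_def)
    next
      case (3 r) then show ?thesis using k trail_step(3)[of r] by (simp split: if_splits)
    qed
  qed
  moreover have "even (count_list (snd q) E)"
    using count_low_steps[of n n c] trail_N(1) by (simp add: trail_path_def count_up_steps count_replicate low_steps)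
  moreover have "ht (fst q) = - int n" by (simp add: trail_path_def ht_def)
  ultimately show ?thesis by (simp add: is_path_def path_end_trail ht_def)
qed

lemma vertices_trail: "w \<in> vertices q \<longleftrightarrow> (\<exists>r\<le>n. w = (c r - int r + 1, - c r - 1)) \<or>
  (\<exists>x. c 0 < x \<and> x \<le> d 0 \<and> w = (x, - x)) \<or> (\<exists>r\<le>n. w = (d r, int r - d r))"
proof
  assume "w \<in> vertices q"
  then obtain k where k: "k \<le> n + N + n" "w = vertex q k" by (auto simp: vertices_def length_trail_path)
  show "(\<exists>r\<le>n. w = (c r - int r + 1, - c r - 1)) \<or>
  (\<exists>x. c 0 < x \<and> x \<le> d 0 \<and> w = (x, - x)) \<or> (\<exists>r\<le>n. w = (d r, int r - d r))"
  proof (cases "k < n + N + n")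
    case True
    then show ?thesis
    proof (cases rule: index_cases)
      case (1 r) then have "w = (c (n - k) - int (n - k) + 1, - c (n - k) - 1)" using k vertex_low[of k] by simp
      then show ?thesis by (metis diff_le_self)
    next
      case (2 j)
      then have "w = (c 0 + 1 + int j, - (c 0 + 1 + int j))" "c 0 < c 0 + 1 + int j" "c 0 + 1 + int j \<le> d 0"
        using k vertex_mid[of j] trail_N by auto
      then show ?thesis by blast
    next
      case (3 r)
      then have "r \<le> n" "w = (d r, int r - d r)" using k vertex_up[of r] by auto
      then show ?thesis by blast
    qed
  next
    case False
    then have "k = n + N + n" using k by simp
    then show ?thesis using k vertex_up[of n] by auto
  qed
next
  assume "(\<exists>r\<le>n. w = (c r - int r + 1, - c r - 1)) \<or>
  (\<exists>x. c 0 < x \<and> x \<le> d 0 \<and> w = (x, - x)) \<or> (\<exists>r\<le>n. w = (d r, int r - d r))"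
  then have "\<exists>k\<le>n + N + n. w = vertex q k"
  proof (elim disjE exE conjE)
    fix r assume "r \<le> n" "w = (c r - int r + 1, - c r - 1)"
    then show ?thesis using vertex_low[of "n - r"] by (intro exI[of _ "n - r"]) simp
  next
    fix x assume x: "c 0 < x" "x \<le> d 0" "w = (x, - x)"
    then have "nat (x - c 0 - 1) \<le> N" "int (nat (x - c 0 - 1)) = x - c 0 - 1" by auto
    then show ?thesis using vertex_mid[of "nat (x - c 0 - 1)"] x by (intro exI[of _ "n + nat (x - c 0 - 1)"]) simp
  next
    fix r assume "r \<le> n" "w = (d r, int r - d r)"
    then show ?thesis using vertex_up[of r] by (intro exI[of _ "n + N + r"]) simp
  qed
  then show "w \<in> vertices q" by (auto simp: vertices_def length_trail_path)
qed

lemma hp0_trail: "hp0 q = of_int (c 0 + 1)"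
proof -
  have "hp ` {w \<in> vertices q. ht w = 0} = real_of_int ` {c 0 + 1..d 0}"
  proof -
    have "{w \<in> vertices q. ht w = 0} = (\<lambda>x. (x, - x)) ` {c 0 + 1..d 0}"
    proof (intro equalityI subsetI)
      fix w assume "w \<in> {w \<in> vertices q. ht w = 0}"
      then have w: "w \<in> vertices q" "ht w = 0" by auto
      from w(1) consider r where "r \<le> n" "w = (c r - int r + 1, - c r - 1)"
        | x where "c 0 < x" "x \<le> d 0" "w = (x, - x)" | r where "r \<le> n" "w = (d r, int r - d r)"
        unfolding vertices_trail by blast
      then show "w \<in> (\<lambda>x. (x, - x)) ` {c 0 + 1..d 0}"
      proof cases
        case (1 r)
        then have "r = 0" using w(2) by (simp add: ht_def)
        then show ?thesis using 1 cd by (intro image_eqI[of _ _ "c 0 + 1"]) auto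
      next
        case (2 x) then show ?thesis by (intro image_eqI[of _ _ x]) auto
      next
        case (3 r)
        then have "r = 0" using w(2) by (simp add: ht_def)
        then show ?thesis using 3 cd by (intro image_eqI[of _ _ "d 0"]) auto
      qed
    next
      fix w assume "w \<in> (\<lambda>x. (x, - x)) ` {c 0 + 1..d 0}"
      then show "w \<in> {w \<in> vertices q. ht w = 0}" by (auto simp: vertices_trail ht_def)
    qed
    then show ?thesis by (simp add: image_image hp_def)
  qed
  moreover have "Min (real_of_int ` {c 0 + 1..d 0}) = of_int (c 0 + 1)"
  proof (rule Min_eqI)
    show "real_of_int (c 0 + 1) \<in> real_of_int ` {c 0 + 1..d 0}" by (rule imageI) (use cd in simp)
  qed auto
  ultimately show ?thesis by (simp add: hp0_def)
qed

lemma vertex_lower_path: "k \<le> n \<Longrightarrow> vertex (lower_path n q) k = vertex q k"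
  by (simp add: lower_path_def vertex_def min_absorb1)

lemma pos_at_lower: "r \<le> n \<Longrightarrow> pos_at (lower_path n q) (- int r) = of_int (c r + 1) - real r / 2"
proof -
  assume r: "r \<le> n"
  have "ht (fst (lower_path n q)) = - int n" by (simp add: lower_path_def trail_path_def ht_def)
  moreover have "nat (- int r - - int n) = n - r" by (simp add: nat_diff_distrib)
  ultimately show ?thesis using r
    by (simp add: pos_at_def vertex_lower_path vertex_low hp_def field_simps)
qed

lemma vertex_drop: "vertex (vertex p j, drop j (snd p)) r = vertex p (j + r)"
  by (simp add: vertex_def take_add)

lemma vertex_upper_path: "r \<le> n \<Longrightarrow> vertex (upper_path n q) r = (d r, int r - d r)"
  unfolding upper_path_def vertex_drop using vertex_up by (simp add: length_trail_path)

lemma fst_upper_path: "fst (upper_path n q) = (d 0, - d 0)"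
  using vertex_upper_path[of 0] by (simp add: vertex_0)

lemma pos_at_upper: "r \<le> n \<Longrightarrow> pos_at (upper_path n q) (int r) = of_int (d r) - real r / 2"
  by (simp add: pos_at_def fst_upper_path ht_def vertex_upper_path hp_def field_simps)

lemma path_end_lower: "path_end (lower_path n q) = (c 0 + 1, - c 0 - 1)"
proof -
  have "length (snd (lower_path n q)) = n" by (simp add: lower_path_def length_trail_path)
  then show ?thesis by (simp add: path_end_def vertex_lower_path vertex_low)
qed

end

section \<open>The weight of a path built from trails\<close>

lemma prod_split: "(\<Prod>k<i + j. f k) = (\<Prod>k<i. f k) * (\<Prod>k<j. f (i + k))" for f :: "nat \<Rightarrow> 'a::comm_monoid_mult"
  by (induction j) (auto simp: mult.assoc)

lemma prod_pairs: "(\<Prod>k<2 * m. f k) = (\<Prod>k<m. f (2 * k) * f (2 * k + 1))" for f :: "nat \<Rightarrow> 'a::comm_monoid_mult"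
  by (induction m) (auto simp: mult.assoc)

lemma path_weight_trail:
  fixes a :: complex
  assumes c: "c \<in> trails CARD('n) s" and d: "d \<in> trails CARD('n) t" and cd: "c 0 < d 0" "odd (d 0 - c 0)"
  shows "path_weight a (trail_path CARD('n) c d) =
    ((\<Prod>r<CARD('n). low_step CARD('n) a r (c r) (c (Suc r))) * E_run a (c 0 + 1) (d 0) *
      (\<Prod>r<CARD('n). up_step CARD('n) a r (d r) (d (Suc r))) :: 'n zring)"
proof -
  let ?n = "CARD('n)" and ?q = "trail_path CARD('n) c d"
  note as = c d cd
  define N where "N = nat (d 0 - c 0 - 1)"
  have N: "even N" "int N = d 0 - c 0 - 1" using trail_N[OF as] by (simp_all add: N_def)
  note st = trail_step[OF as, folded N_def] and len = length_trail_path[OF as, folded N_def]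
  note vl = vertex_low[OF as] and vm = vertex_mid[OF as, folded N_def] and vu = vertex_up[OF as, folded N_def]
  define f where "f k = (if snd ?q ! k \<in> {NE, E}
    then zvar (step_label ?n ?q k) (a - 2 * of_int (fst (vertex ?q k))) else (1 :: 'n zring))" for k
  have "path_weight a ?q = (\<Prod>k<?n + N + ?n. f k)"
    unfolding path_weight_def f_def len[symmetric] by (subst prod.inter_filter[symmetric]) (auto intro: prod.cong)
  also have "\<dots> = (\<Prod>k<?n. f k) * (\<Prod>k<N. f (?n + k)) * (\<Prod>r<?n. f (?n + N + r))"
    by (simp only: prod_split)
  \<comment> \<open>Rows of the lower trail count away from height 0, against the direction of the
    path.\<close>
  also have "(\<Prod>k<?n. f k) = (\<Prod>r<?n. f (?n - Suc r))" by (rule prod.nat_diff_reindex[symmetric])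
  also have "\<dots> = (\<Prod>r<?n. low_step ?n a r (c r) (c (Suc r)))"
  proof (rule prod.cong)
    fix r assume "r \<in> {..<?n}"
    then have r: "r < ?n" by simp
    then have k: "?n - (?n - Suc r) = Suc r" "Suc (?n - Suc r) = ?n - r" "?n - (?n - r) = r" by auto
    have v: "vertex ?q (?n - Suc r) = (c (Suc r) - int r, - c (Suc r) - 1)" using vl[of "?n - Suc r"] k by simp
    have "step_label ?n ?q (?n - Suc r) = Unb (?n - r)"
      using r by (simp add: step_label_def v ht_def Let_def of_nat_diff nat_diff_distrib)
    moreover have "snd ?q ! (?n - Suc r) = (if c (Suc r) = c r then NE else NW)" using st(1)[of "?n - Suc r"] r k by simp
    ultimately show "f (?n - Suc r) = low_step ?n a r (c r) (c (Suc r))"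
      by (simp add: f_def v low_step_def zU_def)
  qed simp
  also have "(\<Prod>r<?n. f (?n + N + r)) = (\<Prod>r<?n. up_step ?n a r (d r) (d (Suc r)))"
  proof (rule prod.cong)
    fix r assume "r \<in> {..<?n}"
    then have r: "r < ?n" by simp
    have v: "vertex ?q (?n + N + r) = (d r, int r - d r)" using vu[of r] r by simp
    have s: "snd ?q ! (?n + N + r) = (if d (Suc r) = d r then NW else NE)" using st(3)[OF r] .
    have "step_label ?n ?q (?n + N + r) = Bar (?n - r)"
      using r unfolding step_label_def v s by (auto simp: ht_def Let_def nat_diff_distrib)
    then show "f (?n + N + r) = up_step ?n a r (d r) (d (Suc r))"
      by (simp add: f_def v s up_step_def zB_def)
  qed simp
  also have "(\<Prod>k<N. f (?n + k)) = E_run a (c 0 + 1) (d 0)"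
  proof -
    obtain m where m: "N = 2 * m" using N(1) by (auto elim: evenE)
    \<comment> \<open>Exactly \<open>k\<close> E-steps precede this one, so an odd \<open>k\<close>
      means an even-numbered E-step and the unbarred letter.\<close>
    have f: "f (?n + k) = (if odd k then zU a ?n (c 0 + 1 + int k) else zB a ?n (c 0 + 1 + int k))" if "k < N" for k
    proof -
      have v: "vertex ?q (?n + k) = (c 0 + 1 + int k, - c 0 - 1 - int k)" using vm[of k] that by simp
      have "take (?n + k) (snd ?q) = low_steps ?n c @ replicate k E"
        using that by (simp add: trail_path_def low_steps N_def[symmetric] min_absorb1)
      then have "count_list (take (?n + k) (snd ?q)) E = k"
        using count_low_steps[of ?n ?n c] by (simp add: count_replicate low_steps)
      then have "step_label ?n ?q (?n + k) = (if odd k then Unb ?n else Bar ?n)"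
        using st(2)[OF that] by (simp add: step_label_def v ht_def Let_def)
      then show ?thesis using st(2)[OF that] by (simp add: f_def v zU_def zB_def)
    qed
    have "(\<Prod>k<N. f (?n + k)) = (\<Prod>k<m. f (?n + 2 * k) * f (?n + (2 * k + 1)))"
      unfolding m by (rule prod_pairs)
    also have "\<dots> = (\<Prod>k<m. E_pair a (c 0 + 1 + 2 * int k))"
    proof (rule prod.cong)
      fix k assume "k \<in> {..<m}"
      then have "f (?n + 2 * k) = zB a ?n (c 0 + 1 + int (2 * k))"
        "f (?n + (2 * k + 1)) = zU a ?n (c 0 + 1 + int (2 * k + 1))"
        using f[of "2 * k"] f[of "2 * k + 1"] m by auto
      then show "f (?n + 2 * k) * f (?n + (2 * k + 1)) = E_pair a (c 0 + 1 + 2 * int k)"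
        by (simp add: E_pair_def algebra_simps)
    qed simp
    also have "\<dots> = E_run a (c 0 + 1) (d 0)"
    proof -
      have "d 0 - (c 0 + 1) = 2 * int m" using N m by simp
      moreover have "nat (2 * int m) div 2 = m" by simp
      moreover have "c 0 + 1 \<le> d 0" using cd by simp
      ultimately show ?thesis unfolding E_run_def by simp
    qed
    finally show ?thesis .
  qed
  finally show ?thesis .
qed

section \<open>Every path is built from two trails\<close>

lemma ht_mono:
  assumes "j \<le> k" "k \<le> length (snd q)" shows "ht (vertex q j) \<le> ht (vertex q k)"
  using assms
proof (induction rule: dec_induct)
  case (step k)
  then show ?case using vertex_Suc[of k q] by (simp add: ht_step)
qed simp

text \<open>Away from height 0 there are no E-steps, so each step raises the height by 1: the first
  and the last \<open>n\<close> steps are forced to be NE or NW.\<close>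

lemma path_heights:
  assumes "is_path n q"
  shows "2 * n \<le> length (snd q)" "k \<le> n \<Longrightarrow> ht (vertex q k) = int k - int n"
    "k \<le> n \<Longrightarrow> ht (vertex q (length (snd q) - k)) = int n - int k"
proof -
  let ?L = "length (snd q)"
  have p: "ht (vertex q 0) = - int n" "ht (vertex q ?L) = int n"
    and E: "\<And>k. k < ?L \<Longrightarrow> snd q ! k = E \<Longrightarrow> ht (vertex q k) = 0"
    using assms by (auto simp: is_path_def vertex_0 path_end_def)
  have low: "ht (vertex q k) = int k - int n" if "k \<le> n" "k \<le> ?L" for k
    using that
  proof (induction k)
    case (Suc k)
    then have h: "ht (vertex q k) = int k - int n" by simp
    then have "snd q ! k \<noteq> E" using E[of k] Suc.prems by auto
    then show ?case using vertex_Suc[of k q] Suc.prems h by (simp add: ht_step)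
  qed (simp add: p)
  have up: "ht (vertex q (?L - k)) = int n - int k" if "k \<le> n" "k \<le> ?L" for k
    using that
  proof (induction k)
    case (Suc k)
    then have h: "ht (vertex q (?L - k)) = int n - int k" by simp
    let ?j = "?L - Suc k"
    have j: "Suc ?j = ?L - k" "?j < ?L" using Suc.prems by auto
    have v: "ht (vertex q (?L - k)) = ht (vertex q ?j) + (if snd q ! ?j = E then 0 else 1)"
      using vertex_Suc[of ?j q] j by (simp add: ht_step)
    then have "snd q ! ?j \<noteq> E" using E[of ?j] j h Suc.prems by auto
    then show ?case using v h by simp
  qed (simp add: p)
  have nL: "n \<le> ?L"
  proof (rule ccontr)
    assume "\<not> n \<le> ?L"
    then show False using low[of ?L] p(2) by simp
  qed
  then have "ht (vertex q n) = 0" "ht (vertex q (?L - n)) = 0" using low[of n] up[of n] by auto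
  show "2 * n \<le> ?L"
  proof (rule ccontr)
    assume "\<not> 2 * n \<le> ?L"
    then have "?L - n < n" using nL by linarith
    then show False using low[of "?L - n"] \<open>ht (vertex q (?L - n)) = 0\<close> by simp
  qed
  then show "k \<le> n \<Longrightarrow> ht (vertex q k) = int k - int n"
    "k \<le> n \<Longrightarrow> ht (vertex q (?L - k)) = int n - int k"
    using low up by auto
qed

lemma path_is_trail_path:
  assumes q: "is_path n q"
  obtains c d where "c \<in> trails n (fst (fst q) + int n - 1)" "d \<in> trails n (fst (path_end q))"
    "c 0 < d 0" "odd (d 0 - c 0)" "q = trail_path n c d"
proof -
  let ?L = "length (snd q)"
  define N where "N = ?L - 2 * n"
  have L: "?L = n + N + n" "?L - n = n + N" using path_heights(1)[OF q] by (auto simp: N_def)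
  have hl: "ht (vertex q k) = int k - int n" if "k \<le> n" for k using path_heights(2)[OF q that] .
  have hu: "ht (vertex q (n + N + r)) = int r" if "r \<le> n" for r
  proof -
    have "?L - (n - r) = n + N + r" using L that by simp
    then show ?thesis using path_heights(3)[OF q, of "n - r"] that by simp
  qed
  have E: "\<And>k. k < ?L \<Longrightarrow> snd q ! k = E \<Longrightarrow> ht (vertex q k) = 0" using q by (simp add: is_path_def)
  \<comment> \<open>Heights never decrease and are 0 at both ends of the middle part, so they are 0
    throughout and all its steps are E-steps.\<close>
  have hm: "ht (vertex q (n + k)) = 0" if "k \<le> N" for k
    using ht_mono[of n "n + k" q] ht_mono[of "n + k" "n + N" q] hl[of n] hu[of 0] that L by simp
  have mid: "snd q ! (n + k) = E" if "k < N" for k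
  proof (rule ccontr)
    assume "snd q ! (n + k) \<noteq> E"
    then show False using vertex_Suc[of "n + k" q] hm[of k] hm[of "Suc k"] that L by (simp add: ht_step)
  qed
  have lowE: "snd q ! k \<noteq> E" if "k < n" for k using E[of k] hl[of k] that L by auto
  have upE: "snd q ! (n + N + r) \<noteq> E" if "r < n" for r
  proof
    assume "snd q ! (n + N + r) = E"
    then show False using ht_vertex_Suc[of "n + N + r" q] hu[of r] hu[of "Suc r"] that L by simp
  qed
  define c where "c = restrict (\<lambda>r. fst (vertex q (n - r)) + int r - 1) {..n}"
  define d where "d = restrict (\<lambda>r. fst (vertex q (n + N + r))) {..n}"
  have low: "snd q ! k = (if c (n - k) = c (n - Suc k) then NE else NW)"
    and cs: "c (n - k) = c (n - Suc k) \<or> c (n - k) = c (n - Suc k) + 1" if "k < n" for k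
  proof -
    have e: "n - (n - k) = k" "n - (n - Suc k) = Suc k" "int (n - Suc k) = int (n - k) - 1" using that by auto
    have "fst (vertex q (Suc k)) = fst (vertex q k) + (if snd q ! k = NW then 0 else 1)"
      using fst_vertex_Suc[of k q] that L by simp
    then have *: "c (n - k) = c (n - Suc k) + (if snd q ! k = NW then 1 else 0)"
      using e by (simp add: c_def)
    then show "snd q ! k = (if c (n - k) = c (n - Suc k) then NE else NW)"
      using lowE[OF that] by (cases "snd q ! k") auto
    show "c (n - k) = c (n - Suc k) \<or> c (n - k) = c (n - Suc k) + 1" using * by (auto split: if_splits)
  qed
  have up: "snd q ! (n + N + r) = (if d (Suc r) = d r then NW else NE)"
    and ds: "d (Suc r) = d r \<or> d (Suc r) = d r + 1" if "r < n" for r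
  proof -
    have "fst (vertex q (Suc (n + N + r))) = fst (vertex q (n + N + r)) + (if snd q ! (n + N + r) = NW then 0 else 1)"
      using fst_vertex_Suc[of "n + N + r" q] that L by simp
    then have *: "d (Suc r) = d r + (if snd q ! (n + N + r) = NW then 0 else 1)"
      using that by (simp add: d_def)
    then show "snd q ! (n + N + r) = (if d (Suc r) = d r then NW else NE)"
      using upE[OF that] by (cases "snd q ! (n + N + r)") auto
    show "d (Suc r) = d r \<or> d (Suc r) = d r + 1" using * by (auto split: if_splits)
  qed
  have "c (Suc r) = c r \<or> c (Suc r) = c r + 1" if "r < n" for r
  proof -
    have "n - (n - Suc r) = Suc r" "n - Suc (n - Suc r) = r" using that by auto
    then show ?thesis using cs[of "n - Suc r"] that by simp
  qed
  then have ct: "c \<in> trails n (fst (fst q) + int n - 1)" by (simp add: trails_def c_def vertex_0)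
  have dt: "d \<in> trails n (fst (path_end q))" using ds by (simp add: trails_def d_def path_end_def L)
  have "fst (vertex q (n + k)) = fst (vertex q n) + int k" if "k \<le> N" for k
    using that
  proof (induction k)
    case (Suc k)
    then show ?case using fst_vertex_Suc[of "n + k" q] mid[of k] L by simp
  qed simp
  from this[of N] have dc: "d 0 = c 0 + 1 + int N" by (simp add: c_def d_def)
  have steps: "snd q = low_steps n c @ replicate N E @ up_steps n d"
  proof (rule nth_equalityI)
    show "length (snd q) = length (low_steps n c @ replicate N E @ up_steps n d)"
      by (simp add: L low_steps up_steps)
    fix k assume "k < length (snd q)"
    then consider "k < n" | "n \<le> k" "k < n + N" | "n + N \<le> k" "k < n + N + n" using L by linarith
    then show "snd q ! k = (low_steps n c @ replicate N E @ up_steps n d) ! k"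
    proof cases
      case 1 then show ?thesis using low by (simp add: nth_append low_steps)
    next
      case 2
      then have "k - n < N" by linarith
      then show ?thesis using 2 mid[of "k - n"] by (simp add: nth_append low_steps)
    next
      case 3 then show ?thesis using up[of "k - n - N"] by (simp add: nth_append low_steps up_steps)
    qed
  qed
  have "count_list (low_steps n c) E = 0" using count_low_steps[of n n c] by (simp add: low_steps)
  then have "count_list (snd q) E = N" unfolding steps by (simp add: count_up_steps count_replicate)
  then have "even N" using q by (simp add: is_path_def)
  then have "odd (d 0 - c 0)" using dc by simp
  moreover have "fst q = (c n - int n + 1, - c n - 1)"
    using q by (auto simp: c_def vertex_0 is_path_def ht_def prod_eq_iff)
  then have "q = trail_path n c d" using steps dc by (simp add: trail_path_def prod_eq_iff)
  ultimately show thesis using that[OF ct dt] dc by simp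
qed

section \<open>The two strips\<close>

definition up_unit :: "int \<times> nat \<Rightarrow> lunit" where
  "up_unit U = (Upper, fst U, int (snd U) - fst U)"

text \<open>The unit of the lower strip dual to the upper unit \<open>(x, r)\<close>: opposite
  height and horizontal position larger by 1, just as \<alpha> compared with its dual. In these
  coordinates both strips obey the same conditions.\<close>

definition low_unit :: "int \<times> nat \<Rightarrow> lunit" where
  "low_unit U = (Lower, fst U + 1 - int (snd U), - fst U - 1)"

lemma inj_up_unit: "inj_on up_unit S" and inj_low_unit: "inj_on low_unit S"
  by (auto simp: inj_on_def up_unit_def low_unit_def prod_eq_iff)

lemma up_unit_ht: "unit_ht (up_unit U) = int (snd U)"
  and low_unit_ht: "unit_ht (low_unit U) = - int (snd U)"
  by (simp_all add: up_unit_def low_unit_def unit_ht_def ht_def)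

lemma is_lunit_iff: "is_lunit n U \<longleftrightarrow> (\<exists>W. snd W \<le> n \<and> (U = up_unit W \<or> U = low_unit W))"
proof
  assume U: "is_lunit n U"
  obtain s x y where sxy: "U = (s, x, y)" by (cases U) auto
  show "\<exists>W. snd W \<le> n \<and> (U = up_unit W \<or> U = low_unit W)"
  proof (cases s)
    case Upper
    have "0 \<le> real_of_int (x + y)" "real_of_int (x + y) \<le> real n"
      using U by (auto simp: sxy Upper is_lunit_def strip_heights_def unit_ht_def ht_def)
    then have "0 \<le> x + y" "x + y \<le> int n" by linarith+
    then show ?thesis
      by (intro exI[of _ "(x, nat (x + y))"]) (auto simp: sxy Upper up_unit_def)
  next
    case Lower
    have "- real n \<le> real_of_int (x + y)" "real_of_int (x + y) \<le> 0"
      using U by (auto simp: sxy Lower is_lunit_def strip_heights_def unit_ht_def ht_def)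
    then have "x + y \<le> 0" "- int n \<le> x + y" by linarith+
    then show ?thesis
      by (intro exI[of _ "(- y - 1, nat (- x - y))"]) (auto simp: sxy Lower low_unit_def)
  qed
next
  assume "\<exists>W. snd W \<le> n \<and> (U = up_unit W \<or> U = low_unit W)"
  then show "is_lunit n U"
    by (auto simp: is_lunit_def up_unit_ht low_unit_ht strip_heights_def up_unit_def low_unit_def
        unit_ht_def ht_def)
qed

lemma up_ne_low: "up_unit U \<noteq> low_unit W" "low_unit W \<noteq> up_unit U"
  by (simp_all add: up_unit_def low_unit_def)

lemma not_adjacent_up_low: "\<not> adjacent n (up_unit U) (low_unit W)"
  by (simp add: adjacent_def up_unit_def low_unit_def)

lemma symp_adjacent: "symp (adjacent n)"
  by (auto simp: symp_def adjacent_def)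

text \<open>Left and right vertices have the height of their unit, so restricting
  \<open>unit_vertices\<close> to the strip never removes the one that is compared, and adjacency
  depends on the offset alone.\<close>

lemma adjacent_vertices:
  assumes "fst U = fst W" "is_lunit n U" "is_lunit n W"
  shows "adjacent n U W \<longleftrightarrow> snd W - snd U \<in> {(0, 0), (1, -1), (-1, 1), (1, 0), (-1, 0), (0, 1), (0, -1)}"
proof -
  obtain s x y where U: "U = (s, x, y)" by (cases U) auto
  obtain x' y' where W: "W = (s, x', y')" using assms(1) U by (cases W) auto
  have h: "real_of_int (x + y) \<in> strip_heights n s" "real_of_int (x' + y') \<in> strip_heights n s"
    using assms(2,3) by (simp_all add: is_lunit_def U W unit_ht_def ht_def)
  have l: "left_vertex U \<in> unit_vertices n W \<longleftrightarrow> (x, y) \<in> {(x', y'), (x' + 1, y' - 1), (x' + 1, y'), (x', y' - 1)}"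
    "right_vertex U \<in> unit_vertices n W \<longleftrightarrow> (x + 1, y - 1) \<in> {(x', y'), (x' + 1, y' - 1), (x' + 1, y'), (x', y' - 1)}"
    "left_vertex W \<in> unit_vertices n U \<longleftrightarrow> (x', y') \<in> {(x, y), (x + 1, y - 1), (x + 1, y), (x, y - 1)}"
    "right_vertex W \<in> unit_vertices n U \<longleftrightarrow> (x' + 1, y' - 1) \<in> {(x, y), (x + 1, y - 1), (x + 1, y), (x, y - 1)}"
    using h by (auto simp: left_vertex_def right_vertex_def unit_vertices_def U W ht_def)
  have "adjacent n U W \<longleftrightarrow> left_vertex U \<in> unit_vertices n W \<or> right_vertex U \<in> unit_vertices n W \<or>
     left_vertex W \<in> unit_vertices n U \<or> right_vertex W \<in> unit_vertices n U"
    by (simp add: adjacent_def U W)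
  also have "\<dots> \<longleftrightarrow> snd W - snd U \<in> {(0, 0), (1, -1), (-1, 1), (1, 0), (-1, 0), (0, 1), (0, -1)}"
    unfolding l unfolding U W snd_conv minus_prod_def fst_conv insert_iff empty_iff prod.inject by presburger
  finally show ?thesis .
qed

lemma is_lunit_up: "snd U \<le> n \<Longrightarrow> is_lunit n (up_unit U)"
  and is_lunit_low: "snd U \<le> n \<Longrightarrow> is_lunit n (low_unit U)"
  unfolding is_lunit_iff by blast+

lemma adjacent_up:
  assumes "snd U \<le> n" "snd W \<le> n"
  shows "adjacent n (up_unit U) (up_unit W) \<longleftrightarrow> hex_adj U W"
proof -
  have "fst (up_unit U) = fst (up_unit W)" by (simp add: up_unit_def)
  note * = adjacent_vertices[OF this is_lunit_up[OF assms(1)] is_lunit_up[OF assms(2)]]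
  define dx dr where "dx = fst W - fst U" and "dr = int (snd W) - int (snd U)"
  have d: "snd (up_unit W) - snd (up_unit U) = (dx, dr - dx)"
    by (simp add: up_unit_def dx_def dr_def)
  have h: "hex_adj U W \<longleftrightarrow> (dx, dr) \<in> {(0, 0), (1, 0), (-1, 0), (0, 1), (0, -1), (1, 1), (-1, -1)}"
    by (simp add: hex_adj_def dx_def dr_def)
  show ?thesis unfolding * d h by (auto simp del: One_nat_def)
qed

lemma adjacent_low:
  assumes "snd U \<le> n" "snd W \<le> n"
  shows "adjacent n (low_unit U) (low_unit W) \<longleftrightarrow> hex_adj U W"
proof -
  have "fst (low_unit U) = fst (low_unit W)" by (simp add: low_unit_def)
  note * = adjacent_vertices[OF this is_lunit_low[OF assms(1)] is_lunit_low[OF assms(2)]]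
  define dx dr where "dx = fst W - fst U" and "dr = int (snd W) - int (snd U)"
  have d: "snd (low_unit W) - snd (low_unit U) = (dx - dr, - dx)"
    by (simp add: low_unit_def dx_def dr_def)
  have h: "hex_adj U W \<longleftrightarrow> (dx, dr) \<in> {(0, 0), (1, 0), (-1, 0), (0, 1), (0, -1), (1, 1), (-1, -1)}"
    by (simp add: hex_adj_def dx_def dr_def)
  show ?thesis unfolding * d h by (auto simp del: One_nat_def)
qed

lemma components_mirrored:
  assumes "\<And>U. U \<in> S \<Longrightarrow> snd U \<le> n"
  shows "components n (up_unit ` S \<union> low_unit ` S) =
    (`) up_unit ` conn_classes hex_adj S \<union> (`) low_unit ` conn_classes hex_adj S"
proof -
  have "components n T = conn_classes (adjacent n) T" for T
    by (simp add: components_def conn_classes_def conn_def)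
  moreover have "conn_classes (adjacent n) (up_unit ` S \<union> low_unit ` S) =
      conn_classes (adjacent n) (up_unit ` S) \<union> conn_classes (adjacent n) (low_unit ` S)"
    by (rule conn_classes_Un[OF symp_adjacent]) (use not_adjacent_up_low in blast)
  moreover have "conn_classes (adjacent n) (up_unit ` S) = (`) up_unit ` conn_classes hex_adj S"
    by (rule conn_classes_image[OF inj_up_unit]) (use assms adjacent_up in blast)
  moreover have "conn_classes (adjacent n) (low_unit ` S) = (`) low_unit ` conn_classes hex_adj S"
    by (rule conn_classes_image[OF inj_low_unit]) (use assms adjacent_low in blast)
  ultimately show ?thesis by simp
qed

lemma lies_in_up:
  assumes "snd U \<le> n"
  shows "lies_in n (x, - x) (up_unit U) \<longleftrightarrow> U \<in> {(x, 0), (x - 1, 0), (x, 1)}"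
proof -
  obtain y r where U: "U = (y, r)" by (cases U)
  have "lies_in n (x, - x) (up_unit U) \<longleftrightarrow> of_int y \<le> real_of_int x \<and> real_of_int x \<le> of_int y + 1 \<and>
      of_int (int r - y) - 1 \<le> - real_of_int x \<and> - real_of_int x \<le> of_int (int r - y)"
    by (simp add: lies_in_def up_unit_def unit_points_def U strip_heights_def)
  also have "\<dots> \<longleftrightarrow> y \<le> x \<and> x \<le> y + 1 \<and> int r - y - 1 \<le> - x \<and> - x \<le> int r - y"
    by linarith
  also have "\<dots> \<longleftrightarrow> U \<in> {(x, 0), (x - 1, 0), (x, 1)}"
    by (auto simp: U)
  finally show ?thesis .
qed

lemma lies_in_low:
  assumes "snd U \<le> n"
  shows "lies_in n (x + 1, - x - 1) (low_unit U) \<longleftrightarrow> U \<in> {(x, 0), (x - 1, 0), (x, 1)}"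
proof -
  obtain y r where U: "U = (y, r)" by (cases U)
  have "lies_in n (x + 1, - x - 1) (low_unit U) \<longleftrightarrow>
      of_int (y + 1 - int r) \<le> real_of_int (x + 1) \<and> real_of_int (x + 1) \<le> of_int (y + 1 - int r) + 1 \<and>
      of_int (- y - 1) - 1 \<le> real_of_int (- x - 1) \<and> real_of_int (- x - 1) \<le> of_int (- y - 1)"
    by (simp add: lies_in_def low_unit_def unit_points_def U strip_heights_def)
  also have "\<dots> \<longleftrightarrow> y + 1 - int r \<le> x + 1 \<and> x + 1 \<le> y + 1 - int r + 1 \<and> - y - 1 - 1 \<le> - x - 1 \<and> - x - 1 \<le> - y - 1"
    by linarith
  also have "\<dots> \<longleftrightarrow> U \<in> {(x, 0), (x - 1, 0), (x, 1)}"
    by (auto simp: U)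
  finally show ?thesis .
qed

text \<open>The units \<open>(x, 0)\<close>, \<open>(x - 1, 0)\<close> and \<open>(x, 1)\<close> are those that contain the point \<open>x\<close> of height \<open>0\<close>.\<close>

lemma class_touches:
  assumes V: "V \<in> conn_classes hex_adj (region_units n l a b)"
    and i: "1 \<le> i" "i < l" "a i 0 \<noteq> b (Suc i) 0" and x: "x = a i 0 \<or> x = b (Suc i) 0"
  shows "(\<exists>U\<in>V. U \<in> {(x, 0), (x - 1, 0), (x, 1)}) \<longleftrightarrow> (min (a i 0) (b (Suc i) 0), 0) \<in> V"
proof -
  define m M where "m = min (a i 0) (b (Suc i) 0)" and "M = max (a i 0) (b (Suc i) 0)"
  have mM: "m < M" "x = m \<or> x = M" using i x by (auto simp: m_def M_def)
  \<comment> \<open>\<open>w\<close> is the unit of the interval that has the point \<open>x\<close>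
    as its left or right vertex; it is adjacent to each of the three units that contain the
    point.\<close>
  define w where "w = (if x = m then m else M - 1)"
  have w: "m \<le> w" "w < M" "w = x \<or> w = x - 1" using mM by (auto simp: w_def)
  have wT: "(w, 0) \<in> region_units n l a b"
    using w i unfolding region_units_def between_def m_def M_def by blast
  have "(w, 0) \<in> V \<longleftrightarrow> (m, 0) \<in> V"
    using class_interval[OF V i(1,2), of 0 w] class_interval[OF V i(1,2), of 0 m] w
    by (simp add: m_def M_def)
  moreover have "(w, 0) \<in> V" if "U \<in> V" "U \<in> {(x, 0), (x - 1, 0), (x, 1)}" for U
  proof (rule class_adj[OF V that(1) wT])
    show "hex_adj U (w, 0)" using that(2) w(3) w_def mM by (auto simp: hex_adj_def split: if_splits)
  qed
  moreover have "(w, 0) \<in> {(x, 0), (x - 1, 0), (x, 1)}" using w(3) by auto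
  ultimately show ?thesis unfolding m_def by blast
qed

section \<open>Units and regions of the theorem in trail coordinates\<close>

context
  fixes n l :: nat and al be :: "nat \<Rightarrow> path" and a b :: "nat \<Rightarrow> nat \<Rightarrow> int"
  assumes al: "\<And>i r. 1 \<le> i \<Longrightarrow> i \<le> l \<Longrightarrow> r \<le> n \<Longrightarrow> pos_at (al i) (- int r) = of_int (a i r + 1) - real r / 2"
    and be: "\<And>i r. 1 \<le> i \<Longrightarrow> i \<le> l \<Longrightarrow> r \<le> n \<Longrightarrow> pos_at (be i) (int r) = of_int (b i r) - real r / 2"
    and al_end: "\<And>i. 1 \<le> i \<Longrightarrow> i \<le> l \<Longrightarrow> path_end (al i) = (a i 0 + 1, - a i 0 - 1)"
    and be_start: "\<And>i. 1 \<le> i \<Longrightarrow> i \<le> l \<Longrightarrow> fst (be i) = (b i 0, - b i 0)"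
begin

lemma alpha_eqs:
  assumes "r \<le> n" "i \<le> l"
  shows "alpha al i (- int r) = (if i = 0 then \<infinity> else ereal (of_int (a i r + 1) - real r / 2))"
    and "alpha_dual al i (int r) = (if i = 0 then \<infinity> else ereal (of_int (a i r) - real r / 2))"
  using assms al[of i r] by (auto simp: alpha_def alpha_dual_def one_ereal_def)

lemma beta_eqs:
  assumes "r \<le> n" "i \<le> l"
  shows "beta l be (i + 1) (int r) = (if i = l then - \<infinity> else ereal (of_int (b (Suc i) r) - real r / 2))"
    and "beta_dual l be (i + 1) (- int r) = (if i = l then - \<infinity> else ereal (of_int (b (Suc i) r) + 1 - real r / 2))"
  using assms be[of "Suc i" r] by (auto simp: beta_def beta_dual_def one_ereal_def)

lemma unit_hp:
  "hp (left_vertex (up_unit (x, r))) = of_int x - real r / 2"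
  "hp (right_vertex (up_unit (x, r))) = of_int x + 1 - real r / 2"
  "hp (left_vertex (low_unit (x, r))) = of_int x + 1 - real r / 2"
  "hp (right_vertex (low_unit (x, r))) = of_int x + 2 - real r / 2"
  by (simp_all add: left_vertex_def right_vertex_def up_unit_def low_unit_def hp_def field_simps)

lemma unit_fst: "fst (up_unit U) = Upper" "fst (low_unit U) = Lower"
  by (simp_all add: up_unit_def low_unit_def)

lemma real_shift_le:
  "of_int x - z \<le> of_int y - z \<longleftrightarrow> x \<le> y"
  "of_int x + 1 - z \<le> of_int y - z \<longleftrightarrow> x < y"
  "of_int (x + 1) - z \<le> of_int y + 1 - z \<longleftrightarrow> x \<le> y"
  "of_int x + 2 - z \<le> of_int y + 1 - z \<longleftrightarrow> x < y"
  "of_int y + 1 - z \<le> of_int x + 1 - z \<longleftrightarrow> y \<le> x"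
  "of_int x + 2 - z \<le> of_int (y + 1) - z \<longleftrightarrow> x < y" for x y :: int and z :: real
  by linarith+

text \<open>For \<open>i = 0\<close> and \<open>i = l\<close> one of the bounds is infinite on the
  wrong side, so only inner indices remain.\<close>

lemma I_cond_iff:
  assumes "r \<le> n" "i \<le> l"
  shows "I_cond l al be (up_unit (x, r)) i \<longleftrightarrow> 1 \<le> i \<and> i < l \<and> a i r \<le> x \<and> x < b (Suc i) r"
    and "I_cond l al be (low_unit (x, r)) i \<longleftrightarrow> 1 \<le> i \<and> i < l \<and> a i r \<le> x \<and> x < b (Suc i) r"
  using assms(2) unfolding I_cond_def Let_def up_unit_ht low_unit_ht snd_conv unit_hp unit_fst strip.case
    alpha_eqs[OF assms] beta_eqs[OF assms]
  by (auto simp: real_shift_le simp del: of_int_add split: if_splits)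

lemma II_cond_iff:
  assumes "r \<le> n" "i \<le> l"
  shows "II_cond l al be (up_unit (x, r)) i \<longleftrightarrow> (i = l \<or> b (Suc i) r \<le> x) \<and> (i = 0 \<or> x < a i r)"
    and "II_cond l al be (low_unit (x, r)) i \<longleftrightarrow> (i = l \<or> b (Suc i) r \<le> x) \<and> (i = 0 \<or> x < a i r)"
  using assms(2) unfolding II_cond_def Let_def up_unit_ht low_unit_ht snd_conv unit_hp unit_fst strip.case
    alpha_eqs[OF assms] beta_eqs[OF assms]
  by (auto simp: real_shift_le simp del: of_int_add split: if_splits)

lemma mirrored:
  assumes "\<And>x r. r \<le> n \<Longrightarrow> P (up_unit (x, r)) \<longleftrightarrow> Q x r" "\<And>x r. r \<le> n \<Longrightarrow> P (low_unit (x, r)) \<longleftrightarrow> Q x r"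
  shows "{U. is_lunit n U \<and> P U} = up_unit ` {(x, r). r \<le> n \<and> Q x r} \<union> low_unit ` {(x, r). r \<le> n \<and> Q x r}"
  using assms unfolding is_lunit_iff by (auto simp: image_iff)

lemma I_units_eq: "I_units n l al be = up_unit ` overlap_units n l a b \<union> low_unit ` overlap_units n l a b"
  unfolding I_units_def overlap_units_def by (rule mirrored) (use I_cond_iff in \<open>auto intro: less_imp_le\<close>)

lemma II_units_eq: "II_units n l al be = up_unit ` hole_units n l a b \<union> low_unit ` hole_units n l a b"
  unfolding II_units_def hole_units_def by (rule mirrored) (use II_cond_iff in auto)

lemma boundary_II_units_eq:
  assumes "\<And>i. 1 \<le> i \<Longrightarrow> i < l \<Longrightarrow> b (Suc i) n \<le> a i n"
  shows "boundary_II_units n l al be = up_unit ` boundary_units n l a b \<union> low_unit ` boundary_units n l a b"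
proof -
  have e: "boundary_units n l a b = {(x, r). r \<le> n \<and>
    (\<exists>i\<le>l. (i = l \<or> b (Suc i) r \<le> x) \<and> (i = 0 \<or> x < a i r) \<and> (i = 0 \<or> i = l \<or> r = n))}"
    by (rule boundary_units_eq) (rule assms)
  show ?thesis unfolding boundary_II_units_def e
    by (rule mirrored) (use II_cond_iff in \<open>auto simp: up_unit_ht low_unit_ht\<close>)
qed

lemma gap_eq: "1 \<le> i \<Longrightarrow> i < l \<Longrightarrow> gap al be i = of_int (a i 0 + 1 - b (Suc i) 0)"
  using al[of i 0] be[of "Suc i" 0] by (simp add: gap_def)

text \<open>The gap exceeds \<open>a i 0 - b (Suc i) 0\<close> by 1, which turns
  \<open>\<le>\<close> into \<open><\<close> and reverses parity.\<close>

lemma gap_iff: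
  assumes "1 \<le> i" "i < l"
  shows "gap al be i \<le> 0 \<longleftrightarrow> a i 0 < b (Suc i) 0" "even_gap al be i \<longleftrightarrow> odd (b (Suc i) 0 - a i 0)"
proof -
  show "gap al be i \<le> 0 \<longleftrightarrow> a i 0 < b (Suc i) 0" unfolding gap_eq[OF assms] by linarith
  have "even_gap al be i \<longleftrightarrow> even (a i 0 + 1 - b (Suc i) 0)"
    unfolding even_gap_def gap_eq[OF assms] of_int_eq_iff by auto
  also have "\<dots> \<longleftrightarrow> odd (b (Suc i) 0 - a i 0)" by presburger
  finally show "even_gap al be i \<longleftrightarrow> odd (b (Suc i) 0 - a i 0)" .
qed

text \<open>In the upper strip the end of \<beta> is tested, in the lower strip that of \<alpha>.
  Both points bound the same interval, so both tests ask whether this interval lies in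
  \<open>V\<close>.\<close>

lemma intersects0_iff:
  assumes i: "1 \<le> i" "i < l" "odd (b (Suc i) 0 - a i 0)"
    and V: "V \<in> conn_classes hex_adj (region_units n l a b)"
  shows "intersects0 n al be i (up_unit ` V) \<longleftrightarrow> (min (a i 0) (b (Suc i) 0), 0) \<in> V"
    and "intersects0 n al be i (low_unit ` V) \<longleftrightarrow> (min (a i 0) (b (Suc i) 0), 0) \<in> V"
proof -
  have Vn: "snd U \<le> n" if "U \<in> V" for U
    using class_subset[OF V] that by (auto simp: region_units_def)
  have ne: "a i 0 \<noteq> b (Suc i) 0" using i(3) by auto
  have "intersects0 n al be i (up_unit ` V) \<longleftrightarrow> (\<exists>U\<in>V. U \<in> {(b (Suc i) 0, 0), (b (Suc i) 0 - 1, 0), (b (Suc i) 0, 1)})"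
    unfolding intersects0_def using i be_start[of "Suc i"] lies_in_up[of _ n "b (Suc i) 0"] Vn
    by (simp add: unit_fst)
  then show "intersects0 n al be i (up_unit ` V) \<longleftrightarrow> (min (a i 0) (b (Suc i) 0), 0) \<in> V"
    using class_touches[OF V i(1,2) ne] by simp
  have "intersects0 n al be i (low_unit ` V) \<longleftrightarrow> (\<exists>U\<in>V. U \<in> {(a i 0, 0), (a i 0 - 1, 0), (a i 0, 1)})"
    unfolding intersects0_def using i al_end[of i] lies_in_low[of _ n "a i 0"] Vn
    by (simp add: unit_fst)
  then show "intersects0 n al be i (low_unit ` V) \<longleftrightarrow> (min (a i 0) (b (Suc i) 0), 0) \<in> V"
    using class_touches[OF V i(1,2) ne] by simp
qed

context
  fixes s t :: "nat \<Rightarrow> int"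
  assumes c: "config n l s t a b"
    and s: "\<And>i j. 1 \<le> i \<Longrightarrow> i < j \<Longrightarrow> j \<le> l \<Longrightarrow> s j < s i"
    and t: "\<And>i j. 1 \<le> i \<Longrightarrow> i < j \<Longrightarrow> j \<le> l \<Longrightarrow> t j < t i"
    and pos: "\<And>i. 1 \<le> i \<Longrightarrow> i < l \<Longrightarrow> t (Suc i) \<le> s i"
begin

lemma top: "1 \<le> i \<Longrightarrow> i < l \<Longrightarrow> b (Suc i) n \<le> a i n"
  using c pos by (auto simp: config_def families_def trails_def PiE_iff)

lemma disjoint_units: "overlap_units n l a b \<inter> hole_units n l a b = {}"
  by (rule overlap_hole_disjoint[OF c s t])

lemma split_classes: "conn_classes hex_adj (region_units n l a b) =
    conn_classes hex_adj (overlap_units n l a b) \<union> conn_classes hex_adj (hole_units n l a b)"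
  by (rule region_classes[OF c s t])

text \<open>The sign of the gap is automatic: the leftmost unit of the interval lies in an overlap
  component, so it cannot be a hole.\<close>

lemma odd_runs_overlap:
  assumes V: "V \<in> conn_classes hex_adj (overlap_units n l a b)" and f: "f = up_unit \<or> f = low_unit"
  shows "{i. 1 \<le> i \<and> i < l \<and> gap al be i \<le> 0 \<and> even_gap al be i \<and> intersects0 n al be i (f ` V)} =
    odd_runs l a b V"
proof -
  have V': "V \<in> conn_classes hex_adj (region_units n l a b)" using V split_classes by blast
  have "gap al be i \<le> 0 \<and> even_gap al be i \<and> intersects0 n al be i (f ` V) \<longleftrightarrow>
    odd (b (Suc i) 0 - a i 0) \<and> (min (a i 0) (b (Suc i) 0), 0) \<in> V" if i: "1 \<le> i" "i < l" for i
  proof -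
    have "a i 0 < b (Suc i) 0" if "odd (b (Suc i) 0 - a i 0)" "(min (a i 0) (b (Suc i) 0), 0) \<in> V"
    proof (rule ccontr)
      assume "\<not> a i 0 < b (Suc i) 0"
      moreover have "a i 0 \<noteq> b (Suc i) 0" using that by auto
      ultimately have lt: "b (Suc i) 0 < a i 0" by simp
      then have "(b (Suc i) 0, 0) \<in> hole_units n l a b"
        using i by (auto simp: hole_units_def intro!: exI[of _ i])
      moreover have "(b (Suc i) 0, 0) \<in> overlap_units n l a b"
        using that(2) lt class_subset[OF V] by (auto simp: min_def split: if_splits)
      ultimately show False using disjoint_units by blast
    qed
    then show ?thesis using gap_iff[OF i] intersects0_iff[OF i _ V'] f by blast
  qed
  then show ?thesis unfolding odd_runs_def by blast
qed

lemma odd_runs_hole: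
  assumes V: "V \<in> conn_classes hex_adj (hole_units n l a b)" and f: "f = up_unit \<or> f = low_unit"
  shows "{i. 1 \<le> i \<and> i < l \<and> gap al be i > 0 \<and> even_gap al be i \<and> intersects0 n al be i (f ` V)} =
    odd_runs l a b V"
proof -
  have V': "V \<in> conn_classes hex_adj (region_units n l a b)" using V split_classes by blast
  have "gap al be i > 0 \<and> even_gap al be i \<and> intersects0 n al be i (f ` V) \<longleftrightarrow>
    odd (b (Suc i) 0 - a i 0) \<and> (min (a i 0) (b (Suc i) 0), 0) \<in> V" if i: "1 \<le> i" "i < l" for i
  proof -
    have "\<not> a i 0 < b (Suc i) 0" if "odd (b (Suc i) 0 - a i 0)" "(min (a i 0) (b (Suc i) 0), 0) \<in> V"
    proof
      assume lt: "a i 0 < b (Suc i) 0"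
      then have "(a i 0, 0) \<in> overlap_units n l a b"
        using i by (auto simp: overlap_units_def intro!: exI[of _ i])
      moreover have "(a i 0, 0) \<in> hole_units n l a b"
        using that(2) lt class_subset[OF V] by (auto simp: min_def split: if_splits)
      ultimately show False using disjoint_units by blast
    qed
    then show ?thesis using gap_iff[OF i] intersects0_iff[OF i _ V'] f not_less by blast
  qed
  then show ?thesis unfolding odd_runs_def by blast
qed

lemma mirrored_disjoint:
  assumes "f = up_unit \<or> f = low_unit"
  shows "f ` V \<inter> (up_unit ` S \<union> low_unit ` S) = {} \<longleftrightarrow> V \<inter> S = {}"
proof -
  have "f U \<in> up_unit ` S \<union> low_unit ` S \<longleftrightarrow> U \<in> S" for U
  proof -
    have "up_unit U \<notin> low_unit ` S" "low_unit U \<notin> up_unit ` S"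
      using up_ne_low by (metis imageE)+
    then show ?thesis
      using assms inj_image_mem_iff[OF inj_up_unit, of U S] inj_image_mem_iff[OF inj_low_unit, of U S]
      by (metis Un_iff)
  qed
  then show ?thesis by blast
qed

lemma unit_ht_zero: "f = up_unit \<or> f = low_unit \<Longrightarrow> (\<exists>U\<in>f ` V. unit_ht U = 0) \<longleftrightarrow> (\<exists>x. (x, 0) \<in> V)"
  by (auto simp: up_unit_ht low_unit_ht) force+

text \<open>Every odd component occurs twice, once in each strip, which does not affect existence.
  For I-components the condition about boundary units holds automatically, because boundary units
  are holes.\<close>

lemma odd_region_iff:
  "(\<exists>V. odd_I_region n l al be V \<or> odd_II_region n l al be V) \<longleftrightarrow> (\<exists>C. odd_region n l a b C)"
proof -
  let ?I = "overlap_units n l a b" and ?H = "hole_units n l a b" and ?B = "boundary_units n l a b"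
  have le: "\<And>U. U \<in> ?I \<Longrightarrow> snd U \<le> n" "\<And>U. U \<in> ?H \<Longrightarrow> snd U \<le> n"
    by (auto simp: overlap_units_def hole_units_def)
  have bII: "boundary_II_units n l al be = up_unit ` ?B \<union> low_unit ` ?B"
    by (rule boundary_II_units_eq) (rule top)
  have bh: "?B \<subseteq> ?H" by (subst boundary_units_eq) (use top in \<open>auto simp: hole_units_def\<close>)
  have e1: "components n (up_unit ` ?I \<union> low_unit ` ?I) =
      (`) up_unit ` conn_classes hex_adj ?I \<union> (`) low_unit ` conn_classes hex_adj ?I"
    by (rule components_mirrored) (rule le(1))
  have cI: "V \<in> components n (I_units n l al be) \<longleftrightarrow>
      (\<exists>C f. C \<in> conn_classes hex_adj ?I \<and> (f = up_unit \<or> f = low_unit) \<and> V = f ` C)" for V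
    unfolding I_units_eq e1 by blast
  have e2: "components n (up_unit ` ?H \<union> low_unit ` ?H) =
      (`) up_unit ` conn_classes hex_adj ?H \<union> (`) low_unit ` conn_classes hex_adj ?H"
    by (rule components_mirrored) (rule le(2))
  have cH: "V \<in> components n (II_units n l al be) \<longleftrightarrow>
      (\<exists>C f. C \<in> conn_classes hex_adj ?H \<and> (f = up_unit \<or> f = low_unit) \<and> V = f ` C)" for V
    unfolding II_units_eq e2 by blast
  have I: "odd_I_region n l al be V \<longleftrightarrow> (\<exists>C f. C \<in> conn_classes hex_adj ?I \<and>
      (f = up_unit \<or> f = low_unit) \<and> V = f ` C \<and> (\<exists>x. (x, 0) \<in> C) \<and> odd (card (odd_runs l a b C)))" for V
  proof -
    have key: "(\<exists>U\<in>V. unit_ht U = 0) \<and> odd (card {i. 1 \<le> i \<and> i < l \<and>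
        gap al be i \<le> 0 \<and> even_gap al be i \<and> intersects0 n al be i V}) \<longleftrightarrow>
      (\<exists>x. (x, 0) \<in> C) \<and> odd (card (odd_runs l a b C))"
      if "C \<in> conn_classes hex_adj ?I" "f = up_unit \<or> f = low_unit" "V = f ` C" for C f
      unfolding that(3) odd_runs_overlap[OF that(1,2)] unit_ht_zero[OF that(2)] ..
    have "odd_I_region n l al be V \<longleftrightarrow> V \<in> components n (I_units n l al be) \<and> ((\<exists>U\<in>V. unit_ht U = 0) \<and> odd (card {i. 1 \<le> i \<and> i < l \<and>
        gap al be i \<le> 0 \<and> even_gap al be i \<and> intersects0 n al be i V}))"
      unfolding odd_I_region_def I_regions_def mem_Collect_eq by (simp only: conj_assoc)
    also have "\<dots> \<longleftrightarrow> (\<exists>C f. (C \<in> conn_classes hex_adj ?I \<and> (f = up_unit \<or> f = low_unit) \<and> V = f ` C) \<and> ((\<exists>U\<in>V. unit_ht U = 0) \<and> odd (card {i. 1 \<le> i \<and> i < l \<and>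
        gap al be i \<le> 0 \<and> even_gap al be i \<and> intersects0 n al be i V})))"
      unfolding cI by (simp only: ex_simps)
    also have "\<dots> \<longleftrightarrow> (\<exists>C f. (C \<in> conn_classes hex_adj ?I \<and> (f = up_unit \<or> f = low_unit) \<and> V = f ` C) \<and> ((\<exists>x. (x, 0) \<in> C) \<and> odd (card (odd_runs l a b C))))"
      by (intro ex_cong1 conj_cong HOL.refl key) auto
    finally show ?thesis by (simp only: conj_assoc)
  qed
  have H: "odd_II_region n l al be V \<longleftrightarrow> (\<exists>C f. C \<in> conn_classes hex_adj ?H \<and>
      (f = up_unit \<or> f = low_unit) \<and> V = f ` C \<and> (\<exists>x. (x, 0) \<in> C) \<and> C \<inter> ?B = {} \<and> odd (card (odd_runs l a b C)))" for V
  proof -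
    have key: "((\<exists>U\<in>V. unit_ht U = 0) \<and> V \<inter> boundary_II_units n l al be = {}) \<and> odd (card {i. 1 \<le> i \<and> i < l \<and>
        gap al be i > 0 \<and> even_gap al be i \<and> intersects0 n al be i V}) \<longleftrightarrow>
      (\<exists>x. (x, 0) \<in> C) \<and> C \<inter> ?B = {} \<and> odd (card (odd_runs l a b C))"
      if "C \<in> conn_classes hex_adj ?H" "f = up_unit \<or> f = low_unit" "V = f ` C" for C f
      unfolding that(3) odd_runs_hole[OF that(1,2)] unit_ht_zero[OF that(2)] bII mirrored_disjoint[OF that(2)]
      by (rule conj_assoc)
    have "odd_II_region n l al be V \<longleftrightarrow> V \<in> components n (II_units n l al be) \<and> (((\<exists>U\<in>V. unit_ht U = 0) \<and> V \<inter> boundary_II_units n l al be = {}) \<and> odd (card {i. 1 \<le> i \<and> i < l \<and>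
        gap al be i > 0 \<and> even_gap al be i \<and> intersects0 n al be i V}))"
      unfolding odd_II_region_def II_regions_def mem_Collect_eq by (simp only: conj_assoc)
    also have "\<dots> \<longleftrightarrow> (\<exists>C f. (C \<in> conn_classes hex_adj ?H \<and> (f = up_unit \<or> f = low_unit) \<and> V = f ` C) \<and> (((\<exists>U\<in>V. unit_ht U = 0) \<and> V \<inter> boundary_II_units n l al be = {}) \<and> odd (card {i. 1 \<le> i \<and> i < l \<and>
        gap al be i > 0 \<and> even_gap al be i \<and> intersects0 n al be i V})))"
      unfolding cH by (simp only: ex_simps)
    also have "\<dots> \<longleftrightarrow> (\<exists>C f. (C \<in> conn_classes hex_adj ?H \<and> (f = up_unit \<or> f = low_unit) \<and> V = f ` C) \<and> ((\<exists>x. (x, 0) \<in> C) \<and> C \<inter> ?B = {} \<and> odd (card (odd_runs l a b C))))"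
      by (intro ex_cong1 conj_cong HOL.refl key) auto
    finally show ?thesis by (simp only: conj_assoc)
  qed
  have "C \<inter> ?B = {}" if "C \<in> conn_classes hex_adj ?I" for C
    using class_subset[OF that] bh disjoint_units by blast
  then have "(\<exists>C. odd_region n l a b C) \<longleftrightarrow>
    (\<exists>C. C \<in> conn_classes hex_adj ?I \<and> (\<exists>x. (x, 0) \<in> C) \<and> odd (card (odd_runs l a b C))) \<or>
    (\<exists>C. C \<in> conn_classes hex_adj ?H \<and> (\<exists>x. (x, 0) \<in> C) \<and> C \<inter> ?B = {} \<and> odd (card (odd_runs l a b C)))"
    unfolding odd_region_def split_classes by blast
  then show ?thesis unfolding I H by blast
qed

end

end

section \<open>The determinant as a signed sum over trail families\<close>

text \<open>Column \<open>j\<close> belongs to the start u_j, so expanding with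
  \<open>\<sigma>\<close> on the row index makes \<open>\<sigma> j\<close> the index of the
  end.\<close>

lemma det_permutes_Suc:
  fixes f :: "nat \<Rightarrow> nat \<Rightarrow> 'a::comm_ring_1"
  shows "Determinant.det (mat l l (\<lambda>(i, j). f (Suc i) (Suc j))) =
    (\<Sum>\<sigma> | \<sigma> permutes {1..l}. of_int (sign \<sigma>) * (\<Prod>j\<in>{1..l}. f (\<sigma> j) j))"
proof -
  let ?A = "{0..<l}" and ?B = "{1..l}"
  let ?M = "map_permutation ?A Suc" and ?W = "map_permutation ?B (\<lambda>i. i - 1)"
  have bij: "bij_betw Suc ?A ?B" by (rule bij_betw_imageI) (auto simp: image_Suc_atLeastLessThan)
  have bij': "bij_betw (\<lambda>i. i - 1) ?B ?A"
    by (rule bij_betw_byWitness[where f' = Suc]) auto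
  have "Determinant.det (mat l l (\<lambda>(i, j). f (Suc i) (Suc j))) =
    (\<Sum>p | p permutes ?A. of_int (sign p) * (\<Prod>j<l. mat l l (\<lambda>(i, j). f (Suc i) (Suc j)) $$ (p j, j)))"
    by (rule det_col) simp
  also have "\<dots> = (\<Sum>\<sigma> | \<sigma> permutes ?B. of_int (sign \<sigma>) * (\<Prod>j\<in>?B. f (\<sigma> j) j))"
  proof (rule sum.reindex_bij_witness[where i = ?W and j = ?M])
    fix p assume "p \<in> {p. p permutes ?A}"
    then have p: "p permutes ?A" by simp
    show "?M p \<in> {\<sigma>. \<sigma> permutes ?B}" using map_permutation_permutes[OF bij p] by simp
    show "?W (?M p) = p" by (rule map_permutation_compose_inv[OF bij p]) simp
    have s: "sign (?M p) = sign p" by (rule sign_map_permutation) (use p in auto)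
    have "(\<Prod>j\<in>?B. f (?M p j) j) = (\<Prod>j\<in>?A. f (?M p (Suc j)) (Suc j))"
      using prod.reindex_bij_betw[OF bij, of "\<lambda>j. f (?M p j) j"] by simp
    also have "\<dots> = (\<Prod>j\<in>?A. f (Suc (p j)) (Suc j))"
      by (rule prod.cong) (simp_all add: map_permutation_apply)
    also have "\<dots> = (\<Prod>j<l. mat l l (\<lambda>(i, j). f (Suc i) (Suc j)) $$ (p j, j))"
    proof (rule prod.cong)
      fix j assume "j \<in> {..<l}"
      then have "p j < l" "j < l" using permutes_in_image[OF p, of j] by auto
      then show "f (Suc (p j)) (Suc j) = mat l l (\<lambda>(i, j). f (Suc i) (Suc j)) $$ (p j, j)" by simp
    qed auto
    finally show "of_int (sign (?M p)) * (\<Prod>j\<in>?B. f (?M p j) j) =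
      of_int (sign p) * (\<Prod>j<l. mat l l (\<lambda>(i, j). f (Suc i) (Suc j)) $$ (p j, j))" by (simp only: s)
  next
    fix p assume "p \<in> {\<sigma>. \<sigma> permutes ?B}"
    then have p: "p permutes ?B" by simp
    show "?W p \<in> {p. p permutes ?A}" using map_permutation_permutes[OF bij' p] by simp
    show "?M (?W p) = p" by (rule map_permutation_compose_inv[OF bij' p]) simp
  qed
  finally show ?thesis .
qed

text \<open>The dual coordinate of u_i at row \<open>n\<close>, as \<open>up_top\<close> is the
  x-coordinate of v_i.\<close>

definition low_top :: "nat \<Rightarrow> (nat \<Rightarrow> nat) \<Rightarrow> nat \<Rightarrow> int" where
  "low_top n mu i = int (conj_part mu i) - int i + int n"

definition up_top :: "(nat \<Rightarrow> nat) \<Rightarrow> nat \<Rightarrow> int" where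
  "up_top lam i = int (conj_part lam i) + 1 - int i"

lemma chi_entry_trails:
  fixes Fa Fb :: "nat \<Rightarrow> int \<Rightarrow> 'n zring"
  assumes F: "\<And>c d s t. c \<in> trails CARD('n) s \<Longrightarrow> d \<in> trails CARD('n) t \<Longrightarrow>
      (\<Prod>r<CARD('n). low_step CARD('n) a r (c r) (c (Suc r))) * E_run a (c 0 + 1) (d 0) *
      (\<Prod>r<CARD('n). up_step CARD('n) a r (d r) (d (Suc r))) =
      (if c 0 < d 0 \<and> odd (d 0 - c 0)
       then (\<Prod>r\<le>CARD('n). Fa r (c r)) * (\<Prod>r\<le>CARD('n). Fb r (d r)) else 0)"
  shows "chi_entry lam mu a i j =
    (\<Sum>c\<in>trails CARD('n) (low_top CARD('n) mu j). \<Sum>d\<in>trails CARD('n) (up_top lam i).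
      if c 0 < d 0 \<and> odd (d 0 - c 0)
      then (\<Prod>r\<le>CARD('n). Fa r (c r)) * (\<Prod>r\<le>CARD('n). Fb r (d r)) else 0)"
proof -
  define x0 where "x0 = int (conj_part mu j) + 1 - int j"
  have 1: "int (conj_part lam i) - int (conj_part mu j) - int i + int j = up_top lam i - x0"
    by (simp add: up_top_def x0_def)
  have 2: "a - 2 * (of_nat (conj_part mu j) - of_nat j + 1) = a - 2 * of_int x0"
    by (simp add: x0_def algebra_simps)
  have 3: "low_top CARD('n) mu j = x0 + int CARD('n) - 1" by (simp add: low_top_def x0_def)
  show ?thesis unfolding chi_entry_def 1 2 3 e_coeff_trails
    by (intro sum.cong HOL.refl F)
qed

section \<open>Sums over matchings are alternating in both families\<close>

lemma matching_compose:
  assumes "\<tau> permutes {1..l}"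
  shows "matching l (a \<circ> \<tau>) b (\<sigma> \<circ> \<tau>) \<longleftrightarrow> matching l a b \<sigma>"
proof -
  have "\<sigma> \<circ> \<tau> permutes {1..l} \<longleftrightarrow> \<sigma> permutes {1..l}"
  proof
    assume "\<sigma> \<circ> \<tau> permutes {1..l}"
    then have "(\<sigma> \<circ> \<tau>) \<circ> inv_into UNIV \<tau> permutes {1..l}" by (rule permutes_compose[OF permutes_inv[OF assms]])
    then show "\<sigma> permutes {1..l}" by (simp add: o_assoc[symmetric] permutes_inv_o[OF assms])
  qed (rule permutes_compose[OF assms])
  moreover have "(\<forall>i\<in>{1..l}. (a \<circ> \<tau>) i < b ((\<sigma> \<circ> \<tau>) i) \<and> odd (b ((\<sigma> \<circ> \<tau>) i) - (a \<circ> \<tau>) i)) \<longleftrightarrow>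
      (\<forall>i\<in>\<tau> ` {1..l}. a i < b (\<sigma> i) \<and> odd (b (\<sigma> i) - a i))" by simp
  ultimately show ?thesis unfolding matching_def permutes_image[OF assms] by simp
qed

lemma matching_compose':
  assumes "\<tau> permutes {1..l}" "\<And>i. \<tau> (\<tau> i) = i"
  shows "matching l a (b \<circ> \<tau>) \<sigma> \<longleftrightarrow> matching l a b (\<tau> \<circ> \<sigma>)"
proof -
  have "\<tau> \<circ> (\<tau> \<circ> \<sigma>) = \<sigma>" using assms(2) by (auto simp: fun_eq_iff)
  then have "\<tau> \<circ> \<sigma> permutes {1..l} \<longleftrightarrow> \<sigma> permutes {1..l}"
    using permutes_compose[OF _ assms(1), of "\<tau> \<circ> \<sigma>"] permutes_compose[OF _ assms(1), of \<sigma>] by auto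
  then show ?thesis unfolding matching_def by simp
qed

text \<open>The E-runs summed out. What remains depends on the positions at height 0 and is
  alternating in \<open>a\<close> and in \<open>b\<close>, so tails may be exchanged in either
  family alone.\<close>

definition matching_sum :: "nat \<Rightarrow> (nat \<Rightarrow> int) \<Rightarrow> (nat \<Rightarrow> int) \<Rightarrow> int" where
  "matching_sum l a b = (\<Sum>\<sigma> | matching l a b \<sigma>. sign \<sigma>)"

lemma sign_transpose_compose:
  assumes "matching l a b \<sigma>" "i \<noteq> j"
  shows "sign (\<sigma> \<circ> transpose i j) = - sign \<sigma>" "sign (transpose i j \<circ> \<sigma>) = - sign \<sigma>"
proof -
  have "permutation \<sigma>" using assms(1) permutes_imp_permutation[of "{1..l}" \<sigma>] by (auto simp: matching_def)
  then show "sign (\<sigma> \<circ> transpose i j) = - sign \<sigma>" "sign (transpose i j \<circ> \<sigma>) = - sign \<sigma>"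
    using assms(2) by (simp_all add: sign_compose permutation_swap_id sign_swap_id)
qed

lemma matching_sum_alternating:
  assumes ij: "i \<in> {1..l}" "j \<in> {1..l}" "i \<noteq> j"
  shows "matching_sum l (a \<circ> transpose i j) b = - matching_sum l a b"
    and "matching_sum l a (b \<circ> transpose i j) = - matching_sum l a b"
proof -
  let ?t = "transpose i j"
  have t: "?t permutes {1..l}" using ij by (intro permutes_swap_id)
  have o: "(\<sigma> \<circ> ?t) \<circ> ?t = \<sigma>" "?t \<circ> (?t \<circ> \<sigma>) = \<sigma>" for \<sigma> :: "nat \<Rightarrow> nat"
    by (auto simp: fun_eq_iff)
  have "matching_sum l (a \<circ> ?t) b = (\<Sum>\<sigma> | matching l a b \<sigma>. sign (\<sigma> \<circ> ?t))"
    unfolding matching_sum_def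
    by (rule sum.reindex_bij_witness[where i = "\<lambda>\<sigma>. \<sigma> \<circ> ?t" and j = "\<lambda>\<sigma>. \<sigma> \<circ> ?t"])
      (use matching_compose[OF t] o in \<open>auto simp del: o_apply\<close>, metis o(1))
  then show "matching_sum l (a \<circ> ?t) b = - matching_sum l a b"
    using sign_transpose_compose(1) ij(3) by (simp add: matching_sum_def sum_negf)
  have "matching_sum l a (b \<circ> ?t) = (\<Sum>\<sigma> | matching l a b \<sigma>. sign (?t \<circ> \<sigma>))"
    unfolding matching_sum_def
    by (rule sum.reindex_bij_witness[where i = "\<lambda>\<sigma>. ?t \<circ> \<sigma>" and j = "\<lambda>\<sigma>. ?t \<circ> \<sigma>"])
      (use matching_compose'[OF t] o in \<open>auto simp del: o_apply\<close>)
  then show "matching_sum l a (b \<circ> ?t) = - matching_sum l a b"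
    using sign_transpose_compose(2) ij(3) by (simp add: matching_sum_def sum_negf)
qed

text \<open>The alternating property gives twice the sum equal to 0, which suffices because the sum
  is an integer.\<close>

lemma matching_sum_repeated:
  assumes ij: "i \<in> {1..l}" "j \<in> {1..l}" "i \<noteq> j"
  shows "a i = a j \<Longrightarrow> matching_sum l a b = 0" and "b i = b j \<Longrightarrow> matching_sum l a b = 0"
proof -
  assume "a i = a j"
  then have "a \<circ> transpose i j = a" by (auto simp: fun_eq_iff transpose_def)
  then show "matching_sum l a b = 0" using matching_sum_alternating(1)[OF ij, of a b] by simp
next
  assume "b i = b j"
  then have "b \<circ> transpose i j = b" by (auto simp: fun_eq_iff transpose_def)
  then show "matching_sum l a b = 0" using matching_sum_alternating(2)[OF ij, of a b] by simp
qed

text \<open>The upper family is reindexed so that its member j ends at \<open>t j\<close>. The range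
  of summation then does not involve \<open>\<sigma>\<close>, and the sum over
  \<open>\<sigma>\<close> can be taken first.\<close>

lemma signed_families_sum:
  fixes Fa Fb :: "nat \<Rightarrow> int \<Rightarrow> 'a::comm_ring_1" and s t :: "nat \<Rightarrow> int" and n l :: nat
  defines "G \<equiv> \<lambda>c d. if c 0 < d 0 \<and> odd (d 0 - c 0)
      then (\<Prod>r\<le>n. Fa r (c r)) * (\<Prod>r\<le>n. Fb r (d r)) else 0"
  shows "(\<Sum>\<sigma> | \<sigma> permutes {1..l}. of_int (sign \<sigma>) *
      (\<Prod>j\<in>{1..l}. \<Sum>c\<in>trails n (s j). \<Sum>d\<in>trails n (t (\<sigma> j)). G c d)) =
    (\<Sum>c\<in>families n l s. \<Sum>d\<in>families n l t.
      (\<Prod>j\<in>{1..l}. \<Prod>r\<le>n. Fa r (c j r)) * (\<Prod>j\<in>{1..l}. \<Prod>r\<le>n. Fb r (d j r)) *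
      of_int (matching_sum l (\<lambda>j. c j 0) (\<lambda>j. d j 0)))"
proof -
  let ?I = "{1..l}" and ?P = "{\<sigma>. \<sigma> permutes {1..l}}"
  let ?A = "\<lambda>c. \<Prod>j\<in>?I. \<Prod>r\<le>n. Fa r (c j r)" and ?B = "\<lambda>d. \<Prod>j\<in>?I. \<Prod>r\<le>n. Fb r (d j r)"
  have finP: "finite ?P" by (rule finite_permutations) simp
  have prod_G: "(\<Prod>j\<in>?I. G (c j) (d (\<sigma> j))) =
      (if matching l (\<lambda>j. c j 0) (\<lambda>j. d j 0) \<sigma> then ?A c * ?B d else 0)"
    if \<sigma>: "\<sigma> permutes ?I" for \<sigma> and c d :: "nat \<Rightarrow> nat \<Rightarrow> int"
  proof (cases "\<forall>j\<in>?I. c j 0 < d (\<sigma> j) 0 \<and> odd (d (\<sigma> j) 0 - c j 0)")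
    case True
    then have "(\<Prod>j\<in>?I. G (c j) (d (\<sigma> j))) = (\<Prod>j\<in>?I. (\<Prod>r\<le>n. Fa r (c j r)) * (\<Prod>r\<le>n. Fb r (d (\<sigma> j) r)))"
      by (intro prod.cong) (auto simp: G_def)
    also have "\<dots> = ?A c * (\<Prod>j\<in>?I. (\<Prod>r\<le>n. Fb r (d (\<sigma> j) r)))" by (rule prod.distrib)
    also have "(\<Prod>j\<in>?I. (\<Prod>r\<le>n. Fb r (d (\<sigma> j) r))) = ?B d"
      using prod.permute[OF \<sigma>, of "\<lambda>j. \<Prod>r\<le>n. Fb r (d j r)"] by (simp add: comp_def)
    finally show ?thesis using True \<sigma> by (simp add: matching_def)
  next
    case False
    then obtain j where "j \<in> ?I" "G (c j) (d (\<sigma> j)) = 0" by (auto simp: G_def)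
    then have "(\<Prod>j\<in>?I. G (c j) (d (\<sigma> j))) = 0" by (intro prod_zero) auto
    moreover have "\<not> matching l (\<lambda>j. c j 0) (\<lambda>j. d j 0) \<sigma>" using False by (auto simp: matching_def)
    ultimately show ?thesis by simp
  qed
  have expand: "(\<Prod>j\<in>?I. \<Sum>c\<in>trails n (s j). \<Sum>d\<in>trails n (t (\<sigma> j)). G c d) =
      (\<Sum>c\<in>families n l s. \<Sum>d\<in>families n l t. \<Prod>j\<in>?I. G (c j) (d (\<sigma> j)))"
    if \<sigma>: "\<sigma> permutes ?I" for \<sigma>
  proof -
    have "(\<Prod>j\<in>?I. \<Sum>c\<in>trails n (s j). \<Sum>d\<in>trails n (t (\<sigma> j)). G c d) =
      (\<Sum>c\<in>families n l s. \<Prod>j\<in>?I. \<Sum>d\<in>trails n (t (\<sigma> j)). G (c j) d)"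
      unfolding families_def by (rule prod_sum_PiE) (auto intro: finite_trails)
    also have "\<dots> = (\<Sum>c\<in>families n l s. \<Sum>d\<in>families n l t. \<Prod>j\<in>?I. G (c j) (d (\<sigma> j)))"
    proof (rule sum.cong[OF HOL.refl])
      fix c :: "nat \<Rightarrow> nat \<Rightarrow> int"
      \<comment> \<open>The sums over \<open>d\<close> are relabelled by the inverse permutation to
        expand over \<open>families n l t\<close>, then the members are relabelled back.\<close>
      let ?i = "inv_into UNIV \<sigma>"
      have i: "?i permutes ?I" by (rule permutes_inv[OF \<sigma>])
      have "(\<Prod>j\<in>?I. \<Sum>d\<in>trails n (t (\<sigma> j)). G (c j) d) =
          (\<Prod>j\<in>?I. \<Sum>d\<in>trails n (t j). G (c (?i j)) d)"
        using prod.permute[OF i, of "\<lambda>j. \<Sum>d\<in>trails n (t (\<sigma> j)). G (c j) d"]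
        by (simp add: comp_def permutes_inverses[OF \<sigma>])
      also have "\<dots> = (\<Sum>d\<in>families n l t. \<Prod>j\<in>?I. G (c (?i j)) (d j))"
        unfolding families_def by (rule prod_sum_PiE) (auto intro: finite_trails)
      also have "\<dots> = (\<Sum>d\<in>families n l t. \<Prod>j\<in>?I. G (c j) (d (\<sigma> j)))"
      proof (rule sum.cong[OF HOL.refl])
        fix d :: "nat \<Rightarrow> nat \<Rightarrow> int"
        show "(\<Prod>j\<in>?I. G (c (?i j)) (d j)) = (\<Prod>j\<in>?I. G (c j) (d (\<sigma> j)))"
          using prod.permute[OF \<sigma>, of "\<lambda>j. G (c (?i j)) (d j)"]
          by (simp add: comp_def permutes_inverses[OF \<sigma>])
      qed
      finally show "(\<Prod>j\<in>?I. \<Sum>d\<in>trails n (t (\<sigma> j)). G (c j) d) =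
          (\<Sum>d\<in>families n l t. \<Prod>j\<in>?I. G (c j) (d (\<sigma> j)))" .
    qed
    finally show ?thesis .
  qed
  have "(\<Sum>\<sigma>\<in>?P. of_int (sign \<sigma>) * (\<Prod>j\<in>?I. \<Sum>c\<in>trails n (s j). \<Sum>d\<in>trails n (t (\<sigma> j)). G c d)) =
    (\<Sum>\<sigma>\<in>?P. \<Sum>c\<in>families n l s. \<Sum>d\<in>families n l t. of_int (sign \<sigma>) * (\<Prod>j\<in>?I. G (c j) (d (\<sigma> j))))"
    by (intro sum.cong HOL.refl) (simp only: mem_Collect_eq expand sum_distrib_left)
  also have "\<dots> = (\<Sum>c\<in>families n l s. \<Sum>d\<in>families n l t. \<Sum>\<sigma>\<in>?P. of_int (sign \<sigma>) * (\<Prod>j\<in>?I. G (c j) (d (\<sigma> j))))"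
    by (subst sum.swap) (intro sum.cong HOL.refl sum.swap)
  also have "\<dots> = (\<Sum>c\<in>families n l s. \<Sum>d\<in>families n l t. ?A c * ?B d *
      of_int (matching_sum l (\<lambda>j. c j 0) (\<lambda>j. d j 0)))"
  proof (intro sum.cong HOL.refl)
    fix c d :: "nat \<Rightarrow> nat \<Rightarrow> int"
    let ?m = "matching l (\<lambda>j. c j 0) (\<lambda>j. d j 0)"
    have "(\<Sum>\<sigma>\<in>?P. of_int (sign \<sigma>) * (\<Prod>j\<in>?I. G (c j) (d (\<sigma> j)))) =
      (\<Sum>\<sigma>\<in>?P. if ?m \<sigma> then ?A c * ?B d * of_int (sign \<sigma>) else 0)"
    proof (rule sum.cong[OF HOL.refl])
      fix \<sigma> assume "\<sigma> \<in> ?P"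
      then have \<sigma>: "\<sigma> permutes ?I" by simp
      show "of_int (sign \<sigma>) * (\<Prod>j\<in>?I. G (c j) (d (\<sigma> j))) =
          (if ?m \<sigma> then ?A c * ?B d * of_int (sign \<sigma>) else 0)"
        unfolding prod_G[OF \<sigma>] by (cases "?m \<sigma>") (simp_all add: mult.commute)
    qed
    also have "\<dots> = (\<Sum>\<sigma>\<in>{\<sigma>\<in>?P. ?m \<sigma>}. ?A c * ?B d * of_int (sign \<sigma>))"
      by (rule sum.inter_filter[OF finP, symmetric])
    also have "{\<sigma>\<in>?P. ?m \<sigma>} = {\<sigma>. ?m \<sigma>}" by (auto simp: matching_def)
    finally show "(\<Sum>\<sigma>\<in>?P. of_int (sign \<sigma>) * (\<Prod>j\<in>?I. G (c j) (d (\<sigma> j)))) = ?A c * ?B d *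
      of_int (matching_sum l (\<lambda>j. c j 0) (\<lambda>j. d j 0))"
      by (simp add: matching_sum_def sum_distrib_left)
  qed
  finally show ?thesis .
qed

text \<open>Cancellation takes place in the upper family for each fixed lower one, and then in the
  lower family with the restricted sum as alternating function. For the disjoint families left over,
  the rows at height 0 are strictly decreasing and the dichotomy applies.\<close>

lemma signed_families_config:
  fixes Fa Fb :: "nat \<Rightarrow> int \<Rightarrow> 'a::comm_ring_1"
  assumes s: "\<And>i j. 1 \<le> i \<Longrightarrow> i < j \<Longrightarrow> j \<le> l \<Longrightarrow> s j < s i"
    and t: "\<And>i j. 1 \<le> i \<Longrightarrow> i < j \<Longrightarrow> j \<le> l \<Longrightarrow> t j < t i"
  shows "(\<Sum>c\<in>families n l s. \<Sum>d\<in>families n l t.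
      (\<Prod>j\<in>{1..l}. \<Prod>r\<le>n. Fa r (c j r)) * (\<Prod>j\<in>{1..l}. \<Prod>r\<le>n. Fb r (d j r)) *
      of_int (matching_sum l (\<lambda>j. c j 0) (\<lambda>j. d j 0))) =
    (\<Sum>(c, d) | config n l s t c d. (-1) ^ card (odd_overlaps l (\<lambda>i. c i 0) (\<lambda>i. d i 0)) *
      ((\<Prod>j\<in>{1..l}. \<Prod>r\<le>n. Fa r (c j r)) * (\<Prod>j\<in>{1..l}. \<Prod>r\<le>n. Fb r (d j r))))"
proof -
  let ?A = "\<lambda>c. \<Prod>j\<in>{1..l}. \<Prod>r\<le>n. Fa r (c j r)" and ?B = "\<lambda>d. \<Prod>j\<in>{1..l}. \<Prod>r\<le>n. Fb r (d j r)"
  let ?m = "\<lambda>v w. of_int (matching_sum l v w) :: 'a"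
  let ?C = "{c. c \<in> families n l s \<and> vertex_disjoint n l c}" and ?D = "{d. d \<in> families n l t \<and> vertex_disjoint n l d}"
  have inner: "(\<Sum>d\<in>families n l t. ?B d * ?m (\<lambda>j. c j 0) (\<lambda>j. d j 0)) =
      (\<Sum>d\<in>?D. ?B d * ?m (\<lambda>j. c j 0) (\<lambda>j. d j 0))" for c :: "nat \<Rightarrow> nat \<Rightarrow> int"
    by (rule sum_families_disjoint[where T = "?m (\<lambda>j. c j 0)"])
      (simp_all add: matching_sum_alternating matching_sum_repeated)
  have "(\<Sum>c\<in>families n l s. \<Sum>d\<in>families n l t. ?A c * ?B d * ?m (\<lambda>j. c j 0) (\<lambda>j. d j 0)) =
    (\<Sum>c\<in>families n l s. ?A c * (\<Sum>d\<in>families n l t. ?B d * ?m (\<lambda>j. c j 0) (\<lambda>j. d j 0)))"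
    by (simp only: sum_distrib_left mult.assoc)
  also have "\<dots> = (\<Sum>c\<in>families n l s. ?A c * (\<Sum>d\<in>?D. ?B d * ?m (\<lambda>j. c j 0) (\<lambda>j. d j 0)))"
    by (simp only: inner)
  also have "\<dots> = (\<Sum>c\<in>?C. ?A c * (\<Sum>d\<in>?D. ?B d * ?m (\<lambda>j. c j 0) (\<lambda>j. d j 0)))"
    by (rule sum_families_disjoint[where T = "\<lambda>v. \<Sum>d\<in>?D. ?B d * ?m v (\<lambda>j. d j 0)"])
       (simp_all add: matching_sum_alternating matching_sum_repeated sum_negf)
  also have "\<dots> = (\<Sum>(c, d)\<in>?C \<times> ?D. ?m (\<lambda>j. c j 0) (\<lambda>j. d j 0) * (?A c * ?B d))"
    by (simp only: sum_distrib_left sum.cartesian_product) (intro sum.cong HOL.refl, auto simp: ac_simps)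
  also have "\<dots> = (\<Sum>p\<in>?C \<times> ?D. if config n l s t (fst p) (snd p) then
      (case p of (c, d) \<Rightarrow> (-1) ^ card (odd_overlaps l (\<lambda>i. c i 0) (\<lambda>i. d i 0)) * (?A c * ?B d)) else 0)"
  proof (intro sum.cong HOL.refl)
    fix p assume "p \<in> ?C \<times> ?D"
    then obtain c d where p: "p = (c, d)" "c \<in> ?C" "d \<in> ?D" by auto
    have sd: "strict_dec l (\<lambda>j. c j 0)" "strict_dec l (\<lambda>j. d j 0)"
      using vertex_disjoint_strict[of c n l s, OF _ s] vertex_disjoint_strict[of d n l t, OF _ t] p
      by (auto simp: strict_dec_def)
    have conf: "config n l s t c d \<longleftrightarrow> interlaced l (\<lambda>j. c j 0) (\<lambda>j. d j 0)"
      using p by (auto simp: config_def)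
    have "matching_sum l (\<lambda>j. c j 0) (\<lambda>j. d j 0) =
      (if interlaced l (\<lambda>j. c j 0) (\<lambda>j. d j 0) then (-1) ^ card (odd_overlaps l (\<lambda>j. c j 0) (\<lambda>j. d j 0)) else 0)"
    proof (cases "interlaced l (\<lambda>j. c j 0) (\<lambda>j. d j 0)")
      case True
      then obtain \<sigma> where "{\<tau>. matching l (\<lambda>j. c j 0) (\<lambda>j. d j 0) \<tau>} = {\<sigma>}"
        "sign \<sigma> = (-1) ^ card (odd_overlaps l (\<lambda>j. c j 0) (\<lambda>j. d j 0))"
        using matching_dichotomy[OF sd] by metis
      then show ?thesis using True by (simp add: matching_sum_def)
    next
      case False
      then show ?thesis using matching_dichotomy[OF sd] by (simp add: matching_sum_def)
    qed
    then show "(case p of (c, d) \<Rightarrow> ?m (\<lambda>j. c j 0) (\<lambda>j. d j 0) * (?A c * ?B d)) =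
      (if config n l s t (fst p) (snd p) then
      (case p of (c, d) \<Rightarrow> (-1) ^ card (odd_overlaps l (\<lambda>i. c i 0) (\<lambda>i. d i 0)) * (?A c * ?B d)) else 0)"
      by (simp add: p(1) conf)
  qed
  also have "\<dots> = (\<Sum>p\<in>{p \<in> ?C \<times> ?D. config n l s t (fst p) (snd p)}.
      case p of (c, d) \<Rightarrow> (-1) ^ card (odd_overlaps l (\<lambda>i. c i 0) (\<lambda>i. d i 0)) * (?A c * ?B d))"
    by (rule sum.inter_filter[symmetric]) (auto simp: finite_families)
  also have "{p \<in> ?C \<times> ?D. config n l s t (fst p) (snd p)} = {(c, d). config n l s t c d}"
    by (auto simp: config_def)
  finally show ?thesis .
qed

section \<open>Tuples of paths\<close>

lemma conj_part_antimono:
  assumes "is_partition lam" "1 \<le> j" "j \<le> k"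
  shows "conj_part lam k \<le> conj_part lam j"
  unfolding conj_part_def
proof (rule card_mono)
  have "finite {i. 1 \<le> i \<and> lam i \<noteq> 0}" using assms(1) by (simp add: is_partition_def)
  then show "finite {i. 1 \<le> i \<and> j \<le> lam i}"
    by (rule rev_finite_subset) (use assms(2) in auto)
qed (use assms(3) in auto)

lemma low_top_strict:
  "is_partition mu \<Longrightarrow> 1 \<le> i \<Longrightarrow> i < j \<Longrightarrow> low_top n mu j < low_top n mu i"
  using conj_part_antimono[of mu i j] by (simp add: low_top_def)

lemma up_top_strict:
  "is_partition lam \<Longrightarrow> 1 \<le> i \<Longrightarrow> i < j \<Longrightarrow> up_top lam j < up_top lam i"
  using conj_part_antimono[of lam i j] by (simp add: up_top_def)

text \<open>Positivity in trail coordinates: there is no overlap in the top row.\<close>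

lemma low_up_top:
  "positivity n lam mu \<Longrightarrow> 1 \<le> i \<Longrightarrow> i < lam 1 \<Longrightarrow> up_top lam (Suc i) \<le> low_top n mu i"
  by (fastforce simp: positivity_def up_top_def low_top_def)

text \<open>Upper trails are numbered by their ends, as the \<beta> are, so path i continues with
  the trail of index \<open>\<sigma> i\<close>.\<close>

definition trail_tuple :: "nat \<Rightarrow> nat \<Rightarrow> (nat \<Rightarrow> nat) \<Rightarrow> (nat \<Rightarrow> nat \<Rightarrow> int) \<Rightarrow> (nat \<Rightarrow> nat \<Rightarrow> int) \<Rightarrow> nat \<Rightarrow> path" where
  "trail_tuple n l \<sigma> c d = (\<lambda>i\<in>{1..l}. trail_path n (c i) (d (\<sigma> i)))"

lemma matching_trails:
  assumes "c \<in> families n l s" "d \<in> families n l t" "matching l (\<lambda>i. c i 0) (\<lambda>i. d i 0) \<sigma>" "i \<in> {1..l}"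
  shows "c i \<in> trails n (s i)" "d (\<sigma> i) \<in> trails n (t (\<sigma> i))"
    "c i 0 < d (\<sigma> i) 0" "odd (d (\<sigma> i) 0 - c i 0)"
proof -
  have "\<sigma> i \<in> {1..l}" using assms(3,4) permutes_in_image[of \<sigma> "{1..l}" i] by (simp add: matching_def)
  then show "c i \<in> trails n (s i)" "d (\<sigma> i) \<in> trails n (t (\<sigma> i))"
    using assms(1,2,4) by (auto simp: families_def)
  show "c i 0 < d (\<sigma> i) 0" "odd (d (\<sigma> i) 0 - c i 0)" using assms(3,4) by (auto simp: matching_def)
qed

lemma path_tuples_iff:
  "p \<in> path_tuples n lam mu \<longleftrightarrow> (\<exists>\<sigma> c d. c \<in> families n (lam 1) (low_top n mu) \<and>
    d \<in> families n (lam 1) (up_top lam) \<and> matching (lam 1) (\<lambda>i. c i 0) (\<lambda>i. d i 0) \<sigma> \<and>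
    p = trail_tuple n (lam 1) \<sigma> c d)"
proof
  let ?I = "{1..lam 1}"
  assume "p \<in> path_tuples n lam mu"
  then obtain \<sigma> where p: "p \<in> ?I \<rightarrow>\<^sub>E {q. is_path n q}" and \<sigma>: "\<sigma> permutes ?I"
    and ends: "\<And>i. i \<in> ?I \<Longrightarrow> fst (p i) = start_pt n mu i \<and> path_end (p i) = end_pt n lam (\<sigma> i)"
    by (auto simp: path_tuples_def)
  have "\<exists>c d. c \<in> trails n (low_top n mu i) \<and> d \<in> trails n (up_top lam (\<sigma> i)) \<and>
      c 0 < d 0 \<and> odd (d 0 - c 0) \<and> p i = trail_path n c d" if i: "i \<in> ?I" for i
  proof -
    have "is_path n (p i)" using p i by auto
    then obtain c d where "c \<in> trails n (fst (fst (p i)) + int n - 1)" "d \<in> trails n (fst (path_end (p i)))"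
      "c 0 < d 0" "odd (d 0 - c 0)" "p i = trail_path n c d" by (rule path_is_trail_path)
    moreover have "fst (fst (p i)) + int n - 1 = low_top n mu i" "fst (path_end (p i)) = up_top lam (\<sigma> i)"
      using ends[OF i] by (simp_all add: start_pt_def end_pt_def low_top_def up_top_def)
    ultimately show ?thesis by metis
  qed
  then obtain C D where CD: "\<And>i. i \<in> ?I \<Longrightarrow> C i \<in> trails n (low_top n mu i) \<and> D i \<in> trails n (up_top lam (\<sigma> i)) \<and>
      C i 0 < D i 0 \<and> odd (D i 0 - C i 0) \<and> p i = trail_path n (C i) (D i)" by metis
  define c where "c = restrict C ?I"
  define d where "d = (\<lambda>j\<in>?I. D (inv_into UNIV \<sigma> j))"
  have img: "\<sigma> i \<in> ?I" "inv_into UNIV \<sigma> i \<in> ?I" if "i \<in> ?I" for i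
    using permutes_in_image[OF \<sigma>] permutes_in_image[OF permutes_inv[OF \<sigma>]] that by blast+
  have ds: "d (\<sigma> i) = D i" if "i \<in> ?I" for i
    using img that by (simp add: d_def permutes_inverses[OF \<sigma>])
  have "c \<in> families n (lam 1) (low_top n mu)" using CD by (simp add: families_def c_def)
  moreover have "d \<in> families n (lam 1) (up_top lam)"
    unfolding families_def d_def
  proof (rule restrict_PiE_iff[THEN iffD2], rule ballI)
    fix j assume "j \<in> ?I"
    then show "D (inv_into UNIV \<sigma> j) \<in> trails n (up_top lam j)"
      using CD[OF img(2)] by (simp add: permutes_inverses[OF \<sigma>])
  qed
  moreover have "matching (lam 1) (\<lambda>i. c i 0) (\<lambda>i. d i 0) \<sigma>"
    unfolding matching_def using \<sigma> CD ds by (simp add: c_def)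
  moreover have "p = trail_tuple n (lam 1) \<sigma> c d"
  proof
    fix i
    show "p i = trail_tuple n (lam 1) \<sigma> c d i"
    proof (cases "i \<in> ?I")
      case True then show ?thesis using CD ds by (simp add: trail_tuple_def c_def)
    next
      case False then show ?thesis using p by (auto simp: trail_tuple_def PiE_def extensional_def)
    qed
  qed
  ultimately show "\<exists>\<sigma> c d. c \<in> families n (lam 1) (low_top n mu) \<and>
    d \<in> families n (lam 1) (up_top lam) \<and> matching (lam 1) (\<lambda>i. c i 0) (\<lambda>i. d i 0) \<sigma> \<and>
    p = trail_tuple n (lam 1) \<sigma> c d" by blast
next
  let ?I = "{1..lam 1}"
  assume "\<exists>\<sigma> c d. c \<in> families n (lam 1) (low_top n mu) \<and>
    d \<in> families n (lam 1) (up_top lam) \<and> matching (lam 1) (\<lambda>i. c i 0) (\<lambda>i. d i 0) \<sigma> \<and>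
    p = trail_tuple n (lam 1) \<sigma> c d"
  then obtain \<sigma> c d where cd: "c \<in> families n (lam 1) (low_top n mu)" "d \<in> families n (lam 1) (up_top lam)"
    "matching (lam 1) (\<lambda>i. c i 0) (\<lambda>i. d i 0) \<sigma>" and p: "p = trail_tuple n (lam 1) \<sigma> c d" by blast
  note mt = matching_trails[OF cd]
  have "p \<in> ?I \<rightarrow>\<^sub>E {q. is_path n q}"
    unfolding p trail_tuple_def using is_path_trail[OF mt] by auto
  moreover have "fst (p i) = start_pt n mu i \<and> path_end (p i) = end_pt n lam (\<sigma> i)" if i: "i \<in> ?I" for i
  proof -
    have "c i n = low_top n mu i" "d (\<sigma> i) n = up_top lam (\<sigma> i)" using mt(1,2)[OF i] by (auto simp: trails_def)
    then show ?thesis using path_end_trail[OF mt[OF i]] i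
      by (simp add: p trail_tuple_def trail_path_def start_pt_def end_pt_def low_top_def up_top_def)
  qed
  moreover have "\<sigma> permutes ?I" using cd(3) by (simp add: matching_def)
  ultimately show "p \<in> path_tuples n lam mu" unfolding path_tuples_def by blast
qed

text \<open>A common point off height 0 is a common vertex of two lower or two upper trails. At
  height 0 common points matter for left ends of equal parity, which equal left ends have trivially,
  and equal right ends because both differences \<open>d 0 - c 0\<close> and
  \<open>d' 0 - c' 0\<close> are odd.\<close>

lemma not_ordinarily_iff:
  assumes 1: "c \<in> trails n s" "d \<in> trails n t" "c 0 < d 0" "odd (d 0 - c 0)"
    and 2: "c' \<in> trails n s'" "d' \<in> trails n t'" "c' 0 < d' 0" "odd (d' 0 - c' 0)"
  shows "\<not> ordinarily_intersecting (trail_path n c d) (trail_path n c' d') \<longleftrightarrow>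
    (\<forall>r\<le>n. c r \<noteq> c' r) \<and> (\<forall>r\<le>n. d r \<noteq> d' r) \<and> (even (c 0 - c' 0) \<longrightarrow> d 0 \<le> c' 0 \<or> d' 0 \<le> c 0)"
    (is "\<not> ordinarily_intersecting ?p ?q \<longleftrightarrow> ?R")
proof -
  let ?X = "vertices ?p \<inter> vertices ?q"
  have par: "(\<exists>k::int. odd k \<and> hp0 ?p - hp0 ?q = of_int k) \<longleftrightarrow> odd (c 0 - c' 0)"
  proof -
    have "hp0 ?p - hp0 ?q = of_int (c 0 - c' 0)" using hp0_trail[OF 1] hp0_trail[OF 2] by simp
    then show ?thesis by (metis of_int_eq_iff)
  qed
  have ord: "ordinarily_intersecting ?p ?q \<longleftrightarrow> (\<exists>w\<in>?X. ht w \<noteq> 0 \<or> even (c 0 - c' 0))"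
    unfolding ordinarily_intersecting_def specially_intersecting_def intersecting_def par by blast
  note v1 = vertices_trail[OF 1] and v2 = vertices_trail[OF 2]
  have low: "w = (c r - int r + 1, - c r - 1) \<and> w = (c' r - int r + 1, - c' r - 1)"
    if "w \<in> ?X" "ht w = - int r" "0 < r" for w r
    using that unfolding Int_iff v1 v2 by (auto simp: ht_def)
  have up: "w = (d r, int r - d r) \<and> w = (d' r, int r - d' r)"
    if "w \<in> ?X" "ht w = int r" "0 < r" for w r
    using that unfolding Int_iff v1 v2 by (auto simp: ht_def)
  have mid1: "c 0 < fst w \<and> fst w \<le> d 0" if "w \<in> vertices ?p" "ht w = 0" for w
    using that 1(3) unfolding v1 by (auto simp: ht_def)
  have mid2: "c' 0 < fst w \<and> fst w \<le> d' 0" if "w \<in> vertices ?q" "ht w = 0" for w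
    using that 2(3) unfolding v2 by (auto simp: ht_def)
  have bound: "\<bar>ht w\<bar> \<le> int n" if "w \<in> ?X" for w
    using that unfolding Int_iff v1 by (auto simp: ht_def)
  show ?thesis
  proof
    assume no: "\<not> ordinarily_intersecting ?p ?q"
    have "c r \<noteq> c' r" if r: "r \<le> n" for r
    proof
      assume e: "c r = c' r"
      then have "(c r - int r + 1, - c r - 1) \<in> ?X" using r unfolding Int_iff v1 v2 by auto
      moreover have "ht (c r - int r + 1, - c r - 1) \<noteq> 0 \<or> even (c 0 - c' 0)"
        using e by (cases "r = 0") (auto simp: ht_def)
      ultimately show False using no ord by blast
    qed
    moreover have "d r \<noteq> d' r" if r: "r \<le> n" for r
    proof
      assume e: "d r = d' r"
      then have "(d r, int r - d r) \<in> ?X" using r unfolding Int_iff v1 v2 by auto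
      moreover have "ht (d r, int r - d r) \<noteq> 0 \<or> even (c 0 - c' 0)"
      proof (cases "r = 0")
        case True then show ?thesis using e 1(4) 2(4) by presburger
      qed (simp add: ht_def)
      ultimately show False using no ord by blast
    qed
    moreover have "d 0 \<le> c' 0 \<or> d' 0 \<le> c 0" if "even (c 0 - c' 0)"
    proof (rule ccontr)
      assume *: "\<not> (d 0 \<le> c' 0 \<or> d' 0 \<le> c 0)"
      let ?x = "max (c 0) (c' 0) + 1"
      have "c 0 < ?x" "?x \<le> d 0" "c' 0 < ?x" "?x \<le> d' 0" using * 1(3) 2(3) by auto
      then have "(?x, - ?x) \<in> ?X" unfolding Int_iff v1 v2 by blast
      then show False using no ord that by blast
    qed
    ultimately show ?R by blast
  next
    assume R: ?R
    show "\<not> ordinarily_intersecting ?p ?q"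
    proof
      assume "ordinarily_intersecting ?p ?q"
      then obtain w where w: "w \<in> ?X" "ht w \<noteq> 0 \<or> even (c 0 - c' 0)" using ord by blast
      consider "ht w = 0" | "0 < ht w" | "ht w < 0" by linarith
      then show False
      proof cases
        case 1 then show False using mid1[of w] mid2[of w] w R by auto
      next
        case 2
        then obtain r where r: "ht w = int r" "0 < r" using zero_less_imp_eq_int by blast
        then have "r \<le> n" using bound[OF w(1)] by simp
        then show False using up[OF w(1) r] R by auto
      next
        case 3
        then obtain r where r: "- ht w = int r" "0 < r" using zero_less_imp_eq_int[of "- ht w"] by auto
        then have "r \<le> n" using bound[OF w(1)] by simp
        then show False using low[OF w(1) _ r(2)] r R by auto
      qed
    qed
  qed
qed

lemma no_ordinary_pair_iff:
  assumes "c \<in> families n l s" "d \<in> families n l t" "matching l (\<lambda>i. c i 0) (\<lambda>i. d i 0) \<sigma>"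
  shows "(\<forall>i\<in>{1..l}. \<forall>j\<in>{1..l}. i \<noteq> j \<longrightarrow>
      \<not> ordinarily_intersecting (trail_tuple n l \<sigma> c d i) (trail_tuple n l \<sigma> c d j)) \<longleftrightarrow>
    vertex_disjoint n l c \<and> vertex_disjoint n l d \<and> separated l (\<lambda>i. c i 0) (\<lambda>i. d i 0) \<sigma>"
proof -
  let ?I = "{1..l}"
  note mt = matching_trails[OF assms]
  have \<sigma>: "\<sigma> permutes ?I" using assms(3) by (simp add: matching_def)
  have "(\<forall>i\<in>?I. \<forall>j\<in>?I. i \<noteq> j \<longrightarrow>
      \<not> ordinarily_intersecting (trail_tuple n l \<sigma> c d i) (trail_tuple n l \<sigma> c d j)) \<longleftrightarrow>
    (\<forall>i\<in>?I. \<forall>j\<in>?I. i \<noteq> j \<longrightarrow> (\<forall>r\<le>n. c i r \<noteq> c j r) \<and> (\<forall>r\<le>n. d (\<sigma> i) r \<noteq> d (\<sigma> j) r) \<and>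
      (even (c i 0 - c j 0) \<longrightarrow> d (\<sigma> i) 0 \<le> c j 0 \<or> d (\<sigma> j) 0 \<le> c i 0))"
  proof (intro ball_cong HOL.refl imp_cong)
    fix i j assume ij: "i \<in> ?I" "j \<in> ?I"
    show "(\<not> ordinarily_intersecting (trail_tuple n l \<sigma> c d i) (trail_tuple n l \<sigma> c d j)) \<longleftrightarrow>
      (\<forall>r\<le>n. c i r \<noteq> c j r) \<and> (\<forall>r\<le>n. d (\<sigma> i) r \<noteq> d (\<sigma> j) r) \<and>
      (even (c i 0 - c j 0) \<longrightarrow> d (\<sigma> i) 0 \<le> c j 0 \<or> d (\<sigma> j) 0 \<le> c i 0)"
      using not_ordinarily_iff[OF mt[OF ij(1)] mt[OF ij(2)]] ij by (simp add: trail_tuple_def)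
  qed
  also have "\<dots> \<longleftrightarrow> vertex_disjoint n l c \<and>
      (\<forall>i\<in>?I. \<forall>j\<in>?I. i \<noteq> j \<longrightarrow> (\<forall>r\<le>n. d (\<sigma> i) r \<noteq> d (\<sigma> j) r)) \<and>
      separated l (\<lambda>i. c i 0) (\<lambda>i. d i 0) \<sigma>"
    unfolding vertex_disjoint_def inj_on_def separated_def by blast
  also have "(\<forall>i\<in>?I. \<forall>j\<in>?I. i \<noteq> j \<longrightarrow> (\<forall>r\<le>n. d (\<sigma> i) r \<noteq> d (\<sigma> j) r)) \<longleftrightarrow> vertex_disjoint n l d"
  proof -
    have "(\<forall>i\<in>?I. \<forall>j\<in>?I. i \<noteq> j \<longrightarrow> (\<forall>r\<le>n. d (\<sigma> i) r \<noteq> d (\<sigma> j) r)) \<longleftrightarrow>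
      (\<forall>i\<in>?I. \<forall>j\<in>?I. \<sigma> i \<noteq> \<sigma> j \<longrightarrow> (\<forall>r\<le>n. d (\<sigma> i) r \<noteq> d (\<sigma> j) r))"
      using permutes_inj[OF \<sigma>] by (simp add: inj_eq)
    also have "\<dots> \<longleftrightarrow> (\<forall>i\<in>\<sigma> ` ?I. \<forall>j\<in>\<sigma> ` ?I. i \<noteq> j \<longrightarrow> (\<forall>r\<le>n. d i r \<noteq> d j r))" by blast
    finally show ?thesis unfolding permutes_image[OF \<sigma>] vertex_disjoint_def inj_on_def by blast
  qed
  finally show ?thesis .
qed

section \<open>Configurations and the tuples of \<open>P2\<close>\<close>

context
  fixes n :: nat and lam mu :: "nat \<Rightarrow> nat"
  assumes skew: "skew_diagram lam mu" and pos: "positivity n lam mu"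
begin

private abbreviation "l \<equiv> lam 1"
private abbreviation "s \<equiv> low_top n mu"
private abbreviation "t \<equiv> up_top lam"

lemma s_dec: "1 \<le> i \<Longrightarrow> i < j \<Longrightarrow> j \<le> l \<Longrightarrow> s j < s i"
  and t_dec: "1 \<le> i \<Longrightarrow> i < j \<Longrightarrow> j \<le> l \<Longrightarrow> t j < t i"
  and t_le_s: "1 \<le> i \<Longrightarrow> i < l \<Longrightarrow> t (Suc i) \<le> s i"
  using skew low_top_strict up_top_strict low_up_top[OF pos] by (auto simp: skew_diagram_def)

lemma family_rows:
  assumes "config n l s t c d"
  shows "strict_dec l (\<lambda>i. c i 0)" "strict_dec l (\<lambda>i. d i 0)"
  using assms vertex_disjoint_strict[of c n l s, OF _ s_dec] vertex_disjoint_strict[of d n l t, OF _ t_dec]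
  by (auto simp: strict_dec_def config_def)

definition partner :: "(nat \<Rightarrow> nat \<Rightarrow> int) \<Rightarrow> (nat \<Rightarrow> nat \<Rightarrow> int) \<Rightarrow> nat \<Rightarrow> nat" where
  "partner c d = (THE \<sigma>. matching l (\<lambda>i. c i 0) (\<lambda>i. d i 0) \<sigma>)"

lemma partner:
  assumes "config n l s t c d"
  shows "matching l (\<lambda>i. c i 0) (\<lambda>i. d i 0) \<sigma> \<longleftrightarrow> \<sigma> = partner c d"
    and "separated l (\<lambda>i. c i 0) (\<lambda>i. d i 0) (partner c d)"
proof -
  have "interlaced l (\<lambda>i. c i 0) (\<lambda>i. d i 0)" using assms by (simp add: config_def)
  then obtain \<tau> where \<tau>: "{\<tau>. matching l (\<lambda>i. c i 0) (\<lambda>i. d i 0) \<tau>} = {\<tau>}"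
    "separated l (\<lambda>i. c i 0) (\<lambda>i. d i 0) \<tau>" using matching_dichotomy[OF family_rows[OF assms]] by metis
  then have eq: "matching l (\<lambda>i. c i 0) (\<lambda>i. d i 0) \<sigma> \<longleftrightarrow> \<sigma> = \<tau>" for \<sigma> by blast
  then have "partner c d = \<tau>" by (simp add: partner_def)
  then show "matching l (\<lambda>i. c i 0) (\<lambda>i. d i 0) \<sigma> \<longleftrightarrow> \<sigma> = partner c d"
    "separated l (\<lambda>i. c i 0) (\<lambda>i. d i 0) (partner c d)" using eq \<tau> by auto
qed

text \<open>The ends v_i are distinct, so \<open>betas\<close> picks the path with
  \<open>\<sigma> j = i\<close>, and its upper part is the trail \<open>d i\<close>.\<close>

lemma tuple_regions:
  assumes c: "config n l s t c d" and m: "matching l (\<lambda>i. c i 0) (\<lambda>i. d i 0) \<sigma>"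
  defines "p \<equiv> trail_tuple n l \<sigma> c d"
  shows "(\<exists>V. odd_I_region n l (alphas n p) (betas n lam p) V \<or> odd_II_region n l (alphas n p) (betas n lam p) V)
    \<longleftrightarrow> (\<exists>C. odd_region n l c d C)"
proof -
  have fam: "c \<in> families n l s" "d \<in> families n l t" using c by (auto simp: config_def)
  note mt = matching_trails[OF fam m]
  have \<sigma>: "\<sigma> permutes {1..l}" using m by (simp add: matching_def)
  have al: "alphas n p i = lower_path n (trail_path n (c i) (d (\<sigma> i)))" if "i \<in> {1..l}" for i
    using that by (simp add: alphas_def p_def trail_tuple_def)
  have be: "\<exists>j\<in>{1..l}. \<sigma> j = i \<and> betas n lam p i = upper_path n (trail_path n (c j) (d (\<sigma> j)))"
    if i: "i \<in> {1..l}" for i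
  proof -
    have "i \<in> \<sigma> ` {1..l}" unfolding permutes_image[OF \<sigma>] by (rule i)
    then obtain j where j: "j \<in> {1..l}" "\<sigma> j = i" by blast
    have end_eq: "path_end (p k) = end_pt n lam (\<sigma> k)" if k: "k \<in> {1..l}" for k
    proof -
      have "d (\<sigma> k) n = t (\<sigma> k)" using mt(2)[OF k] by (simp add: trails_def)
      then show ?thesis using path_end_trail[OF mt[OF k]] k
        by (simp add: p_def trail_tuple_def end_pt_def up_top_def)
    qed
    have "(THE k. k \<in> {1..l} \<and> path_end (p k) = end_pt n lam i) = j"
    proof (rule the_equality)
      show "j \<in> {1..l} \<and> path_end (p j) = end_pt n lam i" using j end_eq by simp
      fix k assume k: "k \<in> {1..l} \<and> path_end (p k) = end_pt n lam i"
      then have "end_pt n lam (\<sigma> k) = end_pt n lam i" using end_eq[of k] by metis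
      then have "t (\<sigma> k) = t i" by (simp add: end_pt_def up_top_def)
      moreover have "\<sigma> k \<in> {1..l}" using k permutes_in_image[OF \<sigma>] by blast
      ultimately have "\<sigma> k = i" using t_dec[of "\<sigma> k" i] t_dec[of i "\<sigma> k"] i
        by (cases "\<sigma> k" i rule: linorder_cases) auto
      then show "k = j" using j permutes_inj[OF \<sigma>] by (metis injD)
    qed
    then show ?thesis using j by (intro bexI[of _ j]) (simp_all add: betas_def p_def trail_tuple_def)
  qed
  show ?thesis
  proof (rule odd_region_iff[where a = c and b = d and s = s and t = t])
    fix i r assume i: "1 \<le> i" "i \<le> l" "r \<le> n"
    then have I: "i \<in> {1..l}" by simp
    show "pos_at (alphas n p i) (- int r) = of_int (c i r + 1) - real r / 2"
      unfolding al[OF I] by (rule pos_at_lower[OF mt[OF I] i(3)])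
    obtain j where j: "j \<in> {1..l}" "\<sigma> j = i" "betas n lam p i = upper_path n (trail_path n (c j) (d (\<sigma> j)))"
      using be[OF I] by blast
    show "pos_at (betas n lam p i) (int r) = of_int (d i r) - real r / 2"
      unfolding j(3) using pos_at_upper[OF mt[OF j(1)] i(3)] j(2) by simp
  next
    fix i assume i: "1 \<le> i" "i \<le> l"
    then have I: "i \<in> {1..l}" by simp
    show "path_end (alphas n p i) = (c i 0 + 1, - c i 0 - 1)"
      unfolding al[OF I] by (rule path_end_lower[OF mt[OF I]])
    obtain j where j: "j \<in> {1..l}" "\<sigma> j = i" "betas n lam p i = upper_path n (trail_path n (c j) (d (\<sigma> j)))"
      using be[OF I] by blast
    show "fst (betas n lam p i) = (d i 0, - d i 0)"
      unfolding j(3) using fst_upper_path[OF mt[OF j(1)]] j(2) by simp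
  qed (use c s_dec t_dec t_le_s in auto)
qed

text \<open>Absence of ordinary pairs means disjoint families with a separated matching. By the
  dichotomy such a matching exists only for interlaced rows, and is then the only matching.\<close>

lemma P2_eq: "P2 n lam mu = (\<lambda>(c, d). trail_tuple n l (partner c d) c d) `
    {(c, d). config n l s t c d \<and> (\<forall>C. \<not> odd_region n l c d C)}" (is "_ = ?f ` ?G")
proof (intro equalityI subsetI)
  fix p assume "p \<in> P2 n lam mu"
  then have p: "p \<in> path_tuples n lam mu"
    "\<forall>i\<in>{1..l}. \<forall>j\<in>{1..l}. i \<noteq> j \<longrightarrow> \<not> ordinarily_intersecting (p i) (p j)"
    "\<nexists>V. odd_I_region n l (alphas n p) (betas n lam p) V \<or> odd_II_region n l (alphas n p) (betas n lam p) V"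
    by (auto simp: P2_def)
  obtain \<sigma> c d where cd: "c \<in> families n l s" "d \<in> families n l t"
    and m: "matching l (\<lambda>i. c i 0) (\<lambda>i. d i 0) \<sigma>" and pe: "p = trail_tuple n l \<sigma> c d"
    using p(1) unfolding path_tuples_iff by blast
  have dis: "vertex_disjoint n l c" "vertex_disjoint n l d" "separated l (\<lambda>i. c i 0) (\<lambda>i. d i 0) \<sigma>"
    using p(2) no_ordinary_pair_iff[OF cd m] unfolding pe by blast+
  have sd: "strict_dec l (\<lambda>i. c i 0)" "strict_dec l (\<lambda>i. d i 0)"
    using vertex_disjoint_strict[OF cd(1) s_dec dis(1)] vertex_disjoint_strict[OF cd(2) t_dec dis(2)]
    by (auto simp: strict_dec_def)
  have "interlaced l (\<lambda>i. c i 0) (\<lambda>i. d i 0)"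
    using matching_dichotomy[OF sd] m dis(3) by blast
  then have conf: "config n l s t c d" using cd dis by (simp add: config_def)
  have "\<sigma> = partner c d" using partner(1)[OF conf] m by blast
  moreover have "\<forall>C. \<not> odd_region n l c d C"
    using tuple_regions[OF conf m] p(3) unfolding pe by blast
  ultimately show "p \<in> ?f ` ?G" using conf pe by auto
next
  fix p assume "p \<in> ?f ` ?G"
  then obtain c d where conf: "config n l s t c d" and no: "\<forall>C. \<not> odd_region n l c d C"
    and pe: "p = trail_tuple n l (partner c d) c d" by auto
  have cd: "c \<in> families n l s" "d \<in> families n l t" "vertex_disjoint n l c" "vertex_disjoint n l d"
    using conf by (auto simp: config_def)
  have m: "matching l (\<lambda>i. c i 0) (\<lambda>i. d i 0) (partner c d)" using partner(1)[OF conf] by blast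
  have "p \<in> path_tuples n lam mu" unfolding path_tuples_iff using cd m pe by blast
  moreover have "\<forall>i\<in>{1..l}. \<forall>j\<in>{1..l}. i \<noteq> j \<longrightarrow> \<not> ordinarily_intersecting (p i) (p j)"
    unfolding pe no_ordinary_pair_iff[OF cd(1,2) m] using cd partner(2)[OF conf] by blast
  moreover have "\<nexists>V. odd_I_region n l (alphas n p) (betas n lam p) V \<or> odd_II_region n l (alphas n p) (betas n lam p) V"
    unfolding pe tuple_regions[OF conf m] using no by blast
  ultimately show "p \<in> P2 n lam mu" by (simp add: P2_def)
qed

text \<open>The vertices of a path determine both of its trails, and the ends, being distinct,
  determine the permutation that numbers the upper ones.\<close>

lemma inj_on_trail_tuple: "inj_on (\<lambda>(c, d). trail_tuple n l (partner c d) c d) {(c, d). config n l s t c d}"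
proof (rule inj_onI, clarify)
  fix c d c' d' assume conf: "config n l s t c d" and conf': "config n l s t c' d'"
    and eq: "trail_tuple n l (partner c d) c d = trail_tuple n l (partner c' d') c' d'"
  let ?\<sigma> = "partner c d" and ?\<sigma>' = "partner c' d'"
  have fam: "c \<in> families n l s" "d \<in> families n l t" and fam': "c' \<in> families n l s" "d' \<in> families n l t"
    using conf conf' by (auto simp: config_def)
  have m: "matching l (\<lambda>i. c i 0) (\<lambda>i. d i 0) ?\<sigma>" using partner(1)[OF conf] by blast
  have m': "matching l (\<lambda>i. c' i 0) (\<lambda>i. d' i 0) ?\<sigma>'" using partner(1)[OF conf'] by blast
  note mt = matching_trails[OF fam m] and mt' = matching_trails[OF fam' m']
  have perm: "?\<sigma> permutes {1..l}" "?\<sigma>' permutes {1..l}" using m m' by (auto simp: matching_def)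
  have ext: "x = y" if "x \<in> trails n u" "y \<in> trails n v" "\<And>r. r \<le> n \<Longrightarrow> x r = y r" for x y u v
  proof
    fix r show "x r = y r"
      using that by (cases "r \<le> n") (auto simp: trails_def PiE_def extensional_def)
  qed
  have *: "c i = c' i \<and> d (?\<sigma> i) = d' (?\<sigma>' i)" if i: "i \<in> {1..l}" for i
  proof -
    let ?q = "trail_path n (c i) (d (?\<sigma> i))"
    have q: "?q = trail_path n (c' i) (d' (?\<sigma>' i))"
      using fun_cong[OF eq, of i] i by (simp add: trail_tuple_def)
    have "c i r = c' i r" if r: "r \<le> n" for r
      using vertex_low[OF mt[OF i], of "n - r"] vertex_low[OF mt'[OF i], of "n - r"] r unfolding q by simp
    moreover have "d (?\<sigma> i) r = d' (?\<sigma>' i) r" if r: "r \<le> n" for r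
      using vertex_upper_path[OF mt[OF i] r] vertex_upper_path[OF mt'[OF i] r] unfolding q by simp
    ultimately show ?thesis using ext mt(1,2)[OF i] mt'(1,2)[OF i] by metis
  qed
  have **: "?\<sigma> i = ?\<sigma>' i" if i: "i \<in> {1..l}" for i
  proof -
    have "t (?\<sigma> i) = t (?\<sigma>' i)" using * mt(2)[OF i] mt'(2)[OF i] i by (simp add: trails_def)
    moreover have "?\<sigma> i \<in> {1..l}" "?\<sigma>' i \<in> {1..l}"
      using i by (simp_all only: permutes_in_image[OF perm(1)] permutes_in_image[OF perm(2)])
    ultimately show ?thesis using t_dec[of "?\<sigma> i" "?\<sigma>' i"] t_dec[of "?\<sigma>' i" "?\<sigma> i"]
      by (cases "?\<sigma> i" "?\<sigma>' i" rule: linorder_cases) auto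
  qed
  have "c = c'"
  proof
    fix i show "c i = c' i"
      using * fam(1) fam'(1) by (cases "i \<in> {1..l}") (auto simp: families_def PiE_def extensional_def)
  qed
  moreover have "d = d'"
  proof
    fix j show "d j = d' j"
    proof (cases "j \<in> {1..l}")
      case True
      then have "j \<in> ?\<sigma> ` {1..l}" unfolding permutes_image[OF perm(1)] .
      then obtain i where i: "i \<in> {1..l}" "?\<sigma> i = j" by blast
      then show ?thesis using * ** by metis
    next
      case False then show ?thesis using fam(2) fam'(2) by (auto simp: families_def PiE_def extensional_def)
    qed
  qed
  ultimately show "c = c' \<and> d = d'" by blast
qed

end

theorem theorem4p13:
  fixes lam mu :: "nat \<Rightarrow> nat" and a :: complex
  assumes "skew_diagram lam mu"
    and "positivity CARD('n::finite) lam mu"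
  shows "(chi lam mu a :: 'n zring) = (\<Sum>p\<in>P2 CARD('n) lam mu. tuple_weight (lam 1) a p)"
proof -
  let ?n = "CARD('n)" and ?l = "lam 1" and ?s = "low_top CARD('n) mu" and ?t = "up_top lam"
  obtain Fa Fb :: "nat \<Rightarrow> int \<Rightarrow> 'n zring" where
    F: "\<And>c d s t. c \<in> trails ?n s \<Longrightarrow> d \<in> trails ?n t \<Longrightarrow>
      (\<Prod>r<?n. low_step ?n a r (c r) (c (Suc r))) * E_run a (c 0 + 1) (d 0) *
      (\<Prod>r<?n. up_step ?n a r (d r) (d (Suc r))) =
      (if c 0 < d 0 \<and> odd (d 0 - c 0)
       then (\<Prod>r\<le>?n. Fa r (c r)) * (\<Prod>r\<le>?n. Fb r (d r)) else 0)"
    and F2: "\<And>r x y. r \<le> ?n \<Longrightarrow> Fa r x * Fb r y = Fa r y * Fb r x"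
    by (rule vertex_weights[of a]) (rule that)
  let ?A = "\<lambda>c. \<Prod>j\<in>{1..?l}. \<Prod>r\<le>?n. Fa r (c j r)" and ?B = "\<lambda>d. \<Prod>j\<in>{1..?l}. \<Prod>r\<le>?n. Fb r (d j r)"
  let ?G = "{(c, d). config ?n ?l ?s ?t c d \<and> (\<forall>C. \<not> odd_region ?n ?l c d C)}"
  note dec = s_dec[OF assms] t_dec[OF assms] t_le_s[OF assms]
  have entry: "chi_entry lam mu a i j = (\<Sum>c\<in>trails ?n (?s j). \<Sum>d\<in>trails ?n (?t i).
      if c 0 < d 0 \<and> odd (d 0 - c 0)
      then (\<Prod>r\<le>?n. Fa r (c r)) * (\<Prod>r\<le>?n. Fb r (d r)) else 0)" for i j
    by (rule chi_entry_trails) (rule F)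
  have "chi lam mu a = (\<Sum>\<sigma> | \<sigma> permutes {1..?l}. of_int (sign \<sigma>) *
      (\<Prod>j\<in>{1..?l}. chi_entry lam mu a (\<sigma> j) j :: 'n zring))"
    unfolding chi_def by (rule det_permutes_Suc)
  also have "\<dots> = (\<Sum>c\<in>families ?n ?l ?s. \<Sum>d\<in>families ?n ?l ?t. ?A c * ?B d *
      of_int (matching_sum ?l (\<lambda>j. c j 0) (\<lambda>j. d j 0)))"
    unfolding entry by (rule signed_families_sum)
  also have "\<dots> = (\<Sum>(c, d) | config ?n ?l ?s ?t c d.
      (-1) ^ card (odd_overlaps ?l (\<lambda>i. c i 0) (\<lambda>i. d i 0)) * (?A c * ?B d))"
    by (rule signed_families_config) (use dec in auto)
  also have "\<dots> = (\<Sum>(c, d)\<in>?G. ?A c * ?B d)"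
    by (rule sum_config_signed[OF F2]) (use dec in auto)
  also have "\<dots> = (\<Sum>(c, d)\<in>?G. tuple_weight ?l a (trail_tuple ?n ?l (partner lam c d) c d))"
  proof (rule sum.cong[OF HOL.refl], clarify)
    fix c d assume conf: "config ?n ?l ?s ?t c d"
    let ?\<sigma> = "partner lam c d"
    have fam: "c \<in> families ?n ?l ?s" "d \<in> families ?n ?l ?t" using conf by (auto simp: config_def)
    have m: "matching ?l (\<lambda>i. c i 0) (\<lambda>i. d i 0) ?\<sigma>" using partner(1)[OF assms conf] by blast
    note mt = matching_trails[OF fam m]
    have "tuple_weight ?l a (trail_tuple ?n ?l ?\<sigma> c d) =
      (\<Prod>j\<in>{1..?l}. (\<Prod>r\<le>?n. Fa r (c j r)) * (\<Prod>r\<le>?n. Fb r (d (?\<sigma> j) r)))"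
      unfolding tuple_weight_def
    proof (rule prod.cong[OF HOL.refl])
      fix j assume j: "j \<in> {1..?l}"
      show "path_weight a (trail_tuple ?n ?l ?\<sigma> c d j) = (\<Prod>r\<le>?n. Fa r (c j r)) * (\<Prod>r\<le>?n. Fb r (d (?\<sigma> j) r))"
        using j path_weight_trail[OF mt[OF j], of a] F[OF mt(1,2)[OF j]] mt(3,4)[OF j]
        by (simp add: trail_tuple_def)
    qed
    also have "\<dots> = ?A c * (\<Prod>j\<in>{1..?l}. \<Prod>r\<le>?n. Fb r (d (?\<sigma> j) r))" by (rule prod.distrib)
    also have "(\<Prod>j\<in>{1..?l}. \<Prod>r\<le>?n. Fb r (d (?\<sigma> j) r)) = ?B d"
    proof -
      have "?\<sigma> permutes {1..?l}" using m by (simp add: matching_def)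
      from prod.permute[OF this, of "\<lambda>j. \<Prod>r\<le>?n. Fb r (d j r)"] show ?thesis by (simp add: comp_def)
    qed
    finally show "?A c * ?B d = tuple_weight ?l a (trail_tuple ?n ?l ?\<sigma> c d)" by simp
  qed
  also have "\<dots> = (\<Sum>p\<in>P2 ?n lam mu. tuple_weight ?l a p)"
  proof -
    have "inj_on (\<lambda>(c, d). trail_tuple ?n ?l (partner lam c d) c d) ?G"
      by (rule inj_on_subset[OF inj_on_trail_tuple[OF assms]]) auto
    then show ?thesis unfolding P2_eq[OF assms] by (subst sum.reindex) (simp_all add: comp_def case_prod_beta)
  qed
  finally show ?thesis .
qed

end
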